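(* Let $\mathcal{A}$ be a rigid abelian $\otimes$-category with unit object $\mathbf{1}$. Then the commutative ring $Z=Z(\mathcal{A})=\operatorname{End}_{\mathcal{A}}(\mathbf{1})$ is absolutely flat. The class $\mathbf{U}$ of subobjects of $\mathbf{1}$ is a set which is in one-to-one correspondence with the set of open-closed (clopen) subsets of the topological space underlying $\operatorname{Spec} Z$. This correspondence is non-decreasing (for the inclusion relation in both sets), respects intersections, and exchanges union in $\operatorname{Spec} Z$ with sum in $\mathbf{U}$.
   Context: A $\otimes$-category is an additive symmetric monoidal category with unit $\mathbf{1}$ and biadditive tensor product; it is rigid if every object has a dual. A rigid abelian $\otimes$-category is a rigid $\otimes$-category whose underlying category is abelian. A commutative ring $R$ is absolutely flat (von Neumann regular) if for every $x\in R$ there exists $y\in R$ with $xyx=x$. *)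

theory Defs
  imports "HOL-Algebra.Ideal" "HOL-Analysis.Abstract_Topology"
begin

section \<open>Categories\<close>

record ('o, 'm) category =
  obj :: "'o set"
  arr :: "'m set"
  src :: "'m \<Rightarrow> 'o"
  tgt :: "'m \<Rightarrow> 'o"
  ident :: "'o \<Rightarrow> 'm"
  cmp :: "'m \<Rightarrow> 'm \<Rightarrow> 'm"  (infixl "\<cdot>\<index>" 70)

text \<open>Composition is written in the order of functions: \<open>g \<cdot> f\<close> means first \<open>f\<close>, then \<open>g\<close>.\<close>

definition Hom :: "('o, 'm, 'z) category_scheme \<Rightarrow> 'o \<Rightarrow> 'o \<Rightarrow> 'm set" where
  "Hom C a b = {f \<in> arr C. src C f = a \<and> tgt C f = b}"

locale category =
  fixes C (structure)
  assumes src_obj: "f \<in> arr C \<Longrightarrow> src C f \<in> obj C"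
    and tgt_obj: "f \<in> arr C \<Longrightarrow> tgt C f \<in> obj C"
    and ident_Hom: "a \<in> obj C \<Longrightarrow> ident C a \<in> Hom C a a"
    and cmp_Hom: "\<lbrakk>f \<in> Hom C a b; g \<in> Hom C b c\<rbrakk> \<Longrightarrow> g \<cdot> f \<in> Hom C a c"
    and cmp_ident_right: "f \<in> Hom C a b \<Longrightarrow> f \<cdot> ident C a = f"
    and cmp_ident_left: "f \<in> Hom C a b \<Longrightarrow> ident C b \<cdot> f = f"
    and cmp_assoc: "\<lbrakk>f \<in> Hom C a b; g \<in> Hom C b c; h \<in> Hom C c d\<rbrakk>
      \<Longrightarrow> h \<cdot> (g \<cdot> f) = (h \<cdot> g) \<cdot> f"

definition inverse_arrows :: "('o, 'm, 'z) category_scheme \<Rightarrow> 'm \<Rightarrow> 'm \<Rightarrow> bool" where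
  "inverse_arrows C f g \<longleftrightarrow>
     f \<in> arr C \<and> g \<in> Hom C (tgt C f) (src C f) \<and>
     g \<cdot>\<^bsub>C\<^esub> f = ident C (src C f) \<and> f \<cdot>\<^bsub>C\<^esub> g = ident C (tgt C f)"

definition iso_arr :: "('o, 'm, 'z) category_scheme \<Rightarrow> 'm \<Rightarrow> bool" where
  "iso_arr C f \<longleftrightarrow> (\<exists>g. inverse_arrows C f g)"

definition inv_arr :: "('o, 'm, 'z) category_scheme \<Rightarrow> 'm \<Rightarrow> 'm" where
  "inv_arr C f = (THE g. inverse_arrows C f g)"

definition mono_arr :: "('o, 'm, 'z) category_scheme \<Rightarrow> 'm \<Rightarrow> bool" where
  "mono_arr C f \<longleftrightarrow> f \<in> arr C \<and>
     (\<forall>x\<in>obj C. \<forall>g\<in>Hom C x (src C f). \<forall>h\<in>Hom C x (src C f).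
        f \<cdot>\<^bsub>C\<^esub> g = f \<cdot>\<^bsub>C\<^esub> h \<longrightarrow> g = h)"

definition epi_arr :: "('o, 'm, 'z) category_scheme \<Rightarrow> 'm \<Rightarrow> bool" where
  "epi_arr C f \<longleftrightarrow> f \<in> arr C \<and>
     (\<forall>x\<in>obj C. \<forall>g\<in>Hom C (tgt C f) x. \<forall>h\<in>Hom C (tgt C f) x.
        g \<cdot>\<^bsub>C\<^esub> f = h \<cdot>\<^bsub>C\<^esub> f \<longrightarrow> g = h)"

text \<open>\<open>p\<close>, \<open>q\<close> are the two projections of a fibre product of \<open>i\<close> and \<open>j\<close>.\<close>

definition is_pullback ::
  "('o, 'm, 'z) category_scheme \<Rightarrow> 'm \<Rightarrow> 'm \<Rightarrow> 'm \<Rightarrow> 'm \<Rightarrow> bool" where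
  "is_pullback C i j p q \<longleftrightarrow>
     i \<in> arr C \<and> j \<in> arr C \<and> tgt C i = tgt C j \<and>
     p \<in> Hom C (src C p) (src C i) \<and> q \<in> Hom C (src C p) (src C j) \<and>
     i \<cdot>\<^bsub>C\<^esub> p = j \<cdot>\<^bsub>C\<^esub> q \<and>
     (\<forall>x\<in>obj C. \<forall>g\<in>Hom C x (src C i). \<forall>h\<in>Hom C x (src C j).
        i \<cdot>\<^bsub>C\<^esub> g = j \<cdot>\<^bsub>C\<^esub> h \<longrightarrow>
        (\<exists>!u. u \<in> Hom C x (src C p) \<and> p \<cdot>\<^bsub>C\<^esub> u = g \<and> q \<cdot>\<^bsub>C\<^esub> u = h))"

section \<open>Additive and abelian categories\<close>

record ('o, 'm) add_category = "('o, 'm) category" +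
  zero_arr :: "'o \<Rightarrow> 'o \<Rightarrow> 'm"
  add_arr :: "'m \<Rightarrow> 'm \<Rightarrow> 'm"

definition Hom_group :: "('o, 'm, 'z) add_category_scheme \<Rightarrow> 'o \<Rightarrow> 'o \<Rightarrow> 'm monoid" where
  "Hom_group C a b =
     \<lparr>carrier = Hom C a b, monoid.mult = add_arr C, one = zero_arr C a b\<rparr>"

definition End_ring :: "('o, 'm, 'z) add_category_scheme \<Rightarrow> 'o \<Rightarrow> 'm ring" where
  "End_ring C a =
     \<lparr>carrier = Hom C a a, monoid.mult = cmp C, one = ident C a,
      zero = zero_arr C a a, add = add_arr C\<rparr>"

definition is_zero_object :: "('o, 'm, 'z) category_scheme \<Rightarrow> 'o \<Rightarrow> bool" where
  "is_zero_object C z \<longleftrightarrow> z \<in> obj C \<and>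
     (\<forall>a\<in>obj C. (\<exists>!f. f \<in> Hom C a z) \<and> (\<exists>!f. f \<in> Hom C z a))"

definition is_biproduct ::
  "('o, 'm, 'z) add_category_scheme \<Rightarrow> 'o \<Rightarrow> 'o \<Rightarrow> 'o \<Rightarrow> 'm \<Rightarrow> 'm \<Rightarrow> 'm \<Rightarrow> 'm \<Rightarrow> bool" where
  "is_biproduct C a b s i1 i2 p1 p2 \<longleftrightarrow>
     i1 \<in> Hom C a s \<and> i2 \<in> Hom C b s \<and> p1 \<in> Hom C s a \<and> p2 \<in> Hom C s b \<and>
     p1 \<cdot>\<^bsub>C\<^esub> i1 = ident C a \<and> p2 \<cdot>\<^bsub>C\<^esub> i2 = ident C b \<and>
     p1 \<cdot>\<^bsub>C\<^esub> i2 = zero_arr C b a \<and> p2 \<cdot>\<^bsub>C\<^esub> i1 = zero_arr C a b \<and>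
     add_arr C (i1 \<cdot>\<^bsub>C\<^esub> p1) (i2 \<cdot>\<^bsub>C\<^esub> p2) = ident C s"

locale additive_category = category +
  assumes Hom_comm_group: "\<lbrakk>a \<in> obj C; b \<in> obj C\<rbrakk> \<Longrightarrow> comm_group (Hom_group C a b)"
    and cmp_add_right: "\<lbrakk>f \<in> Hom C a b; f' \<in> Hom C a b; g \<in> Hom C b c\<rbrakk>
      \<Longrightarrow> g \<cdot> add_arr C f f' = add_arr C (g \<cdot> f) (g \<cdot> f')"
    and cmp_add_left: "\<lbrakk>f \<in> Hom C a b; g \<in> Hom C b c; g' \<in> Hom C b c\<rbrakk>
      \<Longrightarrow> add_arr C g g' \<cdot> f = add_arr C (g \<cdot> f) (g' \<cdot> f)"
    and zero_object: "\<exists>z. is_zero_object C z"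
    and biproducts: "\<lbrakk>a \<in> obj C; b \<in> obj C\<rbrakk>
      \<Longrightarrow> \<exists>s i1 i2 p1 p2. is_biproduct C a b s i1 i2 p1 p2"

definition is_kernel :: "('o, 'm, 'z) add_category_scheme \<Rightarrow> 'm \<Rightarrow> 'm \<Rightarrow> bool" where
  "is_kernel C k f \<longleftrightarrow>
     f \<in> arr C \<and> k \<in> Hom C (src C k) (src C f) \<and>
     f \<cdot>\<^bsub>C\<^esub> k = zero_arr C (src C k) (tgt C f) \<and>
     (\<forall>x\<in>obj C. \<forall>g\<in>Hom C x (src C f). f \<cdot>\<^bsub>C\<^esub> g = zero_arr C x (tgt C f) \<longrightarrow>
        (\<exists>!u. u \<in> Hom C x (src C k) \<and> k \<cdot>\<^bsub>C\<^esub> u = g))"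

definition is_cokernel :: "('o, 'm, 'z) add_category_scheme \<Rightarrow> 'm \<Rightarrow> 'm \<Rightarrow> bool" where
  "is_cokernel C c f \<longleftrightarrow>
     f \<in> arr C \<and> c \<in> Hom C (tgt C f) (tgt C c) \<and>
     c \<cdot>\<^bsub>C\<^esub> f = zero_arr C (src C f) (tgt C c) \<and>
     (\<forall>x\<in>obj C. \<forall>g\<in>Hom C (tgt C f) x. g \<cdot>\<^bsub>C\<^esub> f = zero_arr C (src C f) x \<longrightarrow>
        (\<exists>!u. u \<in> Hom C (tgt C c) x \<and> u \<cdot>\<^bsub>C\<^esub> c = g))"

text \<open>The image, as in any abelian category, is the kernel of the cokernel.\<close>

definition is_image :: "('o, 'm, 'z) add_category_scheme \<Rightarrow> 'm \<Rightarrow> 'm \<Rightarrow> bool" where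
  "is_image C k f \<longleftrightarrow> (\<exists>c. is_cokernel C c f \<and> is_kernel C k c)"

locale abelian_category = additive_category +
  assumes kernels: "f \<in> arr C \<Longrightarrow> \<exists>k. is_kernel C k f"
    and cokernels: "f \<in> arr C \<Longrightarrow> \<exists>c. is_cokernel C c f"
    and mono_is_kernel: "mono_arr C f \<Longrightarrow> \<exists>g. is_kernel C f g"
    and epi_is_cokernel: "epi_arr C f \<Longrightarrow> \<exists>g. is_cokernel C f g"

section \<open>Rigid tensor categories\<close>

record ('o, 'm) tensor_category = "('o, 'm) add_category" +
  tensor_obj :: "'o \<Rightarrow> 'o \<Rightarrow> 'o"  (infixl "\<otimes>\<^sub>o\<index>" 75)
  tensor_arr :: "'m \<Rightarrow> 'm \<Rightarrow> 'm"  (infixl "\<otimes>\<^sub>m\<index>" 75)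
  tunit :: "'o"
  associator :: "'o \<Rightarrow> 'o \<Rightarrow> 'o \<Rightarrow> 'm"
  left_unitor :: "'o \<Rightarrow> 'm"
  right_unitor :: "'o \<Rightarrow> 'm"
  symmetor :: "'o \<Rightarrow> 'o \<Rightarrow> 'm"

text \<open>
  The last assumptions are, in order: the pentagon, the triangle, the involutivity of the
  symmetry and the hexagon.  The second hexagon follows from the first one, by involutivity.
\<close>

locale symmetric_monoidal_category = category +
  assumes tensor_obj_closed: "\<lbrakk>a \<in> obj C; b \<in> obj C\<rbrakk> \<Longrightarrow> a \<otimes>\<^sub>o b \<in> obj C"
    and tunit_obj: "tunit C \<in> obj C"
    and tensor_arr_Hom: "\<lbrakk>f \<in> Hom C a b; g \<in> Hom C c d\<rbrakk>
      \<Longrightarrow> f \<otimes>\<^sub>m g \<in> Hom C (a \<otimes>\<^sub>o c) (b \<otimes>\<^sub>o d)"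
    and tensor_ident: "\<lbrakk>a \<in> obj C; b \<in> obj C\<rbrakk>
      \<Longrightarrow> ident C a \<otimes>\<^sub>m ident C b = ident C (a \<otimes>\<^sub>o b)"
    and tensor_cmp: "\<lbrakk>f \<in> Hom C a b; g \<in> Hom C b c; f' \<in> Hom C a' b'; g' \<in> Hom C b' c'\<rbrakk>
      \<Longrightarrow> (g \<cdot> f) \<otimes>\<^sub>m (g' \<cdot> f') = (g \<otimes>\<^sub>m g') \<cdot> (f \<otimes>\<^sub>m f')"
    and associator_Hom: "\<lbrakk>a \<in> obj C; b \<in> obj C; c \<in> obj C\<rbrakk>
      \<Longrightarrow> associator C a b c \<in> Hom C ((a \<otimes>\<^sub>o b) \<otimes>\<^sub>o c) (a \<otimes>\<^sub>o (b \<otimes>\<^sub>o c))"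
    and associator_iso: "\<lbrakk>a \<in> obj C; b \<in> obj C; c \<in> obj C\<rbrakk>
      \<Longrightarrow> iso_arr C (associator C a b c)"
    and associator_natural: "\<lbrakk>f \<in> Hom C a a'; g \<in> Hom C b b'; h \<in> Hom C c c'\<rbrakk>
      \<Longrightarrow> associator C a' b' c' \<cdot> ((f \<otimes>\<^sub>m g) \<otimes>\<^sub>m h)
          = (f \<otimes>\<^sub>m (g \<otimes>\<^sub>m h)) \<cdot> associator C a b c"
    and left_unitor_Hom: "a \<in> obj C \<Longrightarrow> left_unitor C a \<in> Hom C (tunit C \<otimes>\<^sub>o a) a"
    and left_unitor_iso: "a \<in> obj C \<Longrightarrow> iso_arr C (left_unitor C a)"
    and left_unitor_natural: "f \<in> Hom C a b
      \<Longrightarrow> left_unitor C b \<cdot> (ident C (tunit C) \<otimes>\<^sub>m f) = f \<cdot> left_unitor C a"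
    and right_unitor_Hom: "a \<in> obj C \<Longrightarrow> right_unitor C a \<in> Hom C (a \<otimes>\<^sub>o tunit C) a"
    and right_unitor_iso: "a \<in> obj C \<Longrightarrow> iso_arr C (right_unitor C a)"
    and right_unitor_natural: "f \<in> Hom C a b
      \<Longrightarrow> right_unitor C b \<cdot> (f \<otimes>\<^sub>m ident C (tunit C)) = f \<cdot> right_unitor C a"
    and symmetor_Hom: "\<lbrakk>a \<in> obj C; b \<in> obj C\<rbrakk>
      \<Longrightarrow> symmetor C a b \<in> Hom C (a \<otimes>\<^sub>o b) (b \<otimes>\<^sub>o a)"
    and symmetor_natural: "\<lbrakk>f \<in> Hom C a a'; g \<in> Hom C b b'\<rbrakk>
      \<Longrightarrow> symmetor C a' b' \<cdot> (f \<otimes>\<^sub>m g) = (g \<otimes>\<^sub>m f) \<cdot> symmetor C a b"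
    and pentagon: "\<lbrakk>a \<in> obj C; b \<in> obj C; c \<in> obj C; d \<in> obj C\<rbrakk>
      \<Longrightarrow> associator C a b (c \<otimes>\<^sub>o d) \<cdot> associator C (a \<otimes>\<^sub>o b) c d
          = (ident C a \<otimes>\<^sub>m associator C b c d) \<cdot> associator C a (b \<otimes>\<^sub>o c) d
            \<cdot> (associator C a b c \<otimes>\<^sub>m ident C d)"
    and triangle: "\<lbrakk>a \<in> obj C; b \<in> obj C\<rbrakk>
      \<Longrightarrow> (ident C a \<otimes>\<^sub>m left_unitor C b) \<cdot> associator C a (tunit C) b
          = right_unitor C a \<otimes>\<^sub>m ident C b"
    and symmetor_involutive: "\<lbrakk>a \<in> obj C; b \<in> obj C\<rbrakk>
      \<Longrightarrow> symmetor C b a \<cdot> symmetor C a b = ident C (a \<otimes>\<^sub>o b)"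
    and hexagon: "\<lbrakk>a \<in> obj C; b \<in> obj C; c \<in> obj C\<rbrakk>
      \<Longrightarrow> associator C b c a \<cdot> symmetor C a (b \<otimes>\<^sub>o c) \<cdot> associator C a b c
          = (ident C b \<otimes>\<^sub>m symmetor C a c) \<cdot> associator C b a c
            \<cdot> (symmetor C a b \<otimes>\<^sub>m ident C c)"

locale tensor_category = additive_category + symmetric_monoidal_category +
  assumes tensor_add_left: "\<lbrakk>f \<in> Hom C a b; f' \<in> Hom C a b; g \<in> Hom C c d\<rbrakk>
      \<Longrightarrow> add_arr C f f' \<otimes>\<^sub>m g = add_arr C (f \<otimes>\<^sub>m g) (f' \<otimes>\<^sub>m g)"
    and tensor_add_right: "\<lbrakk>f \<in> Hom C a b; g \<in> Hom C c d; g' \<in> Hom C c d\<rbrakk>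
      \<Longrightarrow> f \<otimes>\<^sub>m add_arr C g g' = add_arr C (f \<otimes>\<^sub>m g) (f \<otimes>\<^sub>m g')"

text \<open>
  \<open>a'\<close> is dual to \<open>a\<close>, with evaluation \<open>ev : a' \<otimes> a \<rightarrow> 1\<close> and coevaluation
  \<open>coev : 1 \<rightarrow> a \<otimes> a'\<close>.  The two equations are the usual triangle identities; the composites
  run from \<open>1 \<otimes> a\<close> to \<open>a\<close> and from \<open>a' \<otimes> 1\<close> to \<open>a'\<close>.  By symmetry there is no difference
  between left and right duals.
\<close>

definition is_dual ::
  "('o, 'm, 'z) tensor_category_scheme \<Rightarrow> 'o \<Rightarrow> 'o \<Rightarrow> 'm \<Rightarrow> 'm \<Rightarrow> bool" where
  "is_dual C a a' ev coev \<longleftrightarrow>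
     a \<in> obj C \<and> a' \<in> obj C \<and>
     ev \<in> Hom C (a' \<otimes>\<^sub>o\<^bsub>C\<^esub> a) (tunit C) \<and> coev \<in> Hom C (tunit C) (a \<otimes>\<^sub>o\<^bsub>C\<^esub> a') \<and>
     right_unitor C a \<cdot>\<^bsub>C\<^esub> (ident C a \<otimes>\<^sub>m\<^bsub>C\<^esub> ev) \<cdot>\<^bsub>C\<^esub> associator C a a' a
       \<cdot>\<^bsub>C\<^esub> (coev \<otimes>\<^sub>m\<^bsub>C\<^esub> ident C a) = left_unitor C a \<and>
     left_unitor C a' \<cdot>\<^bsub>C\<^esub> (ev \<otimes>\<^sub>m\<^bsub>C\<^esub> ident C a') \<cdot>\<^bsub>C\<^esub> inv_arr C (associator C a' a a')
       \<cdot>\<^bsub>C\<^esub> (ident C a' \<otimes>\<^sub>m\<^bsub>C\<^esub> coev) = right_unitor C a'"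

locale rigid_tensor_category = tensor_category +
  assumes dual: "a \<in> obj C \<Longrightarrow> \<exists>a' ev coev. is_dual C a a' ev coev"

locale rigid_abelian_tensor_category = rigid_tensor_category + abelian_category

section \<open>Subobjects\<close>

definition monos_into :: "('o, 'm, 'z) category_scheme \<Rightarrow> 'o \<Rightarrow> 'm set" where
  "monos_into C a = {i. mono_arr C i \<and> tgt C i = a}"

definition factors_through :: "('o, 'm, 'z) category_scheme \<Rightarrow> 'm \<Rightarrow> 'm \<Rightarrow> bool" where
  "factors_through C i j \<longleftrightarrow> (\<exists>h\<in>Hom C (src C i) (src C j). i = j \<cdot>\<^bsub>C\<^esub> h)"

definition subobj_rel :: "('o, 'm, 'z) category_scheme \<Rightarrow> 'o \<Rightarrow> ('m \<times> 'm) set" where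
  "subobj_rel C a = {(i, j). i \<in> monos_into C a \<and> j \<in> monos_into C a \<and>
     factors_through C i j \<and> factors_through C j i}"

definition subobjects :: "('o, 'm, 'z) category_scheme \<Rightarrow> 'o \<Rightarrow> 'm set set" where
  "subobjects C a = monos_into C a // subobj_rel C a"

definition subobj_le :: "('o, 'm, 'z) category_scheme \<Rightarrow> 'm set \<Rightarrow> 'm set \<Rightarrow> bool" where
  "subobj_le C X Y \<longleftrightarrow> (\<exists>i\<in>X. \<exists>j\<in>Y. factors_through C i j)"

text \<open>
  The intersection of two subobjects is their fibre product, and their sum is the image of the
  induced morphism from the direct sum.  The set of all representatives obtained in this way is
  already a full equivalence class, so that the operations can be defined directly on classes.
\<close>

definition subobj_Int :: "('o, 'm, 'z) category_scheme \<Rightarrow> 'm set \<Rightarrow> 'm set \<Rightarrow> 'm set" where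
  "subobj_Int C X Y =
     {k. \<exists>i\<in>X. \<exists>j\<in>Y. \<exists>p q. is_pullback C i j p q \<and> k = i \<cdot>\<^bsub>C\<^esub> p}"

definition subobj_sum :: "('o, 'm, 'z) add_category_scheme \<Rightarrow> 'm set \<Rightarrow> 'm set \<Rightarrow> 'm set" where
  "subobj_sum C X Y =
     {k. \<exists>i\<in>X. \<exists>j\<in>Y. \<exists>s i1 i2 p1 p2. is_biproduct C (src C i) (src C j) s i1 i2 p1 p2 \<and>
        is_image C k (add_arr C (i \<cdot>\<^bsub>C\<^esub> p1) (j \<cdot>\<^bsub>C\<^esub> p2))}"

section \<open>Absolutely flat rings and the prime spectrum\<close>

definition absolutely_flat :: "('a, 'b) ring_scheme \<Rightarrow> bool" where
  "absolutely_flat R \<longleftrightarrow> cring R \<and>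
     (\<forall>x\<in>carrier R. \<exists>y\<in>carrier R. x \<otimes>\<^bsub>R\<^esub> y \<otimes>\<^bsub>R\<^esub> x = x)"

definition Spec :: "('a, 'b) ring_scheme \<Rightarrow> 'a set set" where
  "Spec R = {P. primeideal P R}"

definition zariski_open :: "('a, 'b) ring_scheme \<Rightarrow> 'a set set \<Rightarrow> bool" where
  "zariski_open R U \<longleftrightarrow> (\<exists>I\<subseteq>carrier R. U = {P \<in> Spec R. \<not> I \<subseteq> P})"

definition zariski :: "('a, 'b) ring_scheme \<Rightarrow> 'a set topology" where
  "zariski R = topology (zariski_open R)"

lemma istopology_zariski_open: "istopology (zariski_open R)"
  unfolding istopology_def
proof (intro conjI allI impI)
  fix S T assume "zariski_open R S" "zariski_open R T"
  then obtain I J where I: "I \<subseteq> carrier R" "S = {P \<in> Spec R. \<not> I \<subseteq> P}"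
    and J: "J \<subseteq> carrier R" "T = {P \<in> Spec R. \<not> J \<subseteq> P}"
    by (auto simp: zariski_open_def)
  define K where "K = {x \<otimes>\<^bsub>R\<^esub> y |x y. x \<in> I \<and> y \<in> J} \<inter> carrier R"
  have "K \<subseteq> P \<longleftrightarrow> I \<subseteq> P \<or> J \<subseteq> P" if "P \<in> Spec R" for P
  proof -
    interpret primeideal P R using that by (simp add: Spec_def)
    show ?thesis
    proof
      assume K: "K \<subseteq> P"
      show "I \<subseteq> P \<or> J \<subseteq> P"
      proof (rule ccontr)
        assume "\<not> (I \<subseteq> P \<or> J \<subseteq> P)"
        then obtain x y where "x \<in> I" "x \<notin> P" "y \<in> J" "y \<notin> P" by blast
        moreover from this have "x \<in> carrier R" "y \<in> carrier R" using I J by auto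
        moreover from calculation have "x \<otimes>\<^bsub>R\<^esub> y \<in> K" by (auto simp: K_def)
        ultimately show False using K I_prime by blast
      qed
    next
      assume "I \<subseteq> P \<or> J \<subseteq> P"
      moreover have "x \<otimes>\<^bsub>R\<^esub> y \<in> P" if "x \<in> I" "y \<in> J" "x \<in> P \<or> y \<in> P" for x y
      proof -
        have "x \<in> carrier R" "y \<in> carrier R" using that I(1) J(1) by auto
        then show ?thesis using that(3) I_l_closed[of y x] I_r_closed[of x y] by metis
      qed
      ultimately show "K \<subseteq> P" unfolding K_def by blast
    qed
  qed
  then have "S \<inter> T = {P \<in> Spec R. \<not> K \<subseteq> P}" using I J by auto
  then show "zariski_open R (S \<inter> T)" unfolding zariski_open_def K_def by blast
next
  fix \<K> assume "\<forall>K\<in>\<K>. zariski_open R K"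
  then obtain I where I: "\<And>K. K \<in> \<K> \<Longrightarrow> I K \<subseteq> carrier R \<and> K = {P \<in> Spec R. \<not> I K \<subseteq> P}"
    unfolding zariski_open_def by metis
  have "\<Union>\<K> = {P \<in> Spec R. \<not> (\<Union>K\<in>\<K>. I K) \<subseteq> P}" using I by blast
  moreover have "(\<Union>K\<in>\<K>. I K) \<subseteq> carrier R" using I by blast
  ultimately show "zariski_open R (\<Union>\<K>)" unfolding zariski_open_def by blast
qed

lemma openin_zariski: "openin (zariski R) = zariski_open R"
  by (simp add: zariski_def istopology_zariski_open topology_inverse')

lemma topspace_zariski: "topspace (zariski R) = Spec R"
proof (rule antisym)
  show "topspace (zariski R) \<subseteq> Spec R"
    unfolding topspace_def openin_zariski zariski_open_def by blast
  have "\<not> carrier R \<subseteq> P" if "P \<in> Spec R" for P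
  proof -
    interpret primeideal P R using that by (simp add: Spec_def)
    show ?thesis using I_notcarr a_subset by blast
  qed
  then have "zariski_open R (Spec R)"
    unfolding zariski_open_def by blast
  then show "Spec R \<subseteq> topspace (zariski R)"
    unfolding topspace_def openin_zariski by blast
qed

definition clopens :: "'a topology \<Rightarrow> 'a set set" where
  "clopens T = {S. openin T S \<and> closedin T S}"

end

theory Submission
  imports Defs
begin

text \<open>
  Let \<open>u : U \<rightarrow> 1\<close> be a monomorphism with cokernel \<open>V\<close>.  Exactness of the tensor product gives
  \<open>V \<otimes> U = 0\<close>, and an object killed by both \<open>U\<close> and \<open>V\<close> is zero.  Comparing \<open>U\<close> with the image
  of \<open>1 \<rightarrow> U \<otimes> U' \<rightarrow> 1 \<otimes> U'\<close>, where \<open>U'\<close> is the dual of \<open>U\<close>, one finds that \<open>u\<close> splits.  Hence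
  kernels and images of endomorphisms of \<open>1\<close> are direct summands, so that \<open>End 1\<close> is absolutely
  flat, and subobjects of \<open>1\<close> correspond to idempotents of \<open>End 1\<close>.  Those correspond in turn to
  clopen subsets of the spectrum.
\<close>

section \<open>Arrows, sources and targets\<close>

text \<open>Composition through the unit is a tensor product up to unitors, so
  \<open>p \<cdot> u = 0\<close> for the cokernel \<open>p\<close> of \<open>u\<close> gives
  \<open>p \<otimes> u = 0\<close>. As \<open>p \<otimes> u\<close> is an epimorphism onto V
  \<otimes> U followed by a monomorphism, this is why V \<otimes> U vanishes. The obstacle to a
  splitting is that rigidity offers only 1 \<rightarrow> U \<otimes> U', not a morphism 1
  \<rightarrow> U. The remedy is to map on to 1 \<otimes> U' and take the image Q, a quotient of 1.
  Kernel and cokernel of U \<rightarrow> 1 \<rightarrow> Q are each killed by U and by V, hence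
  zero; so U \<rightarrow> Q is invertible, and 1 \<rightarrow> Q followed by its inverse is a
  retraction. For flatness, an endomorphism \<open>x = i \<cdot> q\<close> of 1 with a retraction
  \<open>r\<close> of \<open>i\<close> and a section \<open>s\<close> of \<open>q\<close> has the
  quasi-inverse \<open>s \<cdot> r\<close>. In the correspondence the common language is order:
  inclusion of clopen sets and of subobjects both read \<open>f \<cdot> e = e\<close> on
  idempotents. Intersections become products, and sums are recognised as least upper bounds.\<close>

context category
begin

lemma HomI: "\<lbrakk>f \<in> arr C; src C f = a; tgt C f = b\<rbrakk> \<Longrightarrow> f \<in> Hom C a b"
  by (simp add: Hom_def)

lemma HomD:
  assumes "f \<in> Hom C a b"
  shows "f \<in> arr C" "src C f = a" "tgt C f = b"
  using assms by (simp_all add: Hom_def)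

lemma Hom_obj: "f \<in> Hom C a b \<Longrightarrow> a \<in> obj C" "f \<in> Hom C a b \<Longrightarrow> b \<in> obj C"
  using src_obj tgt_obj by (auto simp: Hom_def)

lemmas src_obj' [simp] = src_obj and tgt_obj' [simp] = tgt_obj

lemma ident_simps [simp]:
  assumes "a \<in> obj C"
  shows "ident C a \<in> arr C" "src C (ident C a) = a" "tgt C (ident C a) = a"
  using ident_Hom[OF assms] by (simp_all add: Hom_def)

lemma cmp_simps [simp]:
  assumes "f \<in> arr C" "g \<in> arr C" "tgt C f = src C g"
  shows "g \<cdot> f \<in> arr C" "src C (g \<cdot> f) = src C f" "tgt C (g \<cdot> f) = tgt C g"
  using cmp_Hom[of f "src C f" "tgt C f" g "tgt C g"] assms by (simp_all add: Hom_def)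

lemma cmp_ident [simp]:
  "\<lbrakk>f \<in> arr C; src C f = a\<rbrakk> \<Longrightarrow> f \<cdot> ident C a = f"
  "\<lbrakk>f \<in> arr C; tgt C f = a\<rbrakk> \<Longrightarrow> ident C a \<cdot> f = f"
  by (rule cmp_ident_right, simp add: Hom_def) (rule cmp_ident_left, simp add: Hom_def)

lemma cmp_assoc' [simp]:
  assumes "f \<in> arr C" "g \<in> arr C" "h \<in> arr C" "tgt C f = src C g" "tgt C g = src C h"
  shows "h \<cdot> g \<cdot> f = h \<cdot> (g \<cdot> f)"
  using cmp_assoc[of f "src C f" "tgt C f" g "tgt C g" h "tgt C h"] assms by (simp add: Hom_def)

text \<open>\<open>cmp_assoc'\<close> makes the simplifier bracket composites to the right, so a
  commuting square reappears as the head of a longer chain \<open>g \<cdot> (f \<cdot> x)\<close>.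
  This lemma and its variant rewrite it there.\<close>

lemma cmp_eq_extend:
  assumes "g \<cdot> f = k \<cdot> h" "f \<in> arr C" "g \<in> arr C" "h \<in> arr C" "k \<in> arr C" "x \<in> arr C"
    "tgt C f = src C g" "tgt C h = src C k" "tgt C x = src C f" "src C f = src C h"
  shows "g \<cdot> (f \<cdot> x) = k \<cdot> (h \<cdot> x)"
  using assms cmp_assoc'[of x f g] cmp_assoc'[of x h k] by simp

lemma cmp_eq_extend':
  assumes "g \<cdot> f = k" "f \<in> arr C" "g \<in> arr C" "x \<in> arr C"
    "tgt C f = src C g" "tgt C x = src C f"
  shows "g \<cdot> (f \<cdot> x) = k \<cdot> x"
  using assms cmp_assoc'[of x f g] by simp

lemma inverse_arrows_unique:
  assumes "inverse_arrows C f g" "inverse_arrows C f h"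
  shows "g = h"
proof -
  have t: "f \<in> arr C" "g \<in> arr C" "h \<in> arr C" "src C g = tgt C f" "tgt C g = src C f"
    "src C h = tgt C f" "tgt C h = src C f" "f \<cdot> h = ident C (tgt C f)" "g \<cdot> f = ident C (src C f)"
    using assms by (auto simp: inverse_arrows_def Hom_def)
  have "g = g \<cdot> (f \<cdot> h)" using t by simp
  also have "\<dots> = g \<cdot> f \<cdot> h" using t by (intro cmp_assoc'[symmetric]) auto
  also have "\<dots> = h" using t by simp
  finally show ?thesis .
qed

lemma inv_arr_inverse_arrows: "iso_arr C f \<Longrightarrow> inverse_arrows C f (inv_arr C f)"
  unfolding inv_arr_def iso_arr_def using inverse_arrows_unique by (metis theI)

lemma inv_arr_simps [simp]:
  assumes "iso_arr C f"
  shows "inv_arr C f \<in> arr C" "src C (inv_arr C f) = tgt C f" "tgt C (inv_arr C f) = src C f"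
    "inv_arr C f \<cdot> f = ident C (src C f)" "f \<cdot> inv_arr C f = ident C (tgt C f)"
  using inv_arr_inverse_arrows[OF assms] by (auto simp: inverse_arrows_def Hom_def)

lemma iso_arr_arr: "iso_arr C f \<Longrightarrow> f \<in> arr C"
  by (auto simp: iso_arr_def inverse_arrows_def)

lemma inv_arr_cancel [simp]:
  assumes "iso_arr C f" "x \<in> arr C"
  shows "tgt C x = src C f \<Longrightarrow> inv_arr C f \<cdot> (f \<cdot> x) = x"
    "tgt C x = tgt C f \<Longrightarrow> f \<cdot> (inv_arr C f \<cdot> x) = x"
  using cmp_eq_extend'[of "inv_arr C f" f "ident C (src C f)" x]
    cmp_eq_extend'[of f "inv_arr C f" "ident C (tgt C f)" x] assms iso_arr_arr[of f] by simp_all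

lemma iso_arrI:
  assumes "f \<in> arr C" "g \<in> arr C" "src C g = tgt C f" "tgt C g = src C f"
    "g \<cdot> f = ident C (src C f)" "f \<cdot> g = ident C (tgt C f)"
  shows "iso_arr C f"
  unfolding iso_arr_def inverse_arrows_def Hom_def using assms by blast

lemma iso_inv_arr: "iso_arr C f \<Longrightarrow> iso_arr C (inv_arr C f)"
  using iso_arr_arr by (intro iso_arrI[where g = f]) auto

lemma iso_cmp:
  assumes "iso_arr C f" "iso_arr C g" "tgt C f = src C g"
  shows "iso_arr C (g \<cdot> f)"
  using assms iso_arr_arr[of f] iso_arr_arr[of g]
  by (intro iso_arrI[where g = "inv_arr C f \<cdot> inv_arr C g"]) auto

lemma mono_arrD:
  assumes "mono_arr C f" "g \<in> arr C" "h \<in> arr C" "tgt C g = src C f" "tgt C h = src C f"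
    "src C g = src C h" "f \<cdot> g = f \<cdot> h"
  shows "g = h"
  using assms src_obj unfolding mono_arr_def Hom_def by (metis (mono_tags, lifting) mem_Collect_eq)

lemma epi_arrD:
  assumes "epi_arr C f" "g \<in> arr C" "h \<in> arr C" "src C g = tgt C f" "src C h = tgt C f"
    "tgt C g = tgt C h" "g \<cdot> f = h \<cdot> f"
  shows "g = h"
  using assms tgt_obj unfolding epi_arr_def Hom_def by (metis (mono_tags, lifting) mem_Collect_eq)

lemma mono_arr: "mono_arr C f \<Longrightarrow> f \<in> arr C"
  by (simp add: mono_arr_def)

lemma epi_arr: "epi_arr C f \<Longrightarrow> f \<in> arr C"
  by (simp add: epi_arr_def)

end

section \<open>Tensor products and duals\<close>

context symmetric_monoidal_category
begin

lemma tensor_simps [simp]: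
  assumes "f \<in> arr C" "g \<in> arr C"
  shows "f \<otimes>\<^sub>m g \<in> arr C" "src C (f \<otimes>\<^sub>m g) = src C f \<otimes>\<^sub>o src C g"
    "tgt C (f \<otimes>\<^sub>m g) = tgt C f \<otimes>\<^sub>o tgt C g"
  using tensor_arr_Hom[of f "src C f" "tgt C f" g "src C g" "tgt C g"] assms
  by (simp_all add: Hom_def)

lemmas tensor_obj_closed' [simp] = tensor_obj_closed and tunit_obj' [simp] = tunit_obj
  and associator_iso' [simp] = associator_iso and left_unitor_iso' [simp] = left_unitor_iso
  and right_unitor_iso' [simp] = right_unitor_iso
  and tensor_ident' [simp] = tensor_ident

lemma structure_simps [simp]:
  assumes "a \<in> obj C"
  shows "left_unitor C a \<in> arr C" "src C (left_unitor C a) = tunit C \<otimes>\<^sub>o a"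
    "tgt C (left_unitor C a) = a"
    "right_unitor C a \<in> arr C" "src C (right_unitor C a) = a \<otimes>\<^sub>o tunit C"
    "tgt C (right_unitor C a) = a"
    "b \<in> obj C \<Longrightarrow> symmetor C a b \<in> arr C"
    "b \<in> obj C \<Longrightarrow> src C (symmetor C a b) = a \<otimes>\<^sub>o b"
    "b \<in> obj C \<Longrightarrow> tgt C (symmetor C a b) = b \<otimes>\<^sub>o a"
    "\<lbrakk>b \<in> obj C; c \<in> obj C\<rbrakk> \<Longrightarrow> associator C a b c \<in> arr C"
    "\<lbrakk>b \<in> obj C; c \<in> obj C\<rbrakk> \<Longrightarrow> src C (associator C a b c) = (a \<otimes>\<^sub>o b) \<otimes>\<^sub>o c"
    "\<lbrakk>b \<in> obj C; c \<in> obj C\<rbrakk> \<Longrightarrow> tgt C (associator C a b c) = a \<otimes>\<^sub>o (b \<otimes>\<^sub>o c)"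
  using left_unitor_Hom[OF assms] right_unitor_Hom[OF assms] symmetor_Hom[OF assms]
    associator_Hom[OF assms] by (simp_all add: Hom_def)

lemma tensor_cmp':
  assumes "f \<in> arr C" "g \<in> arr C" "f' \<in> arr C" "g' \<in> arr C"
    "tgt C f = src C g" "tgt C f' = src C g'"
  shows "(g \<cdot> f) \<otimes>\<^sub>m (g' \<cdot> f') = (g \<otimes>\<^sub>m g') \<cdot> (f \<otimes>\<^sub>m f')"
  using tensor_cmp[of f "src C f" "tgt C f" g "tgt C g" f' "src C f'" "tgt C f'" g' "tgt C g'"] assms
  by (simp add: Hom_def)

lemma tensor_cmp_ident:
  assumes "f \<in> arr C" "g \<in> arr C" "tgt C f = src C g" "a \<in> obj C"
  shows "(g \<cdot> f) \<otimes>\<^sub>m ident C a = (g \<otimes>\<^sub>m ident C a) \<cdot> (f \<otimes>\<^sub>m ident C a)"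
    "ident C a \<otimes>\<^sub>m (g \<cdot> f) = (ident C a \<otimes>\<^sub>m g) \<cdot> (ident C a \<otimes>\<^sub>m f)"
  using tensor_cmp'[of f g "ident C a" "ident C a"] tensor_cmp'[of "ident C a" "ident C a" f g] assms
  by simp_all

text \<open>Bifunctoriality, one factor at a time and in either order. Playing the two orders
  against each other later yields the commutativity of the endomorphisms of the unit.\<close>

lemma interchange:
  assumes "f \<in> arr C" "g \<in> arr C" "src C f = a" "tgt C f = b" "src C g = c" "tgt C g = d"
  shows "(f \<otimes>\<^sub>m ident C d) \<cdot> (ident C a \<otimes>\<^sub>m g) = f \<otimes>\<^sub>m g"
    "(ident C b \<otimes>\<^sub>m g) \<cdot> (f \<otimes>\<^sub>m ident C c) = f \<otimes>\<^sub>m g"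
  using tensor_cmp'[of "ident C a" f g "ident C d"] tensor_cmp'[of f "ident C b" "ident C c" g] assms
  by auto

lemma iso_tensor:
  assumes "iso_arr C f" "iso_arr C g"
  shows "iso_arr C (f \<otimes>\<^sub>m g)"
  using assms iso_arr_arr[of f] iso_arr_arr[of g] tensor_cmp'[of f "inv_arr C f" g "inv_arr C g"]
    tensor_cmp'[of "inv_arr C f" f "inv_arr C g" g]
  by (intro iso_arrI[where g = "inv_arr C f \<otimes>\<^sub>m inv_arr C g"]) auto

lemma iso_ident: "a \<in> obj C \<Longrightarrow> iso_arr C (ident C a)"
  by (rule iso_arrI[where g = "ident C a"]) auto

lemma iso_symmetor: "\<lbrakk>a \<in> obj C; b \<in> obj C\<rbrakk> \<Longrightarrow> iso_arr C (symmetor C a b)"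
  by (rule iso_arrI[where g = "symmetor C b a"]) (auto simp: symmetor_involutive)

lemma associator_natural':
  assumes "f \<in> arr C" "g \<in> arr C" "h \<in> arr C" "src C f = a" "tgt C f = a'" "src C g = b"
    "tgt C g = b'" "src C h = c" "tgt C h = c'"
  shows "associator C a' b' c' \<cdot> ((f \<otimes>\<^sub>m g) \<otimes>\<^sub>m h) = (f \<otimes>\<^sub>m (g \<otimes>\<^sub>m h)) \<cdot> associator C a b c"
  using assms by (intro associator_natural) (auto simp: Hom_def)

lemma inv_associator_natural:
  assumes [simp]: "f \<in> arr C" "g \<in> arr C" "h \<in> arr C" and "src C f = a" "tgt C f = a'" "src C g = b"
    "tgt C g = b'" "src C h = c" "tgt C h = c'"
  shows "((f \<otimes>\<^sub>m g) \<otimes>\<^sub>m h) \<cdot> inv_arr C (associator C a b c)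
    = inv_arr C (associator C a' b' c') \<cdot> (f \<otimes>\<^sub>m (g \<otimes>\<^sub>m h))"
proof -
  have t [simp]: "a \<in> obj C" "b \<in> obj C" "c \<in> obj C" "a' \<in> obj C" "b' \<in> obj C" "c' \<in> obj C"
    using assms src_obj tgt_obj by blast+
  note [simp] = assms
  have "((f \<otimes>\<^sub>m g) \<otimes>\<^sub>m h) \<cdot> inv_arr C (associator C a b c)
    = inv_arr C (associator C a' b' c') \<cdot> ((associator C a' b' c' \<cdot> ((f \<otimes>\<^sub>m g) \<otimes>\<^sub>m h))
      \<cdot> inv_arr C (associator C a b c))"
    by simp
  also have "\<dots> = inv_arr C (associator C a' b' c') \<cdot> (((f \<otimes>\<^sub>m (g \<otimes>\<^sub>m h)) \<cdot> associator C a b c)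
      \<cdot> inv_arr C (associator C a b c))"
    by (subst associator_natural') auto
  also have "\<dots> = inv_arr C (associator C a' b' c') \<cdot> (f \<otimes>\<^sub>m (g \<otimes>\<^sub>m h))" by simp
  finally show ?thesis .
qed

lemma inv_unitor_natural:
  assumes f: "f \<in> arr C" "src C f = a" "tgt C f = b"
  shows "inv_arr C (left_unitor C b) \<cdot> f = (ident C (tunit C) \<otimes>\<^sub>m f) \<cdot> inv_arr C (left_unitor C a)"
    "inv_arr C (right_unitor C b) \<cdot> f = (f \<otimes>\<^sub>m ident C (tunit C)) \<cdot> inv_arr C (right_unitor C a)"
proof -
  have ab: "a \<in> obj C" "b \<in> obj C" using src_obj[OF f(1)] tgt_obj[OF f(1)] f by simp_all
  have l: "f \<cdot> left_unitor C a = left_unitor C b \<cdot> (ident C (tunit C) \<otimes>\<^sub>m f)"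
    and r: "f \<cdot> right_unitor C a = right_unitor C b \<cdot> (f \<otimes>\<^sub>m ident C (tunit C))"
    using f left_unitor_natural[of f a b] right_unitor_natural[of f a b] by (simp_all add: Hom_def)
  note [simp] = f ab
  have "inv_arr C (left_unitor C b) \<cdot> ((f \<cdot> left_unitor C a) \<cdot> inv_arr C (left_unitor C a))
    = (ident C (tunit C) \<otimes>\<^sub>m f) \<cdot> inv_arr C (left_unitor C a)"
    unfolding l by simp
  then show "inv_arr C (left_unitor C b) \<cdot> f
    = (ident C (tunit C) \<otimes>\<^sub>m f) \<cdot> inv_arr C (left_unitor C a)" by simp
  have "inv_arr C (right_unitor C b) \<cdot> ((f \<cdot> right_unitor C a) \<cdot> inv_arr C (right_unitor C a))
    = (f \<otimes>\<^sub>m ident C (tunit C)) \<cdot> inv_arr C (right_unitor C a)"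
    unfolding r by simp
  then show "inv_arr C (right_unitor C b) \<cdot> f
    = (f \<otimes>\<^sub>m ident C (tunit C)) \<cdot> inv_arr C (right_unitor C a)" by simp
qed

lemma tensor_inv_cancel:
  assumes "iso_arr C f" "a \<in> obj C"
  shows "(ident C a \<otimes>\<^sub>m inv_arr C f) \<cdot> (ident C a \<otimes>\<^sub>m f) = ident C (a \<otimes>\<^sub>o src C f)"
    "(f \<otimes>\<^sub>m ident C a) \<cdot> (inv_arr C f \<otimes>\<^sub>m ident C a) = ident C (tgt C f \<otimes>\<^sub>o a)"
  using tensor_cmp_ident(2)[of f "inv_arr C f" a] tensor_cmp_ident(1)[of "inv_arr C f" f a] assms iso_arr_arr[of f]
  by simp_all

lemma iso_cancel_right:
  assumes "iso_arr C s" "f \<in> arr C" "g \<in> arr C" "tgt C s = src C f" "tgt C s = src C g"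
    "f \<cdot> s = g \<cdot> s"
  shows "f = g"
proof -
  have "(f \<cdot> s) \<cdot> inv_arr C s = (g \<cdot> s) \<cdot> inv_arr C s" using assms(6) by simp
  moreover have "(f \<cdot> s) \<cdot> inv_arr C s = f" "(g \<cdot> s) \<cdot> inv_arr C s = g"
    using assms(1-5) iso_arr_arr[OF assms(1)] by simp_all
  ultimately show ?thesis by (rule box_equals)
qed

lemma symmetor_natural':
  assumes "f \<in> arr C" "g \<in> arr C" "src C f = a" "tgt C f = a'" "src C g = b" "tgt C g = b'"
  shows "symmetor C a' b' \<cdot> (f \<otimes>\<^sub>m g) = (g \<otimes>\<^sub>m f) \<cdot> symmetor C a b"
  by (rule symmetor_natural) (use assms in \<open>simp_all add: Hom_def\<close>)

text \<open>This is a triangle identity for the functors \<open>x' \<otimes> -\<close> and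
  \<open>x \<otimes> -\<close> at \<open>a\<close>. It is the first identity of
  \<open>is_dual\<close> tensored with \<open>a\<close> on the right: the pentagon moves
  \<open>a\<close> past the associators, and the triangle axiom absorbs the unitors. The left unitor
  stays on \<open>x\<close> instead of on \<open>x \<otimes> a\<close>, so that the two need not be
  compared here.\<close>

lemma dual_unit_counit:
  assumes d: "is_dual C x x' ev coev" and a [simp]: "a \<in> obj C"
  shows "(ident C x \<otimes>\<^sub>m (left_unitor C a \<cdot> ((ev \<otimes>\<^sub>m ident C a) \<cdot> inv_arr C (associator C x' x a))))
      \<cdot> (associator C x x' (x \<otimes>\<^sub>o a) \<cdot> ((coev \<otimes>\<^sub>m ident C (x \<otimes>\<^sub>o a)) \<cdot> associator C (tunit C) x a))
    = left_unitor C x \<otimes>\<^sub>m ident C a"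
proof -
  have [simp]: "x \<in> obj C" "x' \<in> obj C" "ev \<in> arr C" "src C ev = x' \<otimes>\<^sub>o x" "tgt C ev = tunit C"
    "coev \<in> arr C" "src C coev = tunit C" "tgt C coev = x \<otimes>\<^sub>o x'"
    using d by (auto simp: is_dual_def Hom_def)
  let ?A = "associator C" and ?i = "ident C"
  have l: "left_unitor C x = right_unitor C x \<cdot> ((?i x \<otimes>\<^sub>m ev) \<cdot> (?A x x' x \<cdot> (coev \<otimes>\<^sub>m ?i x)))"
    using d by (simp add: is_dual_def)
  have 1: "left_unitor C x \<otimes>\<^sub>m ?i a = (right_unitor C x \<otimes>\<^sub>m ?i a) \<cdot> (((?i x \<otimes>\<^sub>m ev) \<otimes>\<^sub>m ?i a)
      \<cdot> ((?A x x' x \<otimes>\<^sub>m ?i a) \<cdot> ((coev \<otimes>\<^sub>m ?i x) \<otimes>\<^sub>m ?i a)))"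
    unfolding l by (simp add: tensor_cmp_ident)
  have 2: "(coev \<otimes>\<^sub>m ?i (x \<otimes>\<^sub>o a)) \<cdot> ?A (tunit C) x a = ?A (x \<otimes>\<^sub>o x') x a \<cdot> ((coev \<otimes>\<^sub>m ?i x) \<otimes>\<^sub>m ?i a)"
    by (subst associator_natural') simp_all
  have 3: "?A x x' (x \<otimes>\<^sub>o a) \<cdot> (?A (x \<otimes>\<^sub>o x') x a \<cdot> ((coev \<otimes>\<^sub>m ?i x) \<otimes>\<^sub>m ?i a))
    = (?i x \<otimes>\<^sub>m ?A x' x a) \<cdot> (?A x (x' \<otimes>\<^sub>o x) a
       \<cdot> ((?A x x' x \<otimes>\<^sub>m ?i a) \<cdot> ((coev \<otimes>\<^sub>m ?i x) \<otimes>\<^sub>m ?i a)))"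
    by (subst cmp_eq_extend[OF pentagon]) simp_all
  have 4: "(?i x \<otimes>\<^sub>m inv_arr C (?A x' x a)) \<cdot> ((?i x \<otimes>\<^sub>m ?A x' x a) \<cdot> y) = y"
    if "y \<in> arr C" "tgt C y = x \<otimes>\<^sub>o ((x' \<otimes>\<^sub>o x) \<otimes>\<^sub>o a)" for y
    using that by (subst cmp_eq_extend'[OF tensor_inv_cancel(1)]) simp_all
  have 5: "(?i x \<otimes>\<^sub>m (ev \<otimes>\<^sub>m ?i a)) \<cdot> (?A x (x' \<otimes>\<^sub>o x) a \<cdot> y)
    = ?A x (tunit C) a \<cdot> (((?i x \<otimes>\<^sub>m ev) \<otimes>\<^sub>m ?i a) \<cdot> y)"
    if "y \<in> arr C" "tgt C y = (x \<otimes>\<^sub>o (x' \<otimes>\<^sub>o x)) \<otimes>\<^sub>o a" for y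
    using that by (intro cmp_eq_extend associator_natural'[symmetric]) simp_all
  have 6: "(?i x \<otimes>\<^sub>m left_unitor C a) \<cdot> (?A x (tunit C) a \<cdot> y) = (right_unitor C x \<otimes>\<^sub>m ?i a) \<cdot> y"
    if "y \<in> arr C" "tgt C y = (x \<otimes>\<^sub>o tunit C) \<otimes>\<^sub>o a" for y
    using that by (intro cmp_eq_extend' triangle) simp_all
  show ?thesis
    unfolding 1 2 3 by (simp add: tensor_cmp_ident 4 5 6)
qed

text \<open>The counterpart for the functors \<open>- \<otimes> x\<close> and
  \<open>- \<otimes> x'\<close> at \<open>b\<close>, from the same identity of the dual, now
  tensored with \<open>b\<close> on the left. By coherence the right-hand side is the identity; it
  is left as a composite of isomorphisms.\<close>

lemma dual_unit_counit':
  assumes d: "is_dual C x x' ev coev" and b [simp]: "b \<in> obj C"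
  shows "(right_unitor C (b \<otimes>\<^sub>o x) \<cdot> ((ident C (b \<otimes>\<^sub>o x) \<otimes>\<^sub>m ev) \<cdot> associator C (b \<otimes>\<^sub>o x) x' x))
      \<cdot> ((inv_arr C (associator C b x x') \<cdot> ((ident C b \<otimes>\<^sub>m coev) \<cdot> inv_arr C (right_unitor C b)))
        \<otimes>\<^sub>m ident C x)
    = right_unitor C (b \<otimes>\<^sub>o x) \<cdot> (inv_arr C (associator C b x (tunit C))
        \<cdot> (ident C b \<otimes>\<^sub>m inv_arr C (right_unitor C x)))"
proof -
  have [simp]: "x \<in> obj C" "x' \<in> obj C" "ev \<in> arr C" "src C ev = x' \<otimes>\<^sub>o x" "tgt C ev = tunit C"
    "coev \<in> arr C" "src C coev = tunit C" "tgt C coev = x \<otimes>\<^sub>o x'"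
    using d by (auto simp: is_dual_def Hom_def)
  let ?A = "associator C" and ?i = "ident C" and ?I = "inv_arr C"
  have l: "left_unitor C x = right_unitor C x \<cdot> ((?i x \<otimes>\<^sub>m ev) \<cdot> (?A x x' x \<cdot> (coev \<otimes>\<^sub>m ?i x)))"
    using d by (simp add: is_dual_def)
  \<comment> \<open>The pentagon at \<open>b\<close>, \<open>x\<close>, \<open>x'\<close>,
    \<open>x\<close>, with two of its five isomorphisms moved to the other side.\<close>
  have 1: "?A (b \<otimes>\<^sub>o x) x' x \<cdot> ((?I (?A b x x') \<otimes>\<^sub>m ?i x) \<cdot> y)
    = ?I (?A b x (x' \<otimes>\<^sub>o x)) \<cdot> ((?i b \<otimes>\<^sub>m ?A x x' x) \<cdot> (?A b (x \<otimes>\<^sub>o x') x \<cdot> y))"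
    if [simp]: "y \<in> arr C" "tgt C y = (b \<otimes>\<^sub>o (x \<otimes>\<^sub>o x')) \<otimes>\<^sub>o x" for y
  proof -
    let ?z = "(?I (?A b x x') \<otimes>\<^sub>m ?i x) \<cdot> y"
    have "?A b x (x' \<otimes>\<^sub>o x) \<cdot> (?A (b \<otimes>\<^sub>o x) x' x \<cdot> ?z)
      = ((?i b \<otimes>\<^sub>m ?A x x' x) \<cdot> ?A b (x \<otimes>\<^sub>o x') x \<cdot> (?A b x x' \<otimes>\<^sub>m ?i x)) \<cdot> ?z"
      by (subst pentagon[symmetric]) simp_all
    also have "\<dots> = (?i b \<otimes>\<^sub>m ?A x x' x) \<cdot> (?A b (x \<otimes>\<^sub>o x') x \<cdot> ((?A b x x' \<otimes>\<^sub>m ?i x) \<cdot> ?z))"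
      by simp
    also have "(?A b x x' \<otimes>\<^sub>m ?i x) \<cdot> ?z = y"
      by (subst cmp_eq_extend'[OF tensor_inv_cancel(2)]) simp_all
    finally have "?I (?A b x (x' \<otimes>\<^sub>o x)) \<cdot> (?A b x (x' \<otimes>\<^sub>o x) \<cdot> (?A (b \<otimes>\<^sub>o x) x' x \<cdot> ?z))
      = ?I (?A b x (x' \<otimes>\<^sub>o x)) \<cdot> ((?i b \<otimes>\<^sub>m ?A x x' x) \<cdot> (?A b (x \<otimes>\<^sub>o x') x \<cdot> y))"
      by simp
    then show ?thesis by simp
  qed
  have 2: "?A b (x \<otimes>\<^sub>o x') x \<cdot> (((?i b \<otimes>\<^sub>m coev) \<otimes>\<^sub>m ?i x) \<cdot> y)
     = (?i b \<otimes>\<^sub>m (coev \<otimes>\<^sub>m ?i x)) \<cdot> (?A b (tunit C) x \<cdot> y)"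
    if "y \<in> arr C" "tgt C y = (b \<otimes>\<^sub>o tunit C) \<otimes>\<^sub>o x" for y
    using that by (intro cmp_eq_extend associator_natural') simp_all
  have 3: "(?i b \<otimes>\<^sub>m left_unitor C x) \<cdot> (?A b (tunit C) x \<cdot> (?I (right_unitor C b) \<otimes>\<^sub>m ?i x))
    = ?i (b \<otimes>\<^sub>o x)"
    by (subst cmp_eq_extend'[OF triangle]) (simp_all add: tensor_inv_cancel)
  have 4: "(?i (b \<otimes>\<^sub>o x) \<otimes>\<^sub>m ev) \<cdot> (?I (?A b x (x' \<otimes>\<^sub>o x)) \<cdot> y)
    = ?I (?A b x (tunit C)) \<cdot> ((?i b \<otimes>\<^sub>m (?i x \<otimes>\<^sub>m ev)) \<cdot> y)"
    if "y \<in> arr C" "tgt C y = b \<otimes>\<^sub>o (x \<otimes>\<^sub>o (x' \<otimes>\<^sub>o x))" for y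
    using that inv_associator_natural[of "?i b" "?i x" ev b b x x "x' \<otimes>\<^sub>o x" "tunit C"]
    by (intro cmp_eq_extend) simp_all
  have 5: "(?i b \<otimes>\<^sub>m (?i x \<otimes>\<^sub>m ev)) \<cdot> ((?i b \<otimes>\<^sub>m ?A x x' x) \<cdot> ((?i b \<otimes>\<^sub>m (coev \<otimes>\<^sub>m ?i x))
      \<cdot> (?A b (tunit C) x \<cdot> (?I (right_unitor C b) \<otimes>\<^sub>m ?i x))))
    = ?i b \<otimes>\<^sub>m ?I (right_unitor C x)" (is "?l = ?r")
  proof -
    \<comment> \<open>Inserting \<open>right_unitor C x\<close> and its inverse completes the
      composite in \<open>l\<close>, which collapses to \<open>left_unitor C x\<close>; then 3
      applies.\<close>
    have "?l = (?i b \<otimes>\<^sub>m ?I (right_unitor C x)) \<cdot> ((?i b \<otimes>\<^sub>m right_unitor C x) \<cdot> ?l)"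
      by (subst cmp_eq_extend'[OF tensor_inv_cancel(1)]) simp_all
    also have "(?i b \<otimes>\<^sub>m right_unitor C x) \<cdot> ?l
      = (?i b \<otimes>\<^sub>m left_unitor C x) \<cdot> (?A b (tunit C) x \<cdot> (?I (right_unitor C b) \<otimes>\<^sub>m ?i x))"
      unfolding l by (simp add: tensor_cmp_ident)
    finally show ?thesis unfolding 3 by simp
  qed
  show ?thesis
    by (simp add: tensor_cmp_ident 1 2 4 5)
qed

end

section \<open>Zero morphisms, monomorphisms and epimorphisms\<close>

context additive_category
begin

lemma zero_arr_simps [simp]:
  assumes "a \<in> obj C" "b \<in> obj C"
  shows "zero_arr C a b \<in> arr C" "src C (zero_arr C a b) = a" "tgt C (zero_arr C a b) = b"
proof -
  interpret comm_group "Hom_group C a b" by (rule Hom_comm_group[OF assms])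
  have "zero_arr C a b \<in> Hom C a b" using one_closed by (simp add: Hom_group_def)
  then show "zero_arr C a b \<in> arr C" "src C (zero_arr C a b) = a" "tgt C (zero_arr C a b) = b"
    by (simp_all add: Hom_def)
qed

lemma add_arr_Hom: "\<lbrakk>f \<in> Hom C a b; g \<in> Hom C a b\<rbrakk> \<Longrightarrow> add_arr C f g \<in> Hom C a b"
  using monoid.m_closed[OF group.is_monoid[OF comm_group.axioms(2)[OF Hom_comm_group[of a b]]], of f g]
    Hom_obj[of f a b] by (simp add: Hom_group_def)

lemma add_arr_simps [simp]:
  assumes "f \<in> arr C" "g \<in> arr C" "src C f = src C g" "tgt C f = tgt C g"
  shows "add_arr C f g \<in> arr C" "src C (add_arr C f g) = src C g" "tgt C (add_arr C f g) = tgt C g"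
  using add_arr_Hom[of f "src C g" "tgt C g" g] assms by (simp_all add: Hom_def)

lemma add_arr_group:
  assumes "f \<in> Hom C a b" "g \<in> Hom C a b" "h \<in> Hom C a b"
  shows "add_arr C (zero_arr C a b) f = f" "add_arr C f (zero_arr C a b) = f"
    "add_arr C f g = add_arr C g f"
    "add_arr C (add_arr C f g) h = add_arr C f (add_arr C g h)"
    "\<exists>f'. f' \<in> Hom C a b \<and> add_arr C f f' = zero_arr C a b"
    "add_arr C f g = add_arr C f h \<Longrightarrow> g = h"
proof -
  interpret G: comm_group "Hom_group C a b" by (rule Hom_comm_group) (use Hom_obj assms in auto)
  show "add_arr C (zero_arr C a b) f = f" "add_arr C f (zero_arr C a b) = f"
    "add_arr C f g = add_arr C g f"
    "add_arr C (add_arr C f g) h = add_arr C f (add_arr C g h)"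
    using G.l_one[of f] G.r_one[of f] G.m_comm[of f g] G.m_assoc[of f g h] assms
    by (simp_all add: Hom_group_def)
  show "\<exists>f'. f' \<in> Hom C a b \<and> add_arr C f f' = zero_arr C a b"
    using G.r_inv_ex[of f] assms by (auto simp: Hom_group_def)
  show "g = h" if "add_arr C f g = add_arr C f h"
    using G.Units_l_cancel[of f g h] that assms G.Units_eq by (simp add: Hom_group_def)
qed

text \<open>Source and target are read off the morphism itself, so vanishing passes through
  composites and tensor products without naming the objects; \<open>null_arr_eq\<close> recovers the
  equation.\<close>

definition null_arr :: "'b \<Rightarrow> bool" where
  "null_arr f \<longleftrightarrow> f \<in> arr C \<and> f = zero_arr C (src C f) (tgt C f)"

text \<open>A zero object, encoded by its identity: biadditivity then shows at once that tensoring
  preserves it.\<close>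

definition null_obj :: "'a \<Rightarrow> bool" where
  "null_obj a \<longleftrightarrow> a \<in> obj C \<and> null_arr (ident C a)"

lemma null_arr_arr: "null_arr f \<Longrightarrow> f \<in> arr C"
  by (simp add: null_arr_def)

lemma null_arr_zero [simp]: "\<lbrakk>a \<in> obj C; b \<in> obj C\<rbrakk> \<Longrightarrow> null_arr (zero_arr C a b)"
  by (simp add: null_arr_def)

lemma null_arr_eq: "\<lbrakk>null_arr f; src C f = a; tgt C f = b\<rbrakk> \<Longrightarrow> f = zero_arr C a b"
  by (simp add: null_arr_def)

lemma null_arr_unique:
  "\<lbrakk>null_arr f; null_arr g; src C f = src C g; tgt C f = tgt C g\<rbrakk> \<Longrightarrow> f = g"
  unfolding null_arr_def by metis

text \<open>Cancellation in the Hom group. With this criterion biadditivity proves that composites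
  and tensor products with a zero factor vanish, without mention of negatives.\<close>

lemma null_arrI_add:
  assumes "f \<in> arr C" "add_arr C f f = f"
  shows "null_arr f"
proof -
  have f: "f \<in> Hom C (src C f) (tgt C f)" using assms by (simp add: Hom_def)
  have z: "zero_arr C (src C f) (tgt C f) \<in> Hom C (src C f) (tgt C f)"
    using assms by (simp add: Hom_def)
  have "add_arr C f f = add_arr C f (zero_arr C (src C f) (tgt C f))"
    using add_arr_group(2)[OF f f f] assms(2) by simp
  then show ?thesis using add_arr_group(6)[OF f f z] assms(1) by (simp add: null_arr_def)
qed

lemma null_arr_add: "null_arr f \<Longrightarrow> add_arr C f f = f"
  using add_arr_group(1)[of f "src C f" "tgt C f" f f]
  by (auto simp: null_arr_def Hom_def)

lemma null_cmp:
  assumes "f \<in> arr C" "g \<in> arr C" "tgt C f = src C g" "null_arr f \<or> null_arr g"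
  shows "null_arr (g \<cdot> f)"
proof (rule null_arrI_add)
  have f: "f \<in> Hom C (src C f) (src C g)" and g: "g \<in> Hom C (src C g) (tgt C g)"
    using assms by (simp_all add: Hom_def)
  show "add_arr C (g \<cdot> f) (g \<cdot> f) = g \<cdot> f"
    using cmp_add_right[OF f f g] cmp_add_left[OF f g g] null_arr_add assms(4) by metis
qed (use assms in simp)

lemma null_obj_arr:
  assumes f: "f \<in> arr C" and n: "null_obj (src C f) \<or> null_obj (tgt C f)"
  shows "null_arr f"
  using n
proof
  assume "null_obj (src C f)"
  then have "null_arr (f \<cdot> ident C (src C f))"
    using f by (intro null_cmp) (auto simp: null_obj_def)
  then show ?thesis using f by simp
next
  assume "null_obj (tgt C f)"
  then have "null_arr (ident C (tgt C f) \<cdot> f)"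
    using f by (intro null_cmp) (auto simp: null_obj_def)
  then show ?thesis using f by simp
qed

lemma mono_null:
  assumes m: "mono_arr C f" and g: "g \<in> arr C" "tgt C g = src C f" "null_arr (f \<cdot> g)"
  shows "null_arr g"
proof -
  have f [simp]: "f \<in> arr C" using m by (rule mono_arr)
  let ?z = "zero_arr C (src C g) (src C f)"
  have "null_arr (f \<cdot> ?z)" using g by (intro null_cmp) auto
  then have "f \<cdot> g = f \<cdot> ?z" using g by - (rule null_arr_unique; auto)
  then have "g = ?z" using g by - (rule mono_arrD[OF m]; auto)
  moreover have "null_arr ?z" using g by simp
  ultimately show ?thesis by simp
qed

lemma epi_null:
  assumes e: "epi_arr C f" and g: "g \<in> arr C" "tgt C f = src C g" "null_arr (g \<cdot> f)"
  shows "null_arr g"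
proof -
  have f [simp]: "f \<in> arr C" using e by (rule epi_arr)
  let ?z = "zero_arr C (tgt C f) (tgt C g)"
  have "null_arr (?z \<cdot> f)" using g by (intro null_cmp) auto
  then have "g \<cdot> f = ?z \<cdot> f" using g by - (rule null_arr_unique; auto)
  then have "g = ?z" using g by - (rule epi_arrD[OF e]; auto)
  moreover have "null_arr ?z" using g by simp
  ultimately show ?thesis by simp
qed

text \<open>By additivity \<open>f \<cdot> g = f \<cdot> h\<close> says that \<open>f\<close> kills
  the difference of \<open>g\<close> and \<open>h\<close>, so it is enough to test against
  zero.\<close>

lemma mono_arrI:
  assumes f: "f \<in> arr C" and n: "\<And>g. \<lbrakk>g \<in> arr C; tgt C g = src C f; null_arr (f \<cdot> g)\<rbrakk> \<Longrightarrow> null_arr g"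
  shows "mono_arr C f"
  unfolding mono_arr_def
proof (intro conjI ballI impI f)
  fix x g h assume x: "x \<in> obj C" and g: "g \<in> Hom C x (src C f)" and h: "h \<in> Hom C x (src C f)"
    and e: "f \<cdot> g = f \<cdot> h"
  \<comment> \<open>The opposite of \<open>h\<close>; \<open>add_arr C g h'\<close> plays the part
    of the difference.\<close>
  obtain h' where h': "h' \<in> Hom C x (src C f)" "add_arr C h h' = zero_arr C x (src C f)"
    using add_arr_group(5)[OF h h h] by blast
  have fH: "f \<in> Hom C (src C f) (tgt C f)" using f by (simp add: Hom_def)
  have "f \<cdot> add_arr C g h' = f \<cdot> add_arr C h h'"
    using cmp_add_right[OF g h'(1) fH] cmp_add_right[OF h h'(1) fH] e by simp
  moreover have "null_arr (f \<cdot> zero_arr C x (src C f))" using x f by (intro null_cmp) auto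
  moreover have s: "add_arr C g h' \<in> Hom C x (src C f)" by (rule add_arr_Hom[OF g h'(1)])
  ultimately have "null_arr (add_arr C g h')"
    unfolding h'(2) using HomD[OF s] by - (rule n; simp)
  then have "add_arr C g h' = add_arr C h h'"
    unfolding h'(2) using HomD[OF s] by - (rule null_arr_eq)
  then have "add_arr C h' g = add_arr C h' h"
    using add_arr_group(3)[OF g h'(1) h] add_arr_group(3)[OF h h'(1) h] by simp
  then show "g = h" using add_arr_group(6)[OF h'(1) g h] by blast
qed

lemma epi_arrI:
  assumes f: "f \<in> arr C" and n: "\<And>g. \<lbrakk>g \<in> arr C; src C g = tgt C f; null_arr (g \<cdot> f)\<rbrakk> \<Longrightarrow> null_arr g"
  shows "epi_arr C f"
  unfolding epi_arr_def
proof (intro conjI ballI impI f)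
  fix x g h assume x: "x \<in> obj C" and g: "g \<in> Hom C (tgt C f) x" and h: "h \<in> Hom C (tgt C f) x"
    and e: "g \<cdot> f = h \<cdot> f"
  obtain h' where h': "h' \<in> Hom C (tgt C f) x" "add_arr C h h' = zero_arr C (tgt C f) x"
    using add_arr_group(5)[OF h h h] by blast
  have fH: "f \<in> Hom C (src C f) (tgt C f)" using f by (simp add: Hom_def)
  have "add_arr C g h' \<cdot> f = add_arr C h h' \<cdot> f"
    using cmp_add_left[OF fH g h'(1)] cmp_add_left[OF fH h h'(1)] e by simp
  moreover have "null_arr (zero_arr C (tgt C f) x \<cdot> f)" using x f by (intro null_cmp) auto
  moreover have s: "add_arr C g h' \<in> Hom C (tgt C f) x" by (rule add_arr_Hom[OF g h'(1)])
  ultimately have "null_arr (add_arr C g h')"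
    unfolding h'(2) using HomD[OF s] by - (rule n; simp)
  then have "add_arr C g h' = add_arr C h h'"
    unfolding h'(2) using HomD[OF s] by - (rule null_arr_eq)
  then have "add_arr C h' g = add_arr C h' h"
    using add_arr_group(3)[OF g h'(1) h] add_arr_group(3)[OF h h'(1) h] by simp
  then show "g = h" using add_arr_group(6)[OF h'(1) g h] by blast
qed

lemma mono_cmp:
  assumes "mono_arr C f" "mono_arr C g" "tgt C f = src C g"
  shows "mono_arr C (g \<cdot> f)"
proof (rule mono_arrI)
  have [simp]: "f \<in> arr C" "g \<in> arr C" using assms mono_arr by auto
  show "g \<cdot> f \<in> arr C" using assms by simp
  show "null_arr h" if "h \<in> arr C" "tgt C h = src C (g \<cdot> f)" "null_arr (g \<cdot> f \<cdot> h)" for h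
    using that assms mono_null[OF assms(2), of "f \<cdot> h"] mono_null[OF assms(1), of h] by simp
qed

lemma epi_cmp:
  assumes "epi_arr C f" "epi_arr C g" "tgt C f = src C g"
  shows "epi_arr C (g \<cdot> f)"
proof (rule epi_arrI)
  have [simp]: "f \<in> arr C" "g \<in> arr C" using assms epi_arr by auto
  show "g \<cdot> f \<in> arr C" using assms by simp
  show "null_arr h" if "h \<in> arr C" "src C h = tgt C (g \<cdot> f)" "null_arr (h \<cdot> (g \<cdot> f))" for h
    using that assms epi_null[OF assms(1), of "h \<cdot> g"] epi_null[OF assms(2), of h] by simp
qed

lemma mono_cancel:
  assumes f: "f \<in> arr C" and g: "g \<in> arr C" and t: "tgt C f = src C g" and m: "mono_arr C (g \<cdot> f)"
  shows "mono_arr C f"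
proof (rule mono_arrI[OF f])
  fix h assume h: "h \<in> arr C" "tgt C h = src C f" "null_arr (f \<cdot> h)"
  then have "null_arr (g \<cdot> (f \<cdot> h))" using f g t by (intro null_cmp) auto
  then show "null_arr h" using mono_null[OF m, of h] h f g t by simp
qed

lemma epi_cancel:
  assumes f: "f \<in> arr C" and g: "g \<in> arr C" and t: "tgt C f = src C g" and e: "epi_arr C (g \<cdot> f)"
  shows "epi_arr C g"
proof (rule epi_arrI[OF g])
  fix h assume h: "h \<in> arr C" "src C h = tgt C g" "null_arr (h \<cdot> g)"
  then have "null_arr ((h \<cdot> g) \<cdot> f)" using f g t by (intro null_cmp) auto
  then show "null_arr h" using epi_null[OF e, of h] h f g t by simp
qed

lemma ident_mono_epi: "a \<in> obj C \<Longrightarrow> mono_arr C (ident C a)" "a \<in> obj C \<Longrightarrow> epi_arr C (ident C a)"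
  by (auto intro: mono_arrI epi_arrI)

lemma iso_mono_epi:
  assumes "iso_arr C f"
  shows "mono_arr C f" "epi_arr C f"
proof -
  have f: "f \<in> arr C" using assms by (rule iso_arr_arr)
  show "mono_arr C f"
    by (rule mono_cancel[of f "inv_arr C f"]) (use f assms ident_mono_epi in auto)
  show "epi_arr C f"
    by (rule epi_cancel[of "inv_arr C f" f]) (use f assms ident_mono_epi in auto)
qed

lemma null_obj_mono:
  assumes "mono_arr C f" "null_obj (tgt C f)"
  shows "null_obj (src C f)"
proof -
  have f: "f \<in> arr C" using assms(1) by (rule mono_arr)
  have "null_arr (ident C (src C f))"
    using f assms(2) null_obj_arr[of f] by - (rule mono_null[OF assms(1)]; simp)
  then show ?thesis using f by (simp add: null_obj_def)
qed

lemma null_obj_epi: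
  assumes "epi_arr C f" "null_obj (src C f)"
  shows "null_obj (tgt C f)"
proof -
  have f: "f \<in> arr C" using assms(1) by (rule epi_arr)
  have "null_arr (ident C (tgt C f))"
    using f assms(2) null_obj_arr[of f] by - (rule epi_null[OF assms(1)]; simp)
  then show ?thesis using f by (simp add: null_obj_def)
qed

text \<open>The kernel property in terms of vanishing. Uniqueness of the factorisation becomes
  monicity of \<open>k\<close>: a morphism \<open>g\<close> killed by \<open>k\<close> and the zero
  morphism have the same composite with \<open>k\<close>.\<close>

lemma is_kernelD:
  assumes k: "is_kernel C k f"
  shows "f \<in> arr C" "k \<in> arr C" "tgt C k = src C f" "null_arr (f \<cdot> k)" "mono_arr C k"
    and "\<And>g. \<lbrakk>g \<in> arr C; tgt C g = src C f; null_arr (f \<cdot> g)\<rbrakk>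
      \<Longrightarrow> \<exists>u\<in>arr C. src C u = src C g \<and> tgt C u = src C k \<and> g = k \<cdot> u"
proof -
  show t [simp]: "f \<in> arr C" "k \<in> arr C" "tgt C k = src C f"
    using k by (auto simp: is_kernel_def Hom_def)
  have "f \<cdot> k = zero_arr C (src C k) (tgt C f)" using k by (simp add: is_kernel_def)
  then show n: "null_arr (f \<cdot> k)" by simp
  have u: "\<exists>!u. u \<in> Hom C (src C g) (src C k) \<and> k \<cdot> u = g"
    if g: "g \<in> arr C" "tgt C g = src C f" "null_arr (f \<cdot> g)" for g
  proof -
    have "f \<cdot> g = zero_arr C (src C g) (tgt C f)" using g by - (rule null_arr_eq; auto)
    moreover have "g \<in> Hom C (src C g) (src C f)" using g by (auto intro: HomI)
    ultimately show ?thesis using k src_obj[OF g(1)] unfolding is_kernel_def by blast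
  qed
  show "\<exists>u\<in>arr C. src C u = src C g \<and> tgt C u = src C k \<and> g = k \<cdot> u"
    if "g \<in> arr C" "tgt C g = src C f" "null_arr (f \<cdot> g)" for g
    using u[OF that] HomD by blast
  show "mono_arr C k"
  proof (rule mono_arrI)
    fix g assume g: "g \<in> arr C" "tgt C g = src C k" "null_arr (k \<cdot> g)"
    let ?z = "zero_arr C (src C g) (src C k)"
    have z: "null_arr (k \<cdot> ?z)" using g by (intro null_cmp) auto
    then have e: "k \<cdot> ?z = k \<cdot> g" using g by - (rule null_arr_unique; auto)
    have "null_arr (f \<cdot> (k \<cdot> g))" using g by (intro null_cmp) auto
    moreover have "g \<in> Hom C (src C (k \<cdot> g)) (src C k)" "?z \<in> Hom C (src C (k \<cdot> g)) (src C k)"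
      using g by (auto intro: HomI)
    ultimately have "g = ?z" using u[of "k \<cdot> g"] g e by auto
    moreover have "null_arr ?z" using g by simp
    ultimately show "null_arr g" by simp
  qed simp
qed

lemma is_cokernelD:
  assumes c: "is_cokernel C c f"
  shows "f \<in> arr C" "c \<in> arr C" "src C c = tgt C f" "null_arr (c \<cdot> f)" "epi_arr C c"
    and "\<And>g. \<lbrakk>g \<in> arr C; src C g = tgt C f; null_arr (g \<cdot> f)\<rbrakk>
      \<Longrightarrow> \<exists>u\<in>arr C. src C u = tgt C c \<and> tgt C u = tgt C g \<and> g = u \<cdot> c"
proof -
  show t [simp]: "f \<in> arr C" "c \<in> arr C" "src C c = tgt C f"
    using c by (auto simp: is_cokernel_def Hom_def)
  have "c \<cdot> f = zero_arr C (src C f) (tgt C c)" using c by (simp add: is_cokernel_def)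
  then show n: "null_arr (c \<cdot> f)" by simp
  have u: "\<exists>!u. u \<in> Hom C (tgt C c) (tgt C g) \<and> u \<cdot> c = g"
    if g: "g \<in> arr C" "src C g = tgt C f" "null_arr (g \<cdot> f)" for g
  proof -
    have "g \<cdot> f = zero_arr C (src C f) (tgt C g)" using g by - (rule null_arr_eq; auto)
    moreover have "g \<in> Hom C (tgt C f) (tgt C g)" using g by (intro HomI) auto
    ultimately show ?thesis using c tgt_obj[OF g(1)] unfolding is_cokernel_def by blast
  qed
  show "\<exists>u\<in>arr C. src C u = tgt C c \<and> tgt C u = tgt C g \<and> g = u \<cdot> c"
    if "g \<in> arr C" "src C g = tgt C f" "null_arr (g \<cdot> f)" for g
    using u[OF that] HomD by blast
  show "epi_arr C c"
  proof (rule epi_arrI)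
    fix g assume g: "g \<in> arr C" "src C g = tgt C c" "null_arr (g \<cdot> c)"
    let ?z = "zero_arr C (tgt C c) (tgt C g)"
    have z: "null_arr (?z \<cdot> c)" using g by (intro null_cmp) auto
    then have e: "?z \<cdot> c = g \<cdot> c" using g by - (rule null_arr_unique; auto)
    have "null_arr ((g \<cdot> c) \<cdot> f)" using g by (intro null_cmp) auto
    moreover have "g \<in> Hom C (tgt C c) (tgt C (g \<cdot> c))" "?z \<in> Hom C (tgt C c) (tgt C (g \<cdot> c))"
      using g by (auto intro: HomI)
    ultimately have "g = ?z" using u[of "g \<cdot> c"] g e by auto
    moreover have "null_arr ?z" using g by simp
    ultimately show "null_arr g" by simp
  qed simp
qed

text \<open>Whatever \<open>f\<close> kills factors through a kernel, and only zero passes through a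
  zero object.\<close>

lemma null_obj_mono_arr:
  assumes "f \<in> arr C" "\<And>k. is_kernel C k f \<Longrightarrow> null_obj (src C k)" "\<exists>k. is_kernel C k f"
  shows "mono_arr C f"
proof (rule mono_arrI[OF assms(1)])
  fix g assume g: "g \<in> arr C" "tgt C g = src C f" "null_arr (f \<cdot> g)"
  obtain k where k: "is_kernel C k f" using assms by blast
  obtain u where u: "u \<in> arr C" "tgt C u = src C k" "g = k \<cdot> u"
    using is_kernelD(6)[OF k g] by blast
  have "null_arr u" by (rule null_obj_arr) (use u assms(2)[OF k] in auto)
  then show "null_arr g" unfolding u(3) by (intro null_cmp) (use u is_kernelD[OF k] in auto)
qed

lemma null_obj_epi_arr:
  assumes "f \<in> arr C" "\<And>c. is_cokernel C c f \<Longrightarrow> null_obj (tgt C c)" "\<exists>c. is_cokernel C c f"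
  shows "epi_arr C f"
proof (rule epi_arrI[OF assms(1)])
  fix g assume g: "g \<in> arr C" "src C g = tgt C f" "null_arr (g \<cdot> f)"
  obtain c where c: "is_cokernel C c f" using assms by blast
  obtain u where u: "u \<in> arr C" "src C u = tgt C c" "g = u \<cdot> c"
    using is_cokernelD(6)[OF c g] by blast
  have "null_arr u" by (rule null_obj_arr) (use u assms(2)[OF c] in auto)
  then show "null_arr g" unfolding u(3) by (intro null_cmp) (use u is_cokernelD[OF c] in auto)
qed

end

section \<open>Balance and image factorisation in abelian categories\<close>

context abelian_category
begin

text \<open>As a monomorphism, \<open>f\<close> is the kernel of some \<open>g\<close>; as an
  epimorphism with \<open>g \<cdot> f = 0\<close>, it forces \<open>g = 0\<close>. Hence the
  identity of the target factors through \<open>f\<close>, and the section so obtained is two-sided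
  because \<open>f\<close> is monic.\<close>

lemma mono_epi_iso:
  assumes m: "mono_arr C f" and e: "epi_arr C f"
  shows "iso_arr C f"
proof -
  have f [simp]: "f \<in> arr C" using m by (rule mono_arr)
  obtain g where k: "is_kernel C f g" using mono_is_kernel[OF m] by blast
  have g: "g \<in> arr C" "tgt C f = src C g" "null_arr (g \<cdot> f)" using is_kernelD[OF k] by auto
  have "null_arr g" by (rule epi_null[OF e]) (use g in auto)
  then obtain s where s: "s \<in> arr C" "src C s = tgt C f" "tgt C s = src C f" "ident C (tgt C f) = f \<cdot> s"
    using is_kernelD(6)[OF k, of "ident C (tgt C f)"] g by auto
  have "f \<cdot> (s \<cdot> f) = (f \<cdot> s) \<cdot> f" using s(1-3) by simp
  also have "\<dots> = f \<cdot> ident C (src C f)" unfolding s(4)[symmetric] by simp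
  finally have "s \<cdot> f = ident C (src C f)" using s(1-3) by - (rule mono_arrD[OF m]; simp)
  then show ?thesis by (intro iso_arrI[where g = s]) (use s in auto)
qed

text \<open>The image is built from the source side, as the quotient of \<open>src C t\<close> by
  the kernel, because it will have to be a quotient of the unit. The content is that the remaining
  factor \<open>i\<close> is monic.\<close>

lemma image_factorization:
  assumes t [simp]: "t \<in> arr C"
  obtains w q i where "is_kernel C w t" "is_cokernel C q w" "mono_arr C i" "src C i = tgt C q"
    "tgt C i = tgt C t" "src C q = src C t" "t = i \<cdot> q"
proof -
  obtain w where w: "is_kernel C w t" using kernels[OF t] by blast
  note W = is_kernelD[OF w]
  obtain q where q: "is_cokernel C q w" using cokernels[OF W(2)] by blast
  note Q = is_cokernelD[OF q]
  note [simp] = W(1-3) Q(1-3)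
  obtain i where i: "i \<in> arr C" "src C i = tgt C q" "tgt C i = tgt C t" "t = i \<cdot> q"
    using Q(6)[OF W(1) W(3)[symmetric] W(4)] by blast
  note [simp] = i(1-3)
  have "mono_arr C i"
  proof (rule mono_arrI)
    fix x assume x: "x \<in> arr C" "tgt C x = src C i" "null_arr (i \<cdot> x)"
    note [simp] = x(1,2)
    \<comment> \<open>It is enough that the cokernel \<open>z\<close> of \<open>x\<close> is monic.
      The epimorphism \<open>z \<cdot> q\<close> is a cokernel of some \<open>v\<close>; since
      \<open>t\<close> factors through it, \<open>t\<close> kills \<open>v\<close>, so
      \<open>v\<close> factors through \<open>w\<close> and \<open>q\<close> kills \<open>v\<close>
      as well. Hence \<open>q\<close> factors through \<open>z \<cdot> q\<close>, which makes
      \<open>z\<close> a split monomorphism.\<close>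
    obtain z where z: "is_cokernel C z x" using cokernels[OF x(1)] by blast
    note Z = is_cokernelD[OF z]
    note [simp] = Z(1-3)
    obtain i' where i': "i' \<in> arr C" "src C i' = tgt C z" "tgt C i' = tgt C i" "i = i' \<cdot> z"
      using Z(6)[of i] x(3) by auto
    note [simp] = i'(1-3)
    have "epi_arr C (z \<cdot> q)" using Z(5) Q(5) by (intro epi_cmp) auto
    then obtain v where v: "is_cokernel C (z \<cdot> q) v" using epi_is_cokernel by blast
    note V = is_cokernelD[OF v]
    have [simp]: "v \<in> arr C" "tgt C v = src C t" using V(1,3) by auto
    have "t \<cdot> v = i' \<cdot> (z \<cdot> q \<cdot> v)"
      unfolding i(4) by (subst i'(4)) simp
    moreover have "null_arr (i' \<cdot> (z \<cdot> q \<cdot> v))" by (rule null_cmp) (use V(4) in auto)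
    ultimately have "null_arr (t \<cdot> v)" by simp
    then obtain n where n: "n \<in> arr C" "src C n = src C v" "tgt C n = src C w" "v = w \<cdot> n"
      using W(6)[of v] by auto
    have "null_arr ((q \<cdot> w) \<cdot> n)" by (rule null_cmp) (use n Q(4) in auto)
    then have "null_arr (q \<cdot> v)" unfolding n(4) using n(1-3) by simp
    then obtain q' where q': "q' \<in> arr C" "src C q' = tgt C z" "tgt C q' = tgt C q" "q = q' \<cdot> (z \<cdot> q)"
      using V(6)[of q] by auto
    have "(q' \<cdot> z) \<cdot> q = ident C (tgt C q) \<cdot> q" using q'(1-3) q'(4)[symmetric] by simp
    then have "q' \<cdot> z = ident C (tgt C q)" using q'(1-3) by - (rule epi_arrD[OF Q(5)]; simp)
    then have "mono_arr C z" by (intro mono_cancel[of z q']) (use q'(1-3) ident_mono_epi in auto)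
    then show "null_arr x" by (rule mono_null) (use Z(4) in auto)
  qed simp
  then show thesis using that[OF w q] i Q(3) W(3) by metis
qed

end

section \<open>Exactness of the tensor product\<close>

context tensor_category
begin

lemma null_tensor:
  assumes f: "null_arr f" and g: "g \<in> arr C"
  shows "null_arr (f \<otimes>\<^sub>m g)" "null_arr (g \<otimes>\<^sub>m f)"
proof -
  have f': "f \<in> arr C" using f by (rule null_arr_arr)
  have H: "f \<in> Hom C (src C f) (tgt C f)" "g \<in> Hom C (src C g) (tgt C g)"
    using f' g by (simp_all add: Hom_def)
  show "null_arr (f \<otimes>\<^sub>m g)"
    using tensor_add_left[OF H(1) H(1) H(2)] null_arr_add[OF f] f' g
    by (intro null_arrI_add) simp_all
  show "null_arr (g \<otimes>\<^sub>m f)"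
    using tensor_add_right[OF H(2) H(1) H(1)] null_arr_add[OF f] f' g
    by (intro null_arrI_add) simp_all
qed

lemma null_obj_tensor:
  assumes "null_obj a" "b \<in> obj C"
  shows "null_obj (a \<otimes>\<^sub>o b)" "null_obj (b \<otimes>\<^sub>o a)"
  using assms null_tensor[of "ident C a" "ident C b"] by (simp_all add: null_obj_def)

lemma null_obj_iso: "iso_arr C f \<Longrightarrow> null_obj (src C f) \<Longrightarrow> null_obj (tgt C f)"
  using null_obj_epi iso_mono_epi(2) by blast

lemma null_obj_commute:
  assumes "a \<in> obj C" "b \<in> obj C" "null_obj (a \<otimes>\<^sub>o b)"
  shows "null_obj (b \<otimes>\<^sub>o a)"
  using null_obj_iso[OF iso_symmetor[OF assms(1,2)]] assms by simp

lemma null_obj_assoc: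
  assumes "a \<in> obj C" "b \<in> obj C" "c \<in> obj C"
  shows "null_obj ((a \<otimes>\<^sub>o b) \<otimes>\<^sub>o c) \<longleftrightarrow> null_obj (a \<otimes>\<^sub>o (b \<otimes>\<^sub>o c))"
  using null_obj_iso[OF associator_iso[OF assms]]
    null_obj_iso[OF iso_inv_arr[OF associator_iso[OF assms]]] assms by auto

end

section \<open>Transposition along duals and preservation of monomorphisms and epimorphisms\<close>

context rigid_tensor_category
begin

text \<open>
  A morphism \<open>g : t \<rightarrow> x \<otimes> a\<close> has a transpose \<open>h : x' \<otimes> t \<rightarrow> a\<close>.  The unit and the
  counit of this adjunction are only shown to compose to some isomorphism, which is all that the
  vanishing statements need; so no coherence beyond the pentagon and the triangle is used.
\<close>

lemma dual_transpose:
  assumes x [simp]: "x \<in> obj C" and a [simp]: "a \<in> obj C"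
    and g [simp]: "g \<in> arr C" "tgt C g = x \<otimes>\<^sub>o a"
  obtains h where "h \<in> arr C" "tgt C h = a"
    "\<And>f. \<lbrakk>f \<in> arr C; src C f = a; null_arr ((ident C x \<otimes>\<^sub>m f) \<cdot> g)\<rbrakk> \<Longrightarrow> null_arr (f \<cdot> h)"
    "null_arr (ident C x \<otimes>\<^sub>m h) \<Longrightarrow> null_arr g"
proof -
  obtain x' ev coev where d: "is_dual C x x' ev coev" using dual[OF x] by blast
  have [simp]: "x' \<in> obj C" "ev \<in> arr C" "src C ev = x' \<otimes>\<^sub>o x" "tgt C ev = tunit C"
    "coev \<in> arr C" "src C coev = tunit C" "tgt C coev = x \<otimes>\<^sub>o x'"
    using d by (auto simp: is_dual_def Hom_def)
  let ?A = "associator C" and ?i = "ident C" and ?I = "inv_arr C" and ?L = "left_unitor C"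
  define t where "t = src C g"
  have [simp]: "src C g = t" "t \<in> obj C" using src_obj[OF g(1)] by (simp_all add: t_def)
  \<comment> \<open>The counit at \<open>b\<close> of the adjunction between
    \<open>x' \<otimes> -\<close> and \<open>x \<otimes> -\<close>; \<open>nat\<close> is its
    naturality.\<close>
  define \<phi> where "\<phi> = (\<lambda>b. ?L b \<cdot> ((ev \<otimes>\<^sub>m ?i b) \<cdot> ?I (?A x' x b)))"
  have \<phi> [simp]: "\<phi> b \<in> arr C" "src C (\<phi> b) = x' \<otimes>\<^sub>o (x \<otimes>\<^sub>o b)" "tgt C (\<phi> b) = b" if "b \<in> obj C" for b
    using that by (simp_all add: \<phi>_def)
  have nat: "f \<cdot> \<phi> a = \<phi> b \<cdot> (?i x' \<otimes>\<^sub>m (?i x \<otimes>\<^sub>m f))"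
    if f [simp]: "f \<in> arr C" "src C f = a" "tgt C f = b" and b [simp]: "b \<in> obj C" for f b
  proof -
    have "f \<cdot> \<phi> a = (f \<cdot> ?L a) \<cdot> ((ev \<otimes>\<^sub>m ?i a) \<cdot> ?I (?A x' x a))"
      unfolding \<phi>_def by simp
    also have "f \<cdot> ?L a = ?L b \<cdot> (?i (tunit C) \<otimes>\<^sub>m f)"
      by (rule left_unitor_natural[symmetric]) (simp add: Hom_def)
    also have "(?L b \<cdot> (?i (tunit C) \<otimes>\<^sub>m f)) \<cdot> ((ev \<otimes>\<^sub>m ?i a) \<cdot> ?I (?A x' x a))
      = ?L b \<cdot> (((?i (tunit C) \<otimes>\<^sub>m f) \<cdot> (ev \<otimes>\<^sub>m ?i a)) \<cdot> ?I (?A x' x a))"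
      by simp
    also have "(?i (tunit C) \<otimes>\<^sub>m f) \<cdot> (ev \<otimes>\<^sub>m ?i a) = (ev \<otimes>\<^sub>m ?i b) \<cdot> (?i (x' \<otimes>\<^sub>o x) \<otimes>\<^sub>m f)"
      using interchange[of ev f "x' \<otimes>\<^sub>o x" "tunit C" a b] by simp
    also have "?L b \<cdot> (((ev \<otimes>\<^sub>m ?i b) \<cdot> (?i (x' \<otimes>\<^sub>o x) \<otimes>\<^sub>m f)) \<cdot> ?I (?A x' x a))
      = ?L b \<cdot> ((ev \<otimes>\<^sub>m ?i b) \<cdot> (((?i x' \<otimes>\<^sub>m ?i x) \<otimes>\<^sub>m f) \<cdot> ?I (?A x' x a)))"
      by simp
    also have "((?i x' \<otimes>\<^sub>m ?i x) \<otimes>\<^sub>m f) \<cdot> ?I (?A x' x a) = ?I (?A x' x b) \<cdot> (?i x' \<otimes>\<^sub>m (?i x \<otimes>\<^sub>m f))"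
      by (rule inv_associator_natural) simp_all
    also have "?L b \<cdot> ((ev \<otimes>\<^sub>m ?i b) \<cdot> (?I (?A x' x b) \<cdot> (?i x' \<otimes>\<^sub>m (?i x \<otimes>\<^sub>m f))))
      = \<phi> b \<cdot> (?i x' \<otimes>\<^sub>m (?i x \<otimes>\<^sub>m f))"
      unfolding \<phi>_def by simp
    finally show ?thesis .
  qed
  define h where "h = \<phi> a \<cdot> (?i x' \<otimes>\<^sub>m g)"
  have h [simp]: "h \<in> arr C" "src C h = x' \<otimes>\<^sub>o t" "tgt C h = a" by (simp_all add: h_def)
  have 1: "null_arr (f \<cdot> h)" if f [simp]: "f \<in> arr C" "src C f = a" and n: "null_arr ((?i x \<otimes>\<^sub>m f) \<cdot> g)" for f
  proof -
    define b where "b = tgt C f"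
    have [simp]: "tgt C f = b" "b \<in> obj C" using tgt_obj[OF f(1)] by (simp_all add: b_def)
    have "f \<cdot> h = (f \<cdot> \<phi> a) \<cdot> (?i x' \<otimes>\<^sub>m g)" unfolding h_def by simp
    also have "\<dots> = \<phi> b \<cdot> (?i x' \<otimes>\<^sub>m ((?i x \<otimes>\<^sub>m f) \<cdot> g))"
      by (subst nat[of f b]) (simp_all add: tensor_cmp_ident)
    also have "null_arr \<dots>"
      by (rule null_cmp) (use null_tensor(2)[OF n, of "?i x'"] in simp_all)
    finally show ?thesis .
  qed
  \<comment> \<open>The isomorphism left over by \<open>dual_unit_counit\<close>, turned into an
    endomorphism of \<open>x \<otimes> a\<close>. It is the identity by coherence, but here it is
    only cancelled.\<close>
  let ?S = "(?L x \<otimes>\<^sub>m ?i a) \<cdot> (?I (?A (tunit C) x a) \<cdot> ?I (?L (x \<otimes>\<^sub>o a)))"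
  have iso: "iso_arr C ?S"
    by (intro iso_cmp iso_tensor iso_ident iso_inv_arr) simp_all
  \<comment> \<open>Up to \<open>?S\<close>, the morphism \<open>g\<close> is recovered from its
    transpose as \<open>x \<otimes> h\<close> after the unit of the adjunction at \<open>t\<close>;
    so it vanishes with \<open>x \<otimes> h\<close>.\<close>
  have S: "?S \<cdot> g = (?i x \<otimes>\<^sub>m h) \<cdot> (?A x x' t \<cdot> ((coev \<otimes>\<^sub>m ?i t) \<cdot> ?I (?L t)))"
  proof -
    have e: "(coev \<otimes>\<^sub>m ?i (x \<otimes>\<^sub>o a)) \<cdot> (?I (?L (x \<otimes>\<^sub>o a)) \<cdot> g)
      = (?i (x \<otimes>\<^sub>o x') \<otimes>\<^sub>m g) \<cdot> ((coev \<otimes>\<^sub>m ?i t) \<cdot> ?I (?L t))"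
    proof -
      have "?I (?L (x \<otimes>\<^sub>o a)) \<cdot> g = (?i (tunit C) \<otimes>\<^sub>m g) \<cdot> ?I (?L t)"
        by (rule inv_unitor_natural) simp_all
      moreover have "(coev \<otimes>\<^sub>m ?i (x \<otimes>\<^sub>o a)) \<cdot> ((?i (tunit C) \<otimes>\<^sub>m g) \<cdot> ?I (?L t))
        = (?i (x \<otimes>\<^sub>o x') \<otimes>\<^sub>m g) \<cdot> ((coev \<otimes>\<^sub>m ?i t) \<cdot> ?I (?L t))"
        using interchange[of coev g "tunit C" "x \<otimes>\<^sub>o x'" t "x \<otimes>\<^sub>o a"]
        by (intro cmp_eq_extend) (simp_all del: tensor_ident')
      ultimately show ?thesis by simp
    qed
    have e2: "?A x x' (x \<otimes>\<^sub>o a) \<cdot> ((?i (x \<otimes>\<^sub>o x') \<otimes>\<^sub>m g) \<cdot> y) = (?i x \<otimes>\<^sub>m (?i x' \<otimes>\<^sub>m g)) \<cdot> (?A x x' t \<cdot> y)"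
      if "y \<in> arr C" "tgt C y = (x \<otimes>\<^sub>o x') \<otimes>\<^sub>o t" for y
      using that associator_natural'[of "?i x" "?i x'" g x x x' x' t "x \<otimes>\<^sub>o a"]
      by (intro cmp_eq_extend) simp_all
    have "?S \<cdot> g = (?L x \<otimes>\<^sub>m ?i a) \<cdot> (?I (?A (tunit C) x a) \<cdot> (?I (?L (x \<otimes>\<^sub>o a)) \<cdot> g))"
      by simp
    also have "\<dots> = (?i x \<otimes>\<^sub>m \<phi> a) \<cdot> (?A x x' (x \<otimes>\<^sub>o a)
        \<cdot> ((coev \<otimes>\<^sub>m ?i (x \<otimes>\<^sub>o a)) \<cdot> (?I (?L (x \<otimes>\<^sub>o a)) \<cdot> g)))"
      unfolding dual_unit_counit[OF d a, folded \<phi>_def, symmetric] by (simp add: \<phi>_def)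
    also have "\<dots> = (?i x \<otimes>\<^sub>m h) \<cdot> (?A x x' t \<cdot> ((coev \<otimes>\<^sub>m ?i t) \<cdot> ?I (?L t)))"
      unfolding e by (simp add: e2 h_def tensor_cmp_ident)
    finally show ?thesis .
  qed
  have 2: "null_arr g" if n: "null_arr (?i x \<otimes>\<^sub>m h)"
  proof (rule mono_null[OF iso_mono_epi(1)[OF iso]])
    show "null_arr (?S \<cdot> g)" unfolding S by (rule null_cmp) (use n in simp_all)
  qed simp_all
  show thesis by (rule that[OF h(1,3) 1 2])
qed

text \<open>The mirror image of \<open>dual_transpose\<close>: a morphism out of
  \<open>b \<otimes> x\<close> is transposed to one from \<open>b\<close> to
  \<open>t \<otimes> x'\<close>. This version serves for epimorphisms.\<close>

lemma dual_transpose':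
  assumes x [simp]: "x \<in> obj C" and b [simp]: "b \<in> obj C"
    and g [simp]: "g \<in> arr C" "src C g = b \<otimes>\<^sub>o x"
  obtains h where "h \<in> arr C" "src C h = b"
    "\<And>f. \<lbrakk>f \<in> arr C; tgt C f = b; null_arr (g \<cdot> (f \<otimes>\<^sub>m ident C x))\<rbrakk> \<Longrightarrow> null_arr (h \<cdot> f)"
    "null_arr h \<Longrightarrow> null_arr g"
proof -
  obtain x' ev coev where d: "is_dual C x x' ev coev" using dual[OF x] by blast
  have [simp]: "x' \<in> obj C" "ev \<in> arr C" "src C ev = x' \<otimes>\<^sub>o x" "tgt C ev = tunit C"
    "coev \<in> arr C" "src C coev = tunit C" "tgt C coev = x \<otimes>\<^sub>o x'"
    using d by (auto simp: is_dual_def Hom_def)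
  let ?A = "associator C" and ?i = "ident C" and ?I = "inv_arr C" and ?R = "right_unitor C"
  define t where "t = tgt C g"
  have [simp]: "tgt C g = t" "t \<in> obj C" using tgt_obj[OF g(1)] by (simp_all add: t_def)
  \<comment> \<open>The unit at \<open>b\<close> of the adjunction between
    \<open>- \<otimes> x\<close> and \<open>- \<otimes> x'\<close>.\<close>
  define \<eta> where "\<eta> = (\<lambda>b. ?I (?A b x x') \<cdot> ((?i b \<otimes>\<^sub>m coev) \<cdot> ?I (?R b)))"
  have \<eta> [simp]: "\<eta> b \<in> arr C" "tgt C (\<eta> b) = (b \<otimes>\<^sub>o x) \<otimes>\<^sub>o x'" "src C (\<eta> b) = b" if "b \<in> obj C" for b
    using that by (simp_all add: \<eta>_def)
  have nat: "\<eta> b \<cdot> f = ((f \<otimes>\<^sub>m ?i x) \<otimes>\<^sub>m ?i x') \<cdot> \<eta> a"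
    if f [simp]: "f \<in> arr C" "src C f = a" "tgt C f = b" and a [simp]: "a \<in> obj C" for f a
  proof -
    have "\<eta> b \<cdot> f = ?I (?A b x x') \<cdot> ((?i b \<otimes>\<^sub>m coev) \<cdot> (?I (?R b) \<cdot> f))"
      unfolding \<eta>_def by simp
    also have "?I (?R b) \<cdot> f = (f \<otimes>\<^sub>m ?i (tunit C)) \<cdot> ?I (?R a)"
      by (rule inv_unitor_natural) simp_all
    also have "(?i b \<otimes>\<^sub>m coev) \<cdot> ((f \<otimes>\<^sub>m ?i (tunit C)) \<cdot> ?I (?R a))
      = (f \<otimes>\<^sub>m (?i x \<otimes>\<^sub>m ?i x')) \<cdot> ((?i a \<otimes>\<^sub>m coev) \<cdot> ?I (?R a))"
      using interchange[of f coev a b "tunit C" "x \<otimes>\<^sub>o x'"]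
      by (intro cmp_eq_extend) simp_all
    also have "?I (?A b x x') \<cdot> ((f \<otimes>\<^sub>m (?i x \<otimes>\<^sub>m ?i x')) \<cdot> ((?i a \<otimes>\<^sub>m coev) \<cdot> ?I (?R a)))
      = ((f \<otimes>\<^sub>m ?i x) \<otimes>\<^sub>m ?i x') \<cdot> (?I (?A a x x') \<cdot> ((?i a \<otimes>\<^sub>m coev) \<cdot> ?I (?R a)))"
      using inv_associator_natural[of f "?i x" "?i x'" a b x x x' x']
      by (intro cmp_eq_extend) simp_all
    finally show ?thesis by (simp add: \<eta>_def)
  qed
  define h where "h = (g \<otimes>\<^sub>m ?i x') \<cdot> \<eta> b"
  have h [simp]: "h \<in> arr C" "src C h = b" "tgt C h = t \<otimes>\<^sub>o x'" by (simp_all add: h_def)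
  have 1: "null_arr (h \<cdot> f)" if f [simp]: "f \<in> arr C" "tgt C f = b" and n: "null_arr (g \<cdot> (f \<otimes>\<^sub>m ?i x))" for f
  proof -
    define a where "a = src C f"
    have [simp]: "src C f = a" "a \<in> obj C" using src_obj[OF f(1)] by (simp_all add: a_def)
    have "h \<cdot> f = (g \<otimes>\<^sub>m ?i x') \<cdot> (\<eta> b \<cdot> f)" unfolding h_def by simp
    also have "\<dots> = ((g \<cdot> (f \<otimes>\<^sub>m ?i x)) \<otimes>\<^sub>m ?i x') \<cdot> \<eta> a"
      by (subst nat[of f a]) (simp_all add: tensor_cmp_ident)
    also have "null_arr \<dots>"
      by (rule null_cmp) (use null_tensor(1)[OF n, of "?i x'"] in simp_all)
    finally show ?thesis .
  qed
  let ?S = "?R (b \<otimes>\<^sub>o x) \<cdot> (?I (?A b x (tunit C)) \<cdot> (?i b \<otimes>\<^sub>m ?I (?R x)))"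
  have iso: "iso_arr C ?S"
    by (intro iso_cmp iso_tensor iso_ident iso_inv_arr) simp_all
  have S: "g \<cdot> ?S = ?R t \<cdot> ((?i t \<otimes>\<^sub>m ev) \<cdot> (?A t x' x \<cdot> (h \<otimes>\<^sub>m ?i x)))"
  proof -
    let ?y = "\<eta> b \<otimes>\<^sub>m ?i x"
    have "g \<cdot> ?S = (g \<cdot> ?R (b \<otimes>\<^sub>o x)) \<cdot> ((?i (b \<otimes>\<^sub>o x) \<otimes>\<^sub>m ev) \<cdot> (?A (b \<otimes>\<^sub>o x) x' x \<cdot> ?y))"
      unfolding dual_unit_counit'[OF d b, symmetric] by (simp add: \<eta>_def)
    also have "g \<cdot> ?R (b \<otimes>\<^sub>o x) = ?R t \<cdot> (g \<otimes>\<^sub>m ?i (tunit C))"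
      by (rule right_unitor_natural[symmetric]) (simp add: Hom_def)
    also have "(?R t \<cdot> (g \<otimes>\<^sub>m ?i (tunit C))) \<cdot> ((?i (b \<otimes>\<^sub>o x) \<otimes>\<^sub>m ev) \<cdot> (?A (b \<otimes>\<^sub>o x) x' x \<cdot> ?y))
      = ?R t \<cdot> ((g \<otimes>\<^sub>m ?i (tunit C)) \<cdot> ((?i (b \<otimes>\<^sub>o x) \<otimes>\<^sub>m ev) \<cdot> (?A (b \<otimes>\<^sub>o x) x' x \<cdot> ?y)))"
      by (simp del: tensor_ident')
    also have "(g \<otimes>\<^sub>m ?i (tunit C)) \<cdot> ((?i (b \<otimes>\<^sub>o x) \<otimes>\<^sub>m ev) \<cdot> (?A (b \<otimes>\<^sub>o x) x' x \<cdot> ?y))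
      = (?i t \<otimes>\<^sub>m ev) \<cdot> ((g \<otimes>\<^sub>m (?i x' \<otimes>\<^sub>m ?i x)) \<cdot> (?A (b \<otimes>\<^sub>o x) x' x \<cdot> ?y))"
      using interchange[of g ev "b \<otimes>\<^sub>o x" t "x' \<otimes>\<^sub>o x" "tunit C"]
      by (intro cmp_eq_extend) simp_all
    also have "(g \<otimes>\<^sub>m (?i x' \<otimes>\<^sub>m ?i x)) \<cdot> (?A (b \<otimes>\<^sub>o x) x' x \<cdot> ?y)
      = ?A t x' x \<cdot> (((g \<otimes>\<^sub>m ?i x') \<otimes>\<^sub>m ?i x) \<cdot> ?y)"
      using associator_natural'[of g "?i x'" "?i x" "b \<otimes>\<^sub>o x" t x' x' x x]
      by (intro cmp_eq_extend) (simp_all del: tensor_ident')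
    also have "((g \<otimes>\<^sub>m ?i x') \<otimes>\<^sub>m ?i x) \<cdot> ?y = h \<otimes>\<^sub>m ?i x"
      unfolding h_def by (simp add: tensor_cmp_ident)
    finally show ?thesis .
  qed
  have 2: "null_arr g" if n: "null_arr h"
  proof (rule epi_null[OF iso_mono_epi(2)[OF iso]])
    have "null_arr (h \<otimes>\<^sub>m ?i x)" using n by (rule null_tensor) simp
    then have "null_arr (?A t x' x \<cdot> (h \<otimes>\<^sub>m ?i x))" by (intro null_cmp) simp_all
    then have "null_arr ((?i t \<otimes>\<^sub>m ev) \<cdot> (?A t x' x \<cdot> (h \<otimes>\<^sub>m ?i x)))" by (intro null_cmp) simp_all
    then show "null_arr (g \<cdot> ?S)" unfolding S by (intro null_cmp) simp_all
  qed simp_all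
  show thesis by (rule that[OF h(1,2) 1 2])
qed

text \<open>Tensoring on the left and on the right are conjugate under the symmetry, so exactness on
  one side carries over to the other.\<close>

lemma tensor_symmetor_conj:
  assumes "f \<in> arr C" "x \<in> obj C"
  shows "f \<otimes>\<^sub>m ident C x = symmetor C x (tgt C f) \<cdot> ((ident C x \<otimes>\<^sub>m f) \<cdot> symmetor C (src C f) x)"
    "ident C x \<otimes>\<^sub>m f = symmetor C (tgt C f) x \<cdot> ((f \<otimes>\<^sub>m ident C x) \<cdot> symmetor C x (src C f))"
proof -
  have "symmetor C x (tgt C f) \<cdot> (ident C x \<otimes>\<^sub>m f) \<cdot> symmetor C (src C f) x
    = (f \<otimes>\<^sub>m ident C x) \<cdot> symmetor C x (src C f) \<cdot> symmetor C (src C f) x"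
    using assms by (subst symmetor_natural') auto
  then show "f \<otimes>\<^sub>m ident C x = symmetor C x (tgt C f) \<cdot> ((ident C x \<otimes>\<^sub>m f) \<cdot> symmetor C (src C f) x)"
    using assms by (simp add: symmetor_involutive)
  have "symmetor C (tgt C f) x \<cdot> (f \<otimes>\<^sub>m ident C x) \<cdot> symmetor C x (src C f)
    = (ident C x \<otimes>\<^sub>m f) \<cdot> symmetor C (src C f) x \<cdot> symmetor C x (src C f)"
    using assms by (subst symmetor_natural') auto
  then show "ident C x \<otimes>\<^sub>m f = symmetor C (tgt C f) x \<cdot> ((f \<otimes>\<^sub>m ident C x) \<cdot> symmetor C x (src C f))"
    using assms by (simp add: symmetor_involutive)
qed

text \<open>\<open>x \<otimes> -\<close> has a left adjoint, and right adjoints preserve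
  monomorphisms: a morphism killed by \<open>x \<otimes> f\<close> has a transpose killed by
  \<open>f\<close>.\<close>

lemma mono_tensor:
  assumes m: "mono_arr C f" and x [simp]: "x \<in> obj C"
  shows "mono_arr C (ident C x \<otimes>\<^sub>m f)" "mono_arr C (f \<otimes>\<^sub>m ident C x)"
proof -
  have f [simp]: "f \<in> arr C" using m by (rule mono_arr)
  show 1: "mono_arr C (ident C x \<otimes>\<^sub>m f)"
  proof (rule mono_arrI)
    fix g assume g: "g \<in> arr C" "tgt C g = src C (ident C x \<otimes>\<^sub>m f)"
      "null_arr ((ident C x \<otimes>\<^sub>m f) \<cdot> g)"
    obtain h where h: "h \<in> arr C" "tgt C h = src C f" "null_arr (f \<cdot> h)"
      "null_arr (ident C x \<otimes>\<^sub>m h) \<Longrightarrow> null_arr g"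
      using g by (elim dual_transpose[rotated 2, of g x "src C f"]) auto
    have "null_arr h" using mono_null[OF m h(1-3)] .
    then show "null_arr g" using h(4) null_tensor(2)[of h "ident C x"] by simp
  qed simp
  show "mono_arr C (f \<otimes>\<^sub>m ident C x)"
    unfolding tensor_symmetor_conj(1)[OF f x]
    by (intro mono_cmp 1 iso_mono_epi(1) iso_symmetor) auto
qed

text \<open>Dually, \<open>- \<otimes> x\<close> has a right adjoint, and left adjoints preserve
  epimorphisms.\<close>

lemma epi_tensor:
  assumes e: "epi_arr C f" and x [simp]: "x \<in> obj C"
  shows "epi_arr C (f \<otimes>\<^sub>m ident C x)" "epi_arr C (ident C x \<otimes>\<^sub>m f)"
proof -
  have f [simp]: "f \<in> arr C" using e by (rule epi_arr)
  show 1: "epi_arr C (f \<otimes>\<^sub>m ident C x)"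
  proof (rule epi_arrI)
    fix g assume g: "g \<in> arr C" "src C g = tgt C (f \<otimes>\<^sub>m ident C x)"
      "null_arr (g \<cdot> (f \<otimes>\<^sub>m ident C x))"
    obtain h where h: "h \<in> arr C" "src C h = tgt C f" "null_arr (h \<cdot> f)" "null_arr h \<Longrightarrow> null_arr g"
      using g by (elim dual_transpose'[rotated 2, of g "tgt C f" x]) auto
    show "null_arr g" using h(4) epi_null[OF e h(1) h(2)[symmetric] h(3)] .
  qed simp
  show "epi_arr C (ident C x \<otimes>\<^sub>m f)"
    unfolding tensor_symmetor_conj(2)[OF f x]
    by (intro epi_cmp 1 iso_mono_epi(2) iso_symmetor) auto
qed

end

section \<open>Coherence at the unit and commutativity of its endomorphisms\<close>

context symmetric_monoidal_category
begin

text \<open>The unitors are natural isomorphisms to the identity functor. This permits proving a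
  coherence law after tensoring it with the unit, where pentagon and triangle apply.\<close>

lemma tensor_unit_faithful:
  assumes f [simp]: "f \<in> arr C" and g [simp]: "g \<in> arr C"
    and s: "src C f = src C g" "tgt C f = tgt C g"
  shows "ident C (tunit C) \<otimes>\<^sub>m f = ident C (tunit C) \<otimes>\<^sub>m g \<Longrightarrow> f = g"
    "f \<otimes>\<^sub>m ident C (tunit C) = g \<otimes>\<^sub>m ident C (tunit C) \<Longrightarrow> f = g"
proof -
  have H: "f \<in> Hom C (src C g) (tgt C g)" "g \<in> Hom C (src C g) (tgt C g)"
    using s by (simp_all add: Hom_def)
  show "f = g" if "ident C (tunit C) \<otimes>\<^sub>m f = ident C (tunit C) \<otimes>\<^sub>m g"
    using left_unitor_natural[OF H(1)] left_unitor_natural[OF H(2)] that s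
    by - (rule iso_cancel_right[of "left_unitor C (src C g)"]; simp)
  show "f = g" if "f \<otimes>\<^sub>m ident C (tunit C) = g \<otimes>\<^sub>m ident C (tunit C)"
    using right_unitor_natural[OF H(1)] right_unitor_natural[OF H(2)] that s
    by - (rule iso_cancel_right[of "right_unitor C (src C g)"]; simp)
qed

text \<open>One of the unit laws that Kelly derived from pentagon and triangle. After tensoring with
  the unit, the pentagon at \<open>1\<close>, \<open>1\<close>, \<open>a\<close>, \<open>b\<close>
  and two uses of the triangle give the equation up to an isomorphism that can be cancelled.\<close>

lemma left_unitor_tensor:
  assumes a [simp]: "a \<in> obj C" and b [simp]: "b \<in> obj C"
  shows "left_unitor C (a \<otimes>\<^sub>o b) \<cdot> associator C (tunit C) a b = left_unitor C a \<otimes>\<^sub>m ident C b"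
proof (rule tensor_unit_faithful(1))
  let ?u = "tunit C" and ?A = "associator C" and ?i = "ident C" and ?L = "left_unitor C"
  \<comment> \<open>The long side of the pentagon without its last factor
    \<open>1 \<otimes> associator\<close>, which is already part of the equation to be
    shown.\<close>
  let ?S = "?A ?u (?u \<otimes>\<^sub>o a) b \<cdot> (?A ?u ?u a \<otimes>\<^sub>m ?i b)"
  show "?i ?u \<otimes>\<^sub>m (?L (a \<otimes>\<^sub>o b) \<cdot> ?A ?u a b) = ?i ?u \<otimes>\<^sub>m (?L a \<otimes>\<^sub>m ?i b)"
  proof (rule iso_cancel_right)
    show "iso_arr C ?S" by (intro iso_cmp iso_tensor iso_ident) simp_all
    have "(?i ?u \<otimes>\<^sub>m (?L (a \<otimes>\<^sub>o b) \<cdot> ?A ?u a b)) \<cdot> ?S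
      = (?i ?u \<otimes>\<^sub>m ?L (a \<otimes>\<^sub>o b)) \<cdot> (?A ?u ?u (a \<otimes>\<^sub>o b) \<cdot> ?A (?u \<otimes>\<^sub>o ?u) a b)"
      unfolding pentagon[OF tunit_obj tunit_obj a b] by (simp add: tensor_cmp_ident)
    also have "\<dots> = (right_unitor C ?u \<otimes>\<^sub>m (?i a \<otimes>\<^sub>m ?i b)) \<cdot> ?A (?u \<otimes>\<^sub>o ?u) a b"
      by (subst cmp_eq_extend'[OF triangle]) simp_all
    also have "\<dots> = ?A ?u a b \<cdot> ((right_unitor C ?u \<otimes>\<^sub>m ?i a) \<otimes>\<^sub>m ?i b)"
      by (rule associator_natural'[symmetric]) simp_all
    also have "right_unitor C ?u \<otimes>\<^sub>m ?i a = (?i ?u \<otimes>\<^sub>m ?L a) \<cdot> ?A ?u ?u a"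
      by (rule triangle[symmetric]) simp_all
    also have "?A ?u a b \<cdot> (((?i ?u \<otimes>\<^sub>m ?L a) \<cdot> ?A ?u ?u a) \<otimes>\<^sub>m ?i b)
      = ?A ?u a b \<cdot> (((?i ?u \<otimes>\<^sub>m ?L a) \<otimes>\<^sub>m ?i b) \<cdot> (?A ?u ?u a \<otimes>\<^sub>m ?i b))"
      by (simp add: tensor_cmp_ident)
    also have "\<dots> = (?i ?u \<otimes>\<^sub>m (?L a \<otimes>\<^sub>m ?i b)) \<cdot> ?S"
      by (intro cmp_eq_extend associator_natural') simp_all
    finally show "(?i ?u \<otimes>\<^sub>m (?L (a \<otimes>\<^sub>o b) \<cdot> ?A ?u a b)) \<cdot> ?S
      = (?i ?u \<otimes>\<^sub>m (?L a \<otimes>\<^sub>m ?i b)) \<cdot> ?S" .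
  qed simp_all
qed simp_all

text \<open>Naturality of the left unitor at itself identifies the left unitor of
  \<open>1 \<otimes> 1\<close> with \<open>1 \<otimes> left_unitor\<close>. Then
  \<open>left_unitor_tensor\<close> and the triangle compute the same composite, once with each
  unitor.\<close>

lemma unitors_tunit: "left_unitor C (tunit C) = right_unitor C (tunit C)"
proof (rule tensor_unit_faithful(2))
  let ?u = "tunit C" and ?i = "ident C" and ?L = "left_unitor C"
  have l: "?L ?u \<in> Hom C (?u \<otimes>\<^sub>o ?u) ?u" by (simp add: Hom_def)
  have e: "?L (?u \<otimes>\<^sub>o ?u) = ?i ?u \<otimes>\<^sub>m ?L ?u"
  proof -
    have "?L ?u \<cdot> (?i ?u \<otimes>\<^sub>m ?L ?u) = ?L ?u \<cdot> ?L (?u \<otimes>\<^sub>o ?u)"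
      by (rule left_unitor_natural[OF l])
    then have "inv_arr C (?L ?u) \<cdot> (?L ?u \<cdot> (?i ?u \<otimes>\<^sub>m ?L ?u))
      = inv_arr C (?L ?u) \<cdot> (?L ?u \<cdot> ?L (?u \<otimes>\<^sub>o ?u))" by simp
    then show ?thesis by (simp del: cmp_assoc')
  qed
  show "?L ?u \<otimes>\<^sub>m ?i ?u = right_unitor C ?u \<otimes>\<^sub>m ?i ?u"
    using left_unitor_tensor[of ?u ?u] triangle[of ?u ?u] unfolding e by simp
qed simp_all

text \<open>Morphisms that meet at the unit can be slid past each other into parallel position. This
  converts composites into tensor products, both for the commutativity of the endomorphisms and for
  the vanishing of V \<otimes> U.\<close>

lemma cmp_tunit:
  assumes g [simp]: "g \<in> arr C" "tgt C g = tunit C" and f [simp]: "f \<in> arr C" "src C f = tunit C"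
  shows "f \<cdot> g = right_unitor C (tgt C f) \<cdot> ((f \<otimes>\<^sub>m g) \<cdot> inv_arr C (left_unitor C (src C g)))"
proof -
  let ?u = "tunit C" and ?i = "ident C" and ?I = "inv_arr C"
  have "right_unitor C (tgt C f) \<cdot> ((f \<otimes>\<^sub>m g) \<cdot> ?I (left_unitor C (src C g)))
    = right_unitor C (tgt C f) \<cdot> ((f \<otimes>\<^sub>m ?i ?u) \<cdot> ((?i ?u \<otimes>\<^sub>m g) \<cdot> ?I (left_unitor C (src C g))))"
    unfolding interchange(1)[OF f(1) g(1) f(2) refl refl g(2), symmetric]
    by (simp del: tensor_ident')
  also have "(?i ?u \<otimes>\<^sub>m g) \<cdot> ?I (left_unitor C (src C g)) = ?I (left_unitor C ?u) \<cdot> g"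
    by (rule inv_unitor_natural[symmetric]) simp_all
  also have "right_unitor C (tgt C f) \<cdot> ((f \<otimes>\<^sub>m ?i ?u) \<cdot> (?I (left_unitor C ?u) \<cdot> g))
    = f \<cdot> (right_unitor C ?u \<cdot> (?I (left_unitor C ?u) \<cdot> g))"
    by (intro cmp_eq_extend right_unitor_natural) (simp_all add: Hom_def)
  also have "\<dots> = f \<cdot> g" unfolding unitors_tunit by simp
  finally show ?thesis ..
qed

text \<open>The Eckmann-Hilton argument: \<open>f \<otimes> g\<close> is split by
  \<open>interchange\<close> in the order opposite to the one used in
  \<open>cmp_tunit\<close>.\<close>

lemma endomorphisms_tunit_commute:
  assumes f: "f \<in> Hom C (tunit C) (tunit C)" and g: "g \<in> Hom C (tunit C) (tunit C)"
  shows "f \<cdot> g = g \<cdot> f"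
proof -
  let ?u = "tunit C" and ?i = "ident C" and ?I = "inv_arr C"
  note [simp] = HomD[OF f] HomD[OF g]
  have "f \<cdot> g = right_unitor C ?u \<cdot> ((f \<otimes>\<^sub>m g) \<cdot> ?I (left_unitor C ?u))"
    using cmp_tunit[of g f] by simp
  also have "f \<otimes>\<^sub>m g = (?i ?u \<otimes>\<^sub>m g) \<cdot> (f \<otimes>\<^sub>m ?i ?u)"
    by (rule interchange(2)[symmetric]) simp_all
  also have "right_unitor C ?u \<cdot> (((?i ?u \<otimes>\<^sub>m g) \<cdot> (f \<otimes>\<^sub>m ?i ?u)) \<cdot> ?I (left_unitor C ?u))
    = left_unitor C ?u \<cdot> ((?i ?u \<otimes>\<^sub>m g) \<cdot> ((f \<otimes>\<^sub>m ?i ?u) \<cdot> ?I (right_unitor C ?u)))"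
    unfolding unitors_tunit by simp
  also have "(f \<otimes>\<^sub>m ?i ?u) \<cdot> ?I (right_unitor C ?u) = ?I (right_unitor C ?u) \<cdot> f"
    by (rule inv_unitor_natural[symmetric]) simp_all
  also have "left_unitor C ?u \<cdot> ((?i ?u \<otimes>\<^sub>m g) \<cdot> (?I (right_unitor C ?u) \<cdot> f))
    = g \<cdot> (left_unitor C ?u \<cdot> (?I (right_unitor C ?u) \<cdot> f))"
    by (intro cmp_eq_extend left_unitor_natural) (simp_all add: Hom_def)
  also have "\<dots> = g \<cdot> f" unfolding unitors_tunit by simp
  finally show ?thesis .
qed

end

context abelian_category
begin

text \<open>\<open>u\<close> is the kernel of some \<open>f\<close>, and \<open>f\<close> factors
  through the cokernel \<open>p\<close>; so everything killed by \<open>p\<close> is killed by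
  \<open>f\<close> and factors through \<open>u\<close>.\<close>

lemma mono_kernel_cokernel:
  assumes u: "mono_arr C u" and p: "is_cokernel C p u"
  shows "is_kernel C u p"
proof -
  obtain f where k: "is_kernel C u f" using mono_is_kernel[OF u] by blast
  note K = is_kernelD[OF k] and P = is_cokernelD[OF p]
  note [simp] = K(1-3) P(1-3)
  obtain f' where f': "f' \<in> arr C" "src C f' = tgt C p" "tgt C f' = tgt C f" "f = f' \<cdot> p"
    using P(6)[of f] K(3,4) by auto
  show ?thesis
    unfolding is_kernel_def
  proof (intro conjI ballI impI)
    show "p \<cdot> u = zero_arr C (src C u) (tgt C p)" using P(4) by (intro null_arr_eq) simp_all
    fix x g assume x: "x \<in> obj C" "g \<in> Hom C x (src C p)" "p \<cdot> g = zero_arr C x (tgt C p)"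
    note [simp] = x(1) HomD[OF x(2)]
    have "null_arr (f' \<cdot> (p \<cdot> g))" unfolding x(3) by (rule null_cmp) (use f'(1,2) in simp_all)
    then have "null_arr (f \<cdot> g)" unfolding f'(4) using f'(1,2) by simp
    then obtain v where v: "v \<in> arr C" "src C v = x" "tgt C v = src C u" "g = u \<cdot> v"
      using K(6)[of g] P(3) by auto
    show "\<exists>!v. v \<in> Hom C x (src C u) \<and> u \<cdot> v = g"
    proof (rule ex1I[of _ v])
      show "v \<in> Hom C x (src C u) \<and> u \<cdot> v = g" using v by (simp add: Hom_def)
      fix v' assume "v' \<in> Hom C x (src C u) \<and> u \<cdot> v' = g"
      then show "v' = v" using v by - (rule mono_arrD[OF u]; simp add: Hom_def)
    qed
  qed (use P(3) in \<open>simp_all add: Hom_def\<close>)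
qed

end

section \<open>Subobjects of the unit split\<close>

context rigid_abelian_tensor_category
begin

text \<open>By the second identity of the dual, \<open>a'\<close> is a retract of
  \<open>a' \<otimes> (a \<otimes> a')\<close>. After tensoring with \<open>v\<close> the larger
  object contains the factor \<open>v \<otimes> a\<close> up to symmetry and associativity, so it is
  zero, and its retract with it.\<close>

lemma null_obj_dual_tensor:
  assumes d: "is_dual C a a' ev coev" and v [simp]: "v \<in> obj C" and n: "null_obj (v \<otimes>\<^sub>o a)"
  shows "null_obj (a' \<otimes>\<^sub>o v)"
proof -
  have [simp]: "a \<in> obj C" "a' \<in> obj C" "ev \<in> arr C" "src C ev = a' \<otimes>\<^sub>o a" "tgt C ev = tunit C"
    "coev \<in> arr C" "src C coev = tunit C" "tgt C coev = a \<otimes>\<^sub>o a'"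
    using d by (auto simp: is_dual_def Hom_def)
  let ?i = "ident C"
  have "null_obj (v \<otimes>\<^sub>o (a \<otimes>\<^sub>o a'))" using null_obj_tensor(1)[OF n, of a'] null_obj_assoc by simp
  then have "null_obj ((a \<otimes>\<^sub>o a') \<otimes>\<^sub>o v)" by (rule null_obj_commute[rotated 2]) simp_all
  then have "null_obj (a' \<otimes>\<^sub>o ((a \<otimes>\<^sub>o a') \<otimes>\<^sub>o v))" by (rule null_obj_tensor(2)) simp
  then have 1: "null_obj ((a' \<otimes>\<^sub>o (a \<otimes>\<^sub>o a')) \<otimes>\<^sub>o v)" using null_obj_assoc by simp
  have 2: "null_arr ((?i a' \<otimes>\<^sub>m coev) \<otimes>\<^sub>m ?i v)" by (rule null_obj_arr) (use 1 in simp_all)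
  have r: "right_unitor C a' = left_unitor C a' \<cdot> ((ev \<otimes>\<^sub>m ?i a') \<cdot> (inv_arr C (associator C a' a a')
      \<cdot> (?i a' \<otimes>\<^sub>m coev)))"
    using d by (simp add: is_dual_def)
  have 3: "right_unitor C a' \<otimes>\<^sub>m ?i v = ((left_unitor C a' \<cdot> ((ev \<otimes>\<^sub>m ?i a')
      \<cdot> inv_arr C (associator C a' a a'))) \<otimes>\<^sub>m ?i v) \<cdot> ((?i a' \<otimes>\<^sub>m coev) \<otimes>\<^sub>m ?i v)"
    unfolding r by (simp add: tensor_cmp_ident)
  have "null_arr (right_unitor C a' \<otimes>\<^sub>m ?i v)"
    unfolding 3 by (rule null_cmp) (use 2 in simp_all)
  moreover have "iso_arr C (right_unitor C a' \<otimes>\<^sub>m ?i v)" by (intro iso_tensor iso_ident) simp_all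
  ultimately have "null_arr (?i (a' \<otimes>\<^sub>o v))"
    by - (rule epi_null[OF iso_mono_epi(2)], assumption, simp_all)
  then show ?thesis by (simp add: null_obj_def)
qed

lemma null_obj_mono_tensor:
  assumes "mono_arr C f" "x \<in> obj C" "null_obj (tgt C f \<otimes>\<^sub>o x)"
  shows "null_obj (src C f \<otimes>\<^sub>o x)"
  using null_obj_mono[OF mono_tensor(2)[OF assms(1,2)]] assms mono_arr[OF assms(1)] by simp

lemma null_obj_epi_tensor:
  assumes "epi_arr C f" "x \<in> obj C" "null_obj (src C f \<otimes>\<^sub>o x)"
  shows "null_obj (tgt C f \<otimes>\<^sub>o x)"
  using null_obj_epi[OF epi_tensor(1)[OF assms(1,2)]] assms epi_arr[OF assms(1)] by simp

text \<open>\<open>cmp_tunit\<close> turns \<open>p \<cdot> u = 0\<close> into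
  \<open>p \<otimes> u = 0\<close>. This morphism is an epimorphism onto
  \<open>V \<otimes> U\<close> followed by a monomorphism, by exactness; cancelling both leaves a
  zero identity.\<close>

lemma null_obj_coker_tensor:
  assumes u: "mono_arr C u" "tgt C u = tunit C" and p: "is_cokernel C p u"
  shows "null_obj (tgt C p \<otimes>\<^sub>o src C u)"
proof -
  note P = is_cokernelD[OF p]
  note [simp] = P(1-3) u(2)
  let ?i = "ident C"
  have "null_arr (right_unitor C (tgt C p) \<cdot> ((p \<otimes>\<^sub>m u) \<cdot> inv_arr C (left_unitor C (src C u))))"
    using P(4) cmp_tunit[of u p] by simp
  then have "null_arr ((p \<otimes>\<^sub>m u) \<cdot> inv_arr C (left_unitor C (src C u)))"
    by (rule mono_null[OF iso_mono_epi(1), rotated -1]) simp_all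
  then have "null_arr (p \<otimes>\<^sub>m u)"
    by (rule epi_null[OF iso_mono_epi(2), rotated -1]) (simp_all add: iso_inv_arr)
  then have "null_arr ((?i (tgt C p) \<otimes>\<^sub>m u) \<cdot> (p \<otimes>\<^sub>m ?i (src C u)))"
    using interchange(2)[of p u] by simp
  then have "null_arr (p \<otimes>\<^sub>m ?i (src C u))"
    by (rule mono_null[OF mono_tensor(1)[OF u(1)], rotated -1]) simp_all
  then have "null_arr (?i (tgt C p \<otimes>\<^sub>o src C u))"
    by - (rule epi_null[OF epi_tensor(1)[OF P(5), of "src C u"]]; simp)
  then show ?thesis by (simp add: null_obj_def)
qed

text \<open>Morally \<open>x\<close> is an extension of \<open>x \<otimes> V\<close> by
  \<open>x \<otimes> U\<close>. Exactness in the middle is replaced by transposition: the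
  isomorphism from \<open>x\<close> to \<open>x \<otimes> 1\<close> has a transpose \<open>h\<close>
  into the unit; \<open>x \<otimes> V = 0\<close> makes \<open>h\<close> factor through
  \<open>u\<close>, then \<open>x \<otimes> U = 0\<close> gives \<open>x \<otimes> h = 0\<close>,
  and so the isomorphism itself vanishes.\<close>

lemma null_obj_by_parts:
  assumes u: "mono_arr C u" "tgt C u = tunit C" and p: "is_cokernel C p u"
    and x [simp]: "x \<in> obj C" and n: "null_obj (x \<otimes>\<^sub>o src C u)" "null_obj (x \<otimes>\<^sub>o tgt C p)"
  shows "null_obj x"
proof -
  note P = is_cokernelD[OF p] and K = is_kernelD[OF mono_kernel_cokernel[OF u(1) p]]
  note [simp] = P(1-3) u(2)
  let ?i = "ident C" and ?g = "inv_arr C (right_unitor C x)"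
  obtain h where h: "h \<in> arr C" "tgt C h = tunit C"
    "\<And>f. \<lbrakk>f \<in> arr C; src C f = tunit C; null_arr ((?i x \<otimes>\<^sub>m f) \<cdot> ?g)\<rbrakk> \<Longrightarrow> null_arr (f \<cdot> h)"
    "null_arr (?i x \<otimes>\<^sub>m h) \<Longrightarrow> null_arr ?g"
    using dual_transpose[of x "tunit C" ?g] by (auto simp: iso_inv_arr)
  have "null_arr ((?i x \<otimes>\<^sub>m p) \<cdot> ?g)" by (rule null_obj_arr) (use n(2) in simp_all)
  then have "null_arr (p \<cdot> h)" by (rule h(3)[rotated 2]) simp_all
  then obtain v where v: "v \<in> arr C" "tgt C v = src C u" "h = u \<cdot> v"
    using K(6)[of h] h(1,2) by auto
  have "null_arr (?i x \<otimes>\<^sub>m v)" by (rule null_obj_arr) (use n(1) v(1,2) in simp_all)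
  then have "null_arr ((?i x \<otimes>\<^sub>m u) \<cdot> (?i x \<otimes>\<^sub>m v))" by (intro null_cmp) (use v in simp_all)
  then have "null_arr (?i x \<otimes>\<^sub>m h)" unfolding v(3) using v by (simp add: tensor_cmp_ident)
  then have "null_arr ?g" by (rule h(4))
  then have "null_arr (right_unitor C x \<cdot> ?g)" by (intro null_cmp) simp_all
  then show ?thesis by (simp add: null_obj_def)
qed

text \<open>
  Let \<open>V\<close> be the cokernel of \<open>u : U \<rightarrow> 1\<close>.  The kernel of \<open>1 \<rightarrow> U \<otimes> U' \<rightarrow> 1 \<otimes> U'\<close> is killed by
  \<open>U\<close> and its image by \<open>V\<close>; so \<open>U\<close> maps isomorphically onto this image, a quotient of the unit.
\<close>

lemma mono_tunit_splits:
  assumes u: "mono_arr C u" "tgt C u = tunit C"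
  obtains r where "r \<in> Hom C (tunit C) (src C u)" "r \<cdot> u = ident C (src C u)"
proof -
  let ?i = "ident C"
  have ua [simp]: "u \<in> arr C" using u(1) by (rule mono_arr)
  obtain p where p: "is_cokernel C p u" using cokernels[OF ua] by blast
  note P = is_cokernelD[OF p] and KP = is_kernelD[OF mono_kernel_cokernel[OF u(1) p]]
  define v where "v = tgt C p"
  define a where "a = src C u"
  have [simp]: "v \<in> obj C" "tgt C p = v" "src C u = a" "a \<in> obj C" "tgt C u = tunit C"
    using P(2) ua u(2) by (simp_all add: v_def a_def)
  note [simp] = P(1-3)
  have va: "null_obj (v \<otimes>\<^sub>o a)" using null_obj_coker_tensor[OF u p] by simp
  obtain a' ev coev where d: "is_dual C a a' ev coev" using dual[of a] by auto
  have [simp]: "a' \<in> obj C" "ev \<in> arr C" "src C ev = a' \<otimes>\<^sub>o a" "tgt C ev = tunit C"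
    "coev \<in> arr C" "src C coev = tunit C" "tgt C coev = a \<otimes>\<^sub>o a'"
    using d by (auto simp: is_dual_def Hom_def)
  define t where "t = (u \<otimes>\<^sub>m ?i a') \<cdot> coev"
  have t [simp]: "t \<in> arr C" "src C t = tunit C" "tgt C t = tunit C \<otimes>\<^sub>o a'" by (simp_all add: t_def)
  obtain w q i where w: "is_kernel C w t" and q: "is_cokernel C q w" and i: "mono_arr C i"
    "src C i = tgt C q" "tgt C i = tgt C t" "src C q = src C t" "t = i \<cdot> q"
    using image_factorization[OF t(1)] by metis
  note W = is_kernelD[OF w] and Q = is_cokernelD[OF q]
  have ia [simp]: "i \<in> arr C" using i(1) by (rule mono_arr)
  note [simp] = W(1-3) Q(1,2) i(2,3,4)
  \<comment> \<open>As \<open>u \<otimes> a'\<close> is monic, \<open>w\<close> is already killed by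
    \<open>coev\<close>. The first identity of the dual exhibits the monomorphism
    \<open>left_unitor C a \<cdot> (w \<otimes> a)\<close> as a composite through
    \<open>(coev \<cdot> w) \<otimes> a\<close>, so its source is zero.\<close>
  have wa: "null_obj (src C w \<otimes>\<^sub>o a)"
  proof -
    have "null_arr (coev \<cdot> w)"
      using W(4) unfolding t_def by - (rule mono_null[OF mono_tensor(2)[OF u(1)]]; simp)
    then have n: "null_arr ((coev \<cdot> w) \<otimes>\<^sub>m ?i a)" by (rule null_tensor) simp
    have l: "left_unitor C a = right_unitor C a \<cdot> ((?i a \<otimes>\<^sub>m ev) \<cdot> (associator C a a' a \<cdot> (coev \<otimes>\<^sub>m ?i a)))"
      using d by (simp add: is_dual_def)
    have e: "left_unitor C a \<cdot> (w \<otimes>\<^sub>m ?i a)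
      = (right_unitor C a \<cdot> ((?i a \<otimes>\<^sub>m ev) \<cdot> associator C a a' a)) \<cdot> ((coev \<cdot> w) \<otimes>\<^sub>m ?i a)"
      unfolding l by (simp add: tensor_cmp_ident)
    have "null_arr (left_unitor C a \<cdot> (w \<otimes>\<^sub>m ?i a))"
      unfolding e by (rule null_cmp) (use n in simp_all)
    moreover have "mono_arr C (left_unitor C a \<cdot> (w \<otimes>\<^sub>m ?i a))"
      by (intro mono_cmp mono_tensor W(5) iso_mono_epi(1)) simp_all
    ultimately have "null_arr (?i (src C w \<otimes>\<^sub>o a))"
      by - (rule mono_null[of "left_unitor C a \<cdot> (w \<otimes>\<^sub>m ?i a)"]; simp)
    then show ?thesis by (simp add: null_obj_def)
  qed
  \<comment> \<open>The image embeds in \<open>1 \<otimes> a'\<close>, and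
    \<open>a' \<otimes> v\<close> is zero because \<open>v \<otimes> a\<close> is.\<close>
  have iv: "null_obj (tgt C q \<otimes>\<^sub>o v)"
  proof -
    have "null_obj (tunit C \<otimes>\<^sub>o (a' \<otimes>\<^sub>o v))"
      by (rule null_obj_tensor(2)[OF null_obj_dual_tensor[OF d _ va]]) simp_all
    then show ?thesis using null_obj_mono_tensor[OF i(1), of v] null_obj_assoc by simp
  qed
  define c where "c = q \<cdot> u"
  have c [simp]: "c \<in> arr C" "src C c = a" "tgt C c = tgt C q" by (simp_all add: c_def)
  \<comment> \<open>The source of a kernel \<open>k\<close> of \<open>c\<close> embeds in
    \<open>a\<close>, hence is killed by \<open>v\<close>; through \<open>u\<close> it also embeds
    in the kernel \<open>w\<close> of \<open>t\<close>, hence is killed by \<open>a\<close>.\<close>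
  have "mono_arr C c"
  proof (rule null_obj_mono_arr)
    fix k assume k: "is_kernel C k c"
    note K = is_kernelD[OF k]
    note [simp] = K(1-3)
    have "null_arr (i \<cdot> (c \<cdot> k))" by (rule null_cmp) (use K(4) in simp_all)
    then have "null_arr (t \<cdot> (u \<cdot> k))" unfolding i(5) c_def by simp
    then obtain n where n: "n \<in> arr C" "src C n = src C k" "tgt C n = src C w" "u \<cdot> k = w \<cdot> n"
      using W(6)[of "u \<cdot> k"] by auto
    have "mono_arr C (w \<cdot> n)" unfolding n(4)[symmetric] using u(1) K(5) by (intro mono_cmp) simp_all
    then have "mono_arr C n" by (rule mono_cancel[rotated -1]) (use n(1-3) in simp_all)
    then have 1: "null_obj (src C k \<otimes>\<^sub>o a)" using null_obj_mono_tensor[of n a] n(2,3) wa by simp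
    have "null_obj (a \<otimes>\<^sub>o v)" using va by (rule null_obj_commute[rotated -1]) simp_all
    then have "null_obj (src C k \<otimes>\<^sub>o v)" using null_obj_mono_tensor[OF K(5), of v] by simp
    with 1 show "null_obj (src C k)" by - (rule null_obj_by_parts[OF u p]; simp)
  qed (simp_all add: kernels)
  \<comment> \<open>The target of a cokernel \<open>j\<close> of \<open>c\<close> is a quotient of
    \<open>v\<close>, since \<open>j \<cdot> q\<close> kills \<open>u\<close>, hence is killed by
    \<open>a\<close>; it is also a quotient of the image, hence is killed by
    \<open>v\<close>.\<close>
  moreover have "epi_arr C c"
  proof (rule null_obj_epi_arr)
    fix j assume j: "is_cokernel C j c"
    note J = is_cokernelD[OF j]
    note [simp] = J(1-3)
    have "null_arr ((j \<cdot> q) \<cdot> u)" using J(4) unfolding c_def by simp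
    then obtain m where m: "m \<in> arr C" "src C m = v" "tgt C m = tgt C j" "j \<cdot> q = m \<cdot> p"
      using P(6)[of "j \<cdot> q"] by auto
    have "epi_arr C (m \<cdot> p)" unfolding m(4)[symmetric] using J(5) Q(5) by (intro epi_cmp) simp_all
    then have "epi_arr C m" by (rule epi_cancel[rotated -1]) (use m(1-3) in simp_all)
    then have 1: "null_obj (tgt C j \<otimes>\<^sub>o a)" using null_obj_epi_tensor[of m a] m(2,3) va by simp
    have "null_obj (tgt C j \<otimes>\<^sub>o v)" using null_obj_epi_tensor[OF J(5), of v] iv by simp
    with 1 show "null_obj (tgt C j)" by - (rule null_obj_by_parts[OF u p]; simp)
  qed (simp_all add: cokernels)
  ultimately have iso: "iso_arr C c" by (rule mono_epi_iso)
  show thesis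
  proof (rule that[of "inv_arr C c \<cdot> q"])
    show "inv_arr C c \<cdot> q \<in> Hom C (tunit C) (src C u)" using iso by (simp add: Hom_def)
    have "inv_arr C c \<cdot> q \<cdot> u = inv_arr C c \<cdot> c" unfolding c_def using iso[unfolded c_def] by simp
    then show "inv_arr C c \<cdot> q \<cdot> u = ?i (src C u)" using iso by simp
  qed
qed

end

section \<open>Idempotents and clopen sets of prime ideals\<close>

definition idempotents :: "('a, 'b) ring_scheme \<Rightarrow> 'a set" where
  "idempotents R = {e \<in> carrier R. e \<otimes>\<^bsub>R\<^esub> e = e}"

definition basic_open :: "('a, 'b) ring_scheme \<Rightarrow> 'a \<Rightarrow> 'a set set" where
  "basic_open R x = {P \<in> Spec R. x \<notin> P}"

lemma (in ring) ideal_Union_chain: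
  assumes "C \<noteq> {}" "\<And>I. I \<in> C \<Longrightarrow> ideal I R" "\<And>I J. \<lbrakk>I \<in> C; J \<in> C\<rbrakk> \<Longrightarrow> I \<subseteq> J \<or> J \<subseteq> I"
  shows "ideal (\<Union>C) R"
proof (rule idealI[OF ring_axioms])
  show "subgroup (\<Union>C) (add_monoid R)"
  proof (rule subgroup.intro)
    show "\<Union>C \<subseteq> carrier (add_monoid R)" using assms(2) ideal.Icarr by fastforce
    show "x \<otimes>\<^bsub>add_monoid R\<^esub> y \<in> \<Union>C" if xy: "x \<in> \<Union>C" "y \<in> \<Union>C" for x y
    proof -
      obtain I where I: "I \<in> C" "x \<in> I" "y \<in> I" using xy assms(3) by blast
      interpret I: ideal I R using assms(2)[OF I(1)] .
      show ?thesis using I I.a_closed by auto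
    qed
    show "\<one>\<^bsub>add_monoid R\<^esub> \<in> \<Union>C"
    proof -
      obtain I where I: "I \<in> C" using assms(1) by blast
      interpret I: ideal I R using assms(2)[OF I] .
      have "\<zero> \<in> \<Union>C" using I additive_subgroup.zero_closed[OF I.is_additive_subgroup] by blast
      then show ?thesis by simp
    qed
    show "inv\<^bsub>add_monoid R\<^esub> x \<in> \<Union>C" if x: "x \<in> \<Union>C" for x
    proof -
      obtain I where I: "I \<in> C" "x \<in> I" using x by blast
      interpret I: ideal I R using assms(2)[OF I(1)] .
      show ?thesis using I I.a_inv_closed[OF I(2)] by (auto simp: a_inv_def)
    qed
  qed
  show "x \<otimes> a \<in> \<Union>C" "a \<otimes> x \<in> \<Union>C" if a: "a \<in> \<Union>C" and x: "x \<in> carrier R" for a x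
  proof -
    obtain I where I: "I \<in> C" "a \<in> I" using a by blast
    interpret I: ideal I R using assms(2)[OF I(1)] .
    show "x \<otimes> a \<in> \<Union>C" "a \<otimes> x \<in> \<Union>C" using I I.I_l_closed x I.I_r_closed by blast+
  qed
qed

context cring
begin

text \<open>Krull's theorem: Zorn's lemma on the ideals above \<open>I\<close> that avoid \<one>,
  where unions bound chains. A maximal such ideal is a maximal ideal, hence prime in a commutative
  ring.\<close>

lemma proper_ideal_subset_prime:
  assumes I: "ideal I R" and n: "\<one> \<notin> I"
  obtains P where "P \<in> Spec R" "I \<subseteq> P"
proof -
  let ?A = "{J. ideal J R \<and> I \<subseteq> J \<and> \<one> \<notin> J}"
  have "\<exists>M\<in>?A. \<forall>X\<in>?A. M \<subseteq> X \<longrightarrow> X = M"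
  proof (rule subset_Zorn_nonempty)
    show "?A \<noteq> {}" using I n by blast
    fix C assume C: "C \<noteq> {}" "subset.chain ?A C"
    have "ideal (\<Union>C) R"
    proof (rule ideal_Union_chain)
      show "ideal J R" if "J \<in> C" for J using C(2) that by (auto simp: subset_chain_def)
      show "J \<subseteq> K \<or> K \<subseteq> J" if "J \<in> C" "K \<in> C" for J K
        using C(2) that unfolding subset_chain_def by blast
    qed (rule C(1))
    moreover have "I \<subseteq> J \<and> \<one> \<notin> J" if "J \<in> C" for J
      using C(2) that unfolding subset_chain_def by blast
    ultimately show "\<Union>C \<in> ?A" using C(1) by blast
  qed
  then obtain M where "M \<in> ?A" and max: "\<forall>X\<in>?A. M \<subseteq> X \<longrightarrow> X = M" ..
  then have M: "ideal M R" "I \<subseteq> M" "\<one> \<notin> M" by simp_all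
  have "maximalideal M R"
  proof (rule maximalidealI[OF M(1)])
    show "carrier R \<noteq> M" using M(3) one_closed by metis
    fix J assume J: "ideal J R" "M \<subseteq> J" "J \<subseteq> carrier R"
    show "J = M \<or> J = carrier R"
    proof (cases "\<one> \<in> J")
      case True
      then show ?thesis using ideal.one_imp_carrier[OF J(1)] by simp
    next
      case False
      then have "J \<in> ?A" using J(1,2) M(2) by blast
      then show ?thesis using max J(2) by blast
    qed
  qed
  then have "M \<in> Spec R" by (simp add: Spec_def maximalideal_prime)
  then show thesis using M(2) that by blast
qed

lemma idempotents_closed: "e \<in> idempotents R \<Longrightarrow> e \<in> carrier R"
  by (simp add: idempotents_def)

lemma idempotent_complement:
  assumes "e \<in> idempotents R"
  shows "\<one> \<ominus> e \<in> idempotents R" "e \<otimes> (\<one> \<ominus> e) = \<zero>" "e \<oplus> (\<one> \<ominus> e) = \<one>"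
proof -
  have e: "e \<in> carrier R" "e \<otimes> e = e" using assms by (simp_all add: idempotents_def)
  have "e \<otimes> (\<one> \<ominus> e) = e \<ominus> e \<otimes> e" using e(1) by algebra
  then show 1: "e \<otimes> (\<one> \<ominus> e) = \<zero>" using e by (simp add: minus_eq r_neg)
  have "(\<one> \<ominus> e) \<otimes> (\<one> \<ominus> e) = \<one> \<ominus> e \<ominus> e \<otimes> (\<one> \<ominus> e)" using e(1) by algebra
  also have "\<dots> = \<one> \<ominus> e" unfolding 1 using e(1) by algebra
  finally show "\<one> \<ominus> e \<in> idempotents R" using e(1) by (simp add: idempotents_def)
  show "e \<oplus> (\<one> \<ominus> e) = \<one>" using e(1) by algebra
qed

lemma idempotent_mult:
  assumes "e \<in> idempotents R" "f \<in> idempotents R"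
  shows "e \<otimes> f \<in> idempotents R"
proof -
  have e: "e \<in> carrier R" "e \<otimes> e = e" "f \<in> carrier R" "f \<otimes> f = f"
    using assms by (simp_all add: idempotents_def)
  have "(e \<otimes> f) \<otimes> (e \<otimes> f) = (e \<otimes> e) \<otimes> (f \<otimes> f)" using e(1,3) by algebra
  then show ?thesis using e by (simp add: idempotents_def)
qed

text \<open>No prime can contain \<open>\<one> \<ominus> e\<close> together with \<open>e\<close>,
  so \<open>\<one> \<ominus> e\<close> is a unit; as it annihilates \<open>e\<close>, the latter is
  zero.\<close>

lemma idempotent_in_all_primes:
  assumes e: "e \<in> idempotents R" and P: "\<And>P. P \<in> Spec R \<Longrightarrow> e \<in> P"
  shows "e = \<zero>"
proof -
  note E = idempotents_closed[OF e] idempotent_complement[OF e]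
  have c: "\<one> \<ominus> e \<in> carrier R" using E(1) by simp
  have "\<one> \<in> PIdl (\<one> \<ominus> e)"
  proof (rule ccontr)
    assume "\<one> \<notin> PIdl (\<one> \<ominus> e)"
    then obtain Q where Q: "Q \<in> Spec R" "PIdl (\<one> \<ominus> e) \<subseteq> Q"
      using proper_ideal_subset_prime[OF cgenideal_ideal[OF c]] by blast
    interpret Q: primeideal Q R using Q(1) by (simp add: Spec_def)
    have "\<one> \<ominus> e \<in> Q" using Q(2) cgenideal_self[OF c] by blast
    then have "\<one> \<in> Q" using Q.a_closed[OF P[OF Q(1)], of "\<one> \<ominus> e"] E(4) by simp
    then show False using Q.one_imp_carrier Q.I_notcarr by blast
  qed
  then obtain y where y: "y \<in> carrier R" "\<one> = y \<otimes> (\<one> \<ominus> e)" by (auto simp: cgenideal_def)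
  have "e = e \<otimes> (y \<otimes> (\<one> \<ominus> e))" using E(1) y(2)[symmetric] by simp
  also have "\<dots> = y \<otimes> (e \<otimes> (\<one> \<ominus> e))" using E(1) y(1) by algebra
  also have "\<dots> = \<zero>" unfolding E(3) using y(1) by simp
  finally show ?thesis .
qed

lemma basic_open_mult:
  assumes "x \<in> carrier R" "y \<in> carrier R"
  shows "basic_open R (x \<otimes> y) = basic_open R x \<inter> basic_open R y"
proof -
  have "x \<otimes> y \<in> P \<longleftrightarrow> x \<in> P \<or> y \<in> P" if "P \<in> Spec R" for P
  proof -
    interpret P: primeideal P R using that by (simp add: Spec_def)
    show ?thesis
      using P.I_prime[OF assms] P.I_l_closed[OF _ assms(1), of y] P.I_r_closed[OF _ assms(2), of x]
      by blast
  qed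
  then show ?thesis by (auto simp: basic_open_def)
qed

text \<open>A prime contains \<open>e\<close> or its complement since their product is zero, and not
  both since their sum is \<one>.\<close>

lemma basic_open_complement:
  assumes e: "e \<in> idempotents R"
  shows "basic_open R (\<one> \<ominus> e) = Spec R - basic_open R e"
proof -
  note E = idempotents_closed[OF e] idempotent_complement[OF e]
  have c: "\<one> \<ominus> e \<in> carrier R" using E(1) by simp
  have "\<one> \<ominus> e \<in> P \<longleftrightarrow> e \<notin> P" if "P \<in> Spec R" for P
  proof -
    interpret P: primeideal P R using that by (simp add: Spec_def)
    have "e \<in> P \<or> \<one> \<ominus> e \<in> P" using P.I_prime[OF E(1) c] E(3) additive_subgroup.zero_closed[OF P.is_additive_subgroup] by simp
    moreover have "\<not> (e \<in> P \<and> \<one> \<ominus> e \<in> P)"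
      using P.a_closed[of e "\<one> \<ominus> e"] E(4) P.one_imp_carrier P.I_notcarr by auto
    ultimately show ?thesis by blast
  qed
  then show ?thesis by (auto simp: basic_open_def)
qed

text \<open>The inclusion says that the idempotent \<open>e \<otimes> (\<one> \<ominus> f)\<close>,
  whose basic open set is the difference of the two, lies in every prime and therefore
  vanishes.\<close>

lemma basic_open_subset_iff:
  assumes e: "e \<in> idempotents R" and f: "f \<in> idempotents R"
  shows "basic_open R e \<subseteq> basic_open R f \<longleftrightarrow> f \<otimes> e = e"
proof
  note c [simp] = idempotents_closed[OF e] idempotents_closed[OF f]
  assume s: "basic_open R e \<subseteq> basic_open R f"
  let ?g = "e \<otimes> (\<one> \<ominus> f)"
  have "basic_open R ?g = {}"
    using s basic_open_complement[OF f] by (auto simp: basic_open_mult)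
  then have "?g = \<zero>"
    by (intro idempotent_in_all_primes idempotent_mult e idempotent_complement(1) f)
      (auto simp: basic_open_def)
  moreover have "f \<otimes> e = e \<ominus> ?g" using c by algebra
  moreover have "e \<ominus> \<zero> = e" using c(1) by algebra
  ultimately show "f \<otimes> e = e" by simp
next
  assume s: "f \<otimes> e = e"
  show "basic_open R e \<subseteq> basic_open R f"
    using basic_open_mult[OF f[THEN idempotents_closed] e[THEN idempotents_closed]] unfolding s by blast
qed

lemma basic_open_inj: "inj_on (basic_open R) (idempotents R)"
proof (rule inj_onI)
  fix e f assume e: "e \<in> idempotents R" and f: "f \<in> idempotents R" and s: "basic_open R e = basic_open R f"
  have "f \<otimes> e = e" "e \<otimes> f = f"
    using basic_open_subset_iff[OF e f] basic_open_subset_iff[OF f e] s by auto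
  then show "e = f" using m_comm[of e f] e f idempotents_closed by metis
qed

lemma basic_open_clopen:
  assumes e: "e \<in> idempotents R"
  shows "basic_open R e \<in> clopens (zariski R)"
proof -
  have o: "zariski_open R (basic_open R x)" if "x \<in> carrier R" for x
    unfolding zariski_open_def basic_open_def using that by (intro exI[of _ "{x}"]) auto
  have c: "\<one> \<ominus> e \<in> carrier R" using idempotents_closed[OF e] by simp
  show ?thesis
    using o[OF idempotents_closed[OF e]] o[OF c] unfolding basic_open_complement[OF e]
    by (auto simp: clopens_def closedin_def openin_zariski topspace_zariski basic_open_def)
qed

text \<open>\<open>S\<close> and its complement are the open sets of \<open>I\<close> and
  \<open>J\<close>. No prime contains both, so the generated ideals are comaximal and \<one> is a
  sum \<open>a \<oplus> b\<close>. The product \<open>a \<otimes> b\<close> lies in every prime;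
  once it is zero, \<open>a\<close> is idempotent and cuts out \<open>S\<close>.\<close>

lemma clopen_basic_open:
  assumes flat: "absolutely_flat R" and S: "S \<in> clopens (zariski R)"
  obtains e where "e \<in> idempotents R" "basic_open R e = S"
proof -
  have "zariski_open R S" "zariski_open R (Spec R - S)" "S \<subseteq> Spec R"
    using S by (auto simp: clopens_def closedin_def openin_zariski topspace_zariski)
  then obtain I J where I: "I \<subseteq> carrier R" "S = {P \<in> Spec R. \<not> I \<subseteq> P}"
    and J: "J \<subseteq> carrier R" "Spec R - S = {P \<in> Spec R. \<not> J \<subseteq> P}"
    unfolding zariski_open_def by blast
  note gI = genideal_ideal[OF I(1)] and gJ = genideal_ideal[OF J(1)]
  have sum: "ideal (set_add R (Idl I) (Idl J)) R" by (rule add_ideals[OF gI gJ])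
  have sub: "Idl I \<subseteq> set_add R (Idl I) (Idl J)" "Idl J \<subseteq> set_add R (Idl I) (Idl J)"
    using union_genideal[OF gI gJ] genideal_self[of "Idl I \<union> Idl J"]
      ideal.Icarr[OF gI] ideal.Icarr[OF gJ] by blast+
  have "\<one> \<in> set_add R (Idl I) (Idl J)"
  proof (rule ccontr)
    assume "\<one> \<notin> set_add R (Idl I) (Idl J)"
    then obtain P where P: "P \<in> Spec R" "set_add R (Idl I) (Idl J) \<subseteq> P"
      using proper_ideal_subset_prime[OF sum] by blast
    have "I \<subseteq> P" "J \<subseteq> P"
      using sub genideal_self[OF I(1)] genideal_self[OF J(1)] P(2) by (meson subset_trans)+
    then have "P \<notin> S" "P \<notin> Spec R - S" unfolding J(2) by (simp_all add: I(2))
    then show False using P(1) by simp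
  qed
  then obtain a b where ab: "a \<in> Idl I" "b \<in> Idl J" "\<one> = a \<oplus> b"
    unfolding set_add_def' by blast
  have c: "a \<in> carrier R" "b \<in> carrier R" using ab ideal.Icarr[OF gI] ideal.Icarr[OF gJ] by auto
  have aP: "a \<in> P" if "P \<in> Spec R" "P \<notin> S" for P
  proof -
    have "I \<subseteq> P" "ideal P R" using that I(2) by (auto simp: Spec_def primeideal_def)
    then show ?thesis using genideal_minimal ab(1) by blast
  qed
  have bP: "b \<in> P" if "P \<in> Spec R" "P \<in> S" for P
  proof -
    have "J \<subseteq> P" "ideal P R" using that J(2) by (auto simp: Spec_def primeideal_def)
    then show ?thesis using genideal_minimal ab(2) by blast
  qed
  have z: "a \<otimes> b = \<zero>"
  proof -
    have m: "a \<otimes> b \<in> carrier R" using c by simp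
    then obtain y where y: "y \<in> carrier R" "(a \<otimes> b) \<otimes> y \<otimes> (a \<otimes> b) = a \<otimes> b"
      using flat unfolding absolutely_flat_def by blast
    \<comment> \<open>Flatness makes \<open>(a \<otimes> b) \<otimes> y\<close> an idempotent that
      generates the same ideal as \<open>a \<otimes> b\<close>. It too lies in every prime, and for
      idempotents that means zero.\<close>
    have "((a \<otimes> b) \<otimes> y) \<otimes> ((a \<otimes> b) \<otimes> y) = ((a \<otimes> b) \<otimes> y \<otimes> (a \<otimes> b)) \<otimes> y"
      using m_assoc[of "(a \<otimes> b) \<otimes> y" "a \<otimes> b" y] m y(1) by simp
    then have "(a \<otimes> b) \<otimes> y \<in> idempotents R" using m y by (simp add: idempotents_def)
    moreover have "(a \<otimes> b) \<otimes> y \<in> P" if P: "P \<in> Spec R" for P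
    proof -
      interpret P: primeideal P R using P by (simp add: Spec_def)
      have "a \<otimes> b \<in> P" using aP[OF P] bP[OF P] P.I_l_closed P.I_r_closed c by blast
      then show ?thesis using P.I_r_closed y(1) by blast
    qed
    ultimately have "(a \<otimes> b) \<otimes> y = \<zero>" by (rule idempotent_in_all_primes)
    then show ?thesis using y(2) m by simp
  qed
  have "a = a \<otimes> (a \<oplus> b)" using ab(3)[symmetric] c by simp
  also have "\<dots> = a \<otimes> a" using c z by (simp add: r_distr)
  finally have e: "a \<in> idempotents R" using c by (simp add: idempotents_def)
  have "a \<notin> P" if P: "P \<in> Spec R" "P \<in> S" for P
  proof
    interpret P: primeideal P R using P by (simp add: Spec_def)
    assume "a \<in> P"
    then have "\<one> \<in> P" using P.a_closed bP[OF P] ab(3) by simp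
    then show False using P.one_imp_carrier P.I_notcarr by blast
  qed
  then have "basic_open R a = S" using aP \<open>S \<subseteq> Spec R\<close> by (auto simp: basic_open_def)
  then show thesis using that e by blast
qed

lemma bij_basic_open:
  assumes "absolutely_flat R"
  shows "bij_betw (basic_open R) (idempotents R) (clopens (zariski R))"
  unfolding bij_betw_def
proof (intro conjI basic_open_inj subset_antisym)
  show "basic_open R ` idempotents R \<subseteq> clopens (zariski R)" using basic_open_clopen by blast
  show "clopens (zariski R) \<subseteq> basic_open R ` idempotents R"
    using clopen_basic_open[OF assms] by blast
qed

end

section \<open>Idempotents and subobjects\<close>

text \<open>All monomorphisms through which the idempotent \<open>e\<close> splits. Taking them all,
  and not one choice, makes the set a full equivalence class, hence directly an element of
  \<open>subobjects\<close>.\<close>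

definition (in category) split_monos :: "'a \<Rightarrow> 'a set" where
  "split_monos e = {i \<in> arr C. \<exists>r\<in>Hom C (tgt C i) (src C i).
     r \<cdot> i = ident C (src C i) \<and> i \<cdot> r = e}"

context category
begin

lemma split_monosD:
  assumes "i \<in> split_monos e"
  obtains r where "i \<in> arr C" "r \<in> arr C" "src C r = tgt C i" "tgt C r = src C i"
    "r \<cdot> i = ident C (src C i)" "e = i \<cdot> r"
  using assms unfolding split_monos_def Hom_def by blast

lemma split_monos_Hom:
  assumes "i \<in> split_monos e"
  shows "i \<in> arr C" "e \<in> Hom C (tgt C i) (tgt C i)"
  using assms by (auto elim!: split_monosD simp: Hom_def)

text \<open>A factorisation can be tested by an equation, because \<open>e\<close> acts as the
  identity on the image of \<open>i\<close> and \<open>r\<close> supplies the factor.\<close>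

lemma split_monos_factor:
  assumes i: "i \<in> split_monos e" and x [simp]: "x \<in> arr C" and t: "tgt C x = tgt C i"
  shows "(\<exists>h\<in>Hom C (src C x) (src C i). x = i \<cdot> h) \<longleftrightarrow> e \<cdot> x = x"
proof -
  obtain r where r: "i \<in> arr C" "r \<in> arr C" "src C r = tgt C i" "tgt C r = src C i"
    "r \<cdot> i = ident C (src C i)" "e = i \<cdot> r"
    using i by (rule split_monosD)
  note [simp] = r(1-4) t
  show ?thesis
  proof
    assume "\<exists>h\<in>Hom C (src C x) (src C i). x = i \<cdot> h"
    then obtain h where h: "h \<in> arr C" "src C h = src C x" "tgt C h = src C i" "x = i \<cdot> h"
      by (auto simp: Hom_def)
    have "r \<cdot> (i \<cdot> h) = h" using cmp_eq_extend'[OF r(5), of h] h by simp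
    then show "e \<cdot> x = x" unfolding r(6) h(4) using h(1-3) by simp
  next
    assume "e \<cdot> x = x"
    then have "x = i \<cdot> (r \<cdot> x)" unfolding r(6) by simp
    moreover have "r \<cdot> x \<in> Hom C (src C x) (src C i)" by (simp add: Hom_def)
    ultimately show "\<exists>h\<in>Hom C (src C x) (src C i). x = i \<cdot> h" by blast
  qed
qed

lemma split_monos_absorb:
  assumes "i \<in> split_monos e"
  shows "e \<cdot> i = i"
  using split_monos_factor[OF assms split_monos_Hom(1)[OF assms] refl] split_monos_Hom[OF assms]
    ident_Hom[of "src C i"] by (auto intro!: bexI[of _ "ident C (src C i)"])

text \<open>The order of subobjects becomes the order of idempotents: \<open>f\<close> fixes
  \<open>i\<close> exactly if it fixes \<open>e\<close>, since \<open>e = i \<cdot> r\<close> and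
  \<open>e \<cdot> i = i\<close>.\<close>

lemma split_monos_factors_through:
  assumes i: "i \<in> split_monos e" and j: "j \<in> split_monos f" and t: "tgt C i = tgt C j"
  shows "factors_through C i j \<longleftrightarrow> f \<cdot> e = e"
proof -
  obtain r where r: "i \<in> arr C" "r \<in> arr C" "src C r = tgt C i" "tgt C r = src C i"
    "r \<cdot> i = ident C (src C i)" "e = i \<cdot> r"
    using i by (rule split_monosD)
  have f: "f \<in> arr C" "src C f = tgt C i" using split_monos_Hom(2)[OF j] t by (simp_all add: Hom_def)
  note [simp] = r(1-4) f
  have "f \<cdot> i = i \<longleftrightarrow> f \<cdot> e = e"
  proof
    assume fi: "f \<cdot> i = i"
    show "f \<cdot> e = e" unfolding r(6) by (rule cmp_eq_extend'[OF fi]) simp_all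
  next
    assume fe: "f \<cdot> e = e"
    have "f \<cdot> (e \<cdot> i) = e \<cdot> i"
      by (rule cmp_eq_extend'[OF fe]) (use HomD[OF split_monos_Hom(2)[OF i]] in simp_all)
    then show "f \<cdot> i = i" unfolding split_monos_absorb[OF i] .
  qed
  then show ?thesis unfolding factors_through_def split_monos_factor[OF j r(1) t] .
qed

end

lemma (in additive_category) split_monos_mono:
  assumes "i \<in> split_monos e"
  shows "mono_arr C i"
proof -
  obtain r where r: "i \<in> arr C" "r \<in> arr C" "src C r = tgt C i" "tgt C r = src C i"
    "r \<cdot> i = ident C (src C i)"
    using assms by (rule split_monosD)
  show ?thesis by (rule mono_cancel[of i r]) (use r ident_mono_epi(1) in simp_all)
qed

text \<open>Kernels are determined only up to isomorphism. Since \<open>subobj_sum\<close> collects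
  all of them, an arbitrary representative has to be recognised as a kernel from a single
  constructed one.\<close>

lemma (in additive_category) is_kernel_iso:
  assumes k: "is_kernel C k f" and l: "l \<in> arr C" and h: "h \<in> Hom C (src C k) (src C l)" "k = l \<cdot> h"
    and h': "h' \<in> Hom C (src C l) (src C k)" "l = k \<cdot> h'" and m: "mono_arr C l"
  shows "is_kernel C l f"
proof -
  note K = is_kernelD[OF k]
  note [simp] = K(1-3) HomD[OF h(1)] HomD[OF h'(1)] l
  have t [simp]: "tgt C l = src C f"
  proof -
    have "tgt C (k \<cdot> h') = tgt C k" by simp
    then show ?thesis using h'(2) by simp
  qed
  have "null_arr ((f \<cdot> k) \<cdot> h')" by (rule null_cmp) (use K(4) in simp_all)
  then have "null_arr (f \<cdot> (k \<cdot> h'))" by simp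
  then have n: "null_arr (f \<cdot> l)" unfolding h'(2)[symmetric] .
  show ?thesis
    unfolding is_kernel_def
  proof (intro conjI ballI impI)
    show "f \<cdot> l = zero_arr C (src C l) (tgt C f)" using n by (rule null_arr_eq) simp_all
    show "l \<in> Hom C (src C l) (src C f)" by (simp add: Hom_def)
    fix x g assume x: "x \<in> obj C" "g \<in> Hom C x (src C f)" "f \<cdot> g = zero_arr C x (tgt C f)"
    note [simp] = x(1) HomD[OF x(2)]
    have "null_arr (f \<cdot> g)" unfolding x(3) by simp
    then obtain v where v: "v \<in> arr C" "src C v = x" "tgt C v = src C k" "g = k \<cdot> v"
      using K(6)[of g] by auto
    show "\<exists>!v. v \<in> Hom C x (src C l) \<and> l \<cdot> v = g"
    proof (rule ex1I[of _ "h \<cdot> v"])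
      have "l \<cdot> (h \<cdot> v) = k \<cdot> v" using cmp_eq_extend'[OF h(2)[symmetric], of v] v by simp
      then show 1: "h \<cdot> v \<in> Hom C x (src C l) \<and> l \<cdot> (h \<cdot> v) = g" using v by (simp add: Hom_def)
      fix w assume w: "w \<in> Hom C x (src C l) \<and> l \<cdot> w = g"
      then have wv: "l \<cdot> w = l \<cdot> (h \<cdot> v)" using 1 by simp
      show "w = h \<cdot> v"
        using w v by - (rule mono_arrD[OF m _ _ _ _ _ wv]; simp add: Hom_def)
    qed
  qed simp
qed

section \<open>Fibre products of monomorphisms and copairings on biproducts\<close>

context additive_category
begin

lemma is_pullbackD:
  assumes "is_pullback C i j p q"
  shows "i \<in> arr C" "j \<in> arr C" "tgt C i = tgt C j" "p \<in> arr C" "q \<in> arr C" "tgt C p = src C i"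
    "tgt C q = src C j" "src C q = src C p" "i \<cdot> p = j \<cdot> q"
    and "\<And>g h. \<lbrakk>g \<in> arr C; h \<in> arr C; src C g = src C h; tgt C g = src C i; tgt C h = src C j;
      i \<cdot> g = j \<cdot> h\<rbrakk> \<Longrightarrow> \<exists>!u. u \<in> Hom C (src C h) (src C p) \<and> p \<cdot> u = g \<and> q \<cdot> u = h"
proof -
  note pb = assms[unfolded is_pullback_def]
  show t: "i \<in> arr C" "j \<in> arr C" "tgt C i = tgt C j" "p \<in> arr C" "q \<in> arr C" "tgt C p = src C i"
    "tgt C q = src C j" "src C q = src C p" "i \<cdot> p = j \<cdot> q"
    using pb by (simp_all add: Hom_def)
  fix g h assume g: "g \<in> arr C" "h \<in> arr C" "src C g = src C h" "tgt C g = src C i"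
    "tgt C h = src C j" "i \<cdot> g = j \<cdot> h"
  then have "g \<in> Hom C (src C h) (src C i)" "h \<in> Hom C (src C h) (src C j)"
    by (simp_all add: Hom_def)
  then show "\<exists>!u. u \<in> Hom C (src C h) (src C p) \<and> p \<cdot> u = g \<and> q \<cdot> u = h"
    using pb src_obj[OF g(2)] g(6) by blast
qed

lemma pullback_mono:
  assumes pb: "is_pullback C i j p q" and i: "mono_arr C i" and j: "mono_arr C j"
  shows "mono_arr C (i \<cdot> p)"
proof -
  note P = is_pullbackD[OF pb]
  note [simp] = P(1-8)
  have "mono_arr C p"
  proof (rule mono_arrI[OF P(4)])
    fix g assume g: "g \<in> arr C" "tgt C g = src C p" "null_arr (p \<cdot> g)"
    note [simp] = g(1,2)
    have "null_arr (i \<cdot> (p \<cdot> g))" by (rule null_cmp) (use g(3) in simp_all)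
    moreover have e: "i \<cdot> (p \<cdot> g) = j \<cdot> (q \<cdot> g)" by (rule cmp_eq_extend[OF P(9)]) simp_all
    ultimately have "null_arr (j \<cdot> (q \<cdot> g))" by simp
    then have n: "null_arr (q \<cdot> g)" by - (rule mono_null[OF j]; simp)
    \<comment> \<open>Both \<open>g\<close> and the zero morphism solve the same universal problem
      of the fibre product, so they agree.\<close>
    let ?z = "zero_arr C (src C g) (src C p)"
    have z: "null_arr (p \<cdot> ?z)" "null_arr (q \<cdot> ?z)" by (rule null_cmp; simp)+
    have "p \<cdot> ?z = p \<cdot> g" by (rule null_arr_unique[OF z(1) g(3)]) simp_all
    moreover have "q \<cdot> ?z = q \<cdot> g" by (rule null_arr_unique[OF z(2) n]) simp_all
    moreover have "\<exists>!u. u \<in> Hom C (src C (q \<cdot> g)) (src C p) \<and> p \<cdot> u = p \<cdot> g \<and> q \<cdot> u = q \<cdot> g"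
      by (rule P(10)) (use e in simp_all)
    moreover have "g \<in> Hom C (src C (q \<cdot> g)) (src C p)" "?z \<in> Hom C (src C (q \<cdot> g)) (src C p)"
      by (simp_all add: Hom_def)
    ultimately have "g = ?z" by blast
    then show "null_arr g" by (metis g(1) P(4) null_arr_zero src_obj)
  qed
  then show ?thesis by (intro mono_cmp i) simp_all
qed

text \<open>Identifies the morphism used in \<open>subobj_sum\<close> as the copairing of
  \<open>i\<close> and \<open>j\<close>: it restricts to them along the injections.\<close>

lemma biproduct_copair:
  assumes b: "is_biproduct C (src C i) (src C j) s i1 i2 p1 p2"
    and i: "i \<in> arr C" and j: "j \<in> arr C" and t: "tgt C i = tgt C j"
  shows "add_arr C (i \<cdot> p1) (j \<cdot> p2) \<in> Hom C s (tgt C j)"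
    "add_arr C (i \<cdot> p1) (j \<cdot> p2) \<cdot> i1 = i" "add_arr C (i \<cdot> p1) (j \<cdot> p2) \<cdot> i2 = j"
proof -
  have B: "i1 \<in> Hom C (src C i) s" "i2 \<in> Hom C (src C j) s" "p1 \<in> Hom C s (src C i)"
    "p2 \<in> Hom C s (src C j)" "p1 \<cdot> i1 = ident C (src C i)" "p2 \<cdot> i2 = ident C (src C j)"
    "p1 \<cdot> i2 = zero_arr C (src C j) (src C i)" "p2 \<cdot> i1 = zero_arr C (src C i) (src C j)"
    using b unfolding is_biproduct_def by blast+
  note [simp] = HomD[OF B(1)] HomD[OF B(2)] HomD[OF B(3)] HomD[OF B(4)] i j
  have t1 [simp]: "tgt C i = tgt C j" by (rule t)
  have H: "i \<cdot> p1 \<in> Hom C s (tgt C j)" "j \<cdot> p2 \<in> Hom C s (tgt C j)"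
    "i \<in> Hom C (src C i) (tgt C j)" "j \<in> Hom C (src C j) (tgt C j)" by (simp_all add: Hom_def)
  show "add_arr C (i \<cdot> p1) (j \<cdot> p2) \<in> Hom C s (tgt C j)" by (rule add_arr_Hom[OF H(1,2)])
  have n: "null_arr (j \<cdot> (p2 \<cdot> i1))" "null_arr (i \<cdot> (p1 \<cdot> i2))"
    unfolding B(7,8) by (rule null_cmp; simp)+
  have z: "j \<cdot> (p2 \<cdot> i1) = zero_arr C (src C i) (tgt C j)"
    "i \<cdot> (p1 \<cdot> i2) = zero_arr C (src C j) (tgt C j)"
    by (rule null_arr_eq[OF n(1)]; simp) (rule null_arr_eq[OF n(2)]; simp)
  have "add_arr C (i \<cdot> p1) (j \<cdot> p2) \<cdot> i1 = add_arr C (i \<cdot> (p1 \<cdot> i1)) (j \<cdot> (p2 \<cdot> i1))"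
    using cmp_add_left[OF B(1) H(1,2)] by simp
  also have "\<dots> = add_arr C i (zero_arr C (src C i) (tgt C j))"
    unfolding B(5) z by simp
  also have "\<dots> = i" by (rule add_arr_group(2)[OF H(3) H(3) H(3)])
  finally show "add_arr C (i \<cdot> p1) (j \<cdot> p2) \<cdot> i1 = i" .
  have "add_arr C (i \<cdot> p1) (j \<cdot> p2) \<cdot> i2 = add_arr C (i \<cdot> (p1 \<cdot> i2)) (j \<cdot> (p2 \<cdot> i2))"
    using cmp_add_left[OF B(2) H(1,2)] by simp
  also have "\<dots> = add_arr C (zero_arr C (src C j) (tgt C j)) j"
    unfolding B(6) z by simp
  also have "\<dots> = j" by (rule add_arr_group(1)[OF H(4) H(4) H(4)])
  finally show "add_arr C (i \<cdot> p1) (j \<cdot> p2) \<cdot> i2 = j" .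
qed

end

section \<open>The endomorphism ring of the unit and the subobjects given by its idempotents\<close>

context rigid_abelian_tensor_category
begin

abbreviation unit_ring :: "'b ring" where
  "unit_ring \<equiv> End_ring C (tunit C)"

lemma unit_ring_cring: "cring unit_ring"
proof (rule cringI)
  show "abelian_group unit_ring"
  proof (rule abelian_groupI)
    fix x assume x: "x \<in> carrier unit_ring"
    then have "x \<in> Hom C (tunit C) (tunit C)" by (simp add: End_ring_def)
    from add_arr_group(5)[OF this this this]
    obtain y where "y \<in> Hom C (tunit C) (tunit C)" "add_arr C x y = zero_arr C (tunit C) (tunit C)"
      by blast
    then show "\<exists>y\<in>carrier unit_ring. y \<oplus>\<^bsub>unit_ring\<^esub> x = \<zero>\<^bsub>unit_ring\<^esub>"
      using x add_arr_group(3)[of x "tunit C" "tunit C" y] by (auto simp: End_ring_def)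
  qed (simp_all add: End_ring_def add_arr_Hom add_arr_group(1,4) Hom_def, rule add_arr_group(3),
      simp_all add: Hom_def)
  show "comm_monoid unit_ring"
    by (rule comm_monoidI)
      (simp_all add: End_ring_def Hom_def, rule endomorphisms_tunit_commute, simp_all add: Hom_def)
  show "(x \<oplus>\<^bsub>unit_ring\<^esub> y) \<otimes>\<^bsub>unit_ring\<^esub> z
      = x \<otimes>\<^bsub>unit_ring\<^esub> z \<oplus>\<^bsub>unit_ring\<^esub> y \<otimes>\<^bsub>unit_ring\<^esub> z"
    if "x \<in> carrier unit_ring" "y \<in> carrier unit_ring" "z \<in> carrier unit_ring" for x y z
    using that by (simp add: End_ring_def cmp_add_left)
qed

text \<open>A retraction \<open>r\<close> of \<open>w\<close> gives the complementary idempotent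
  \<open>1 - w \<cdot> r\<close>. It kills \<open>w\<close>, so it factors as
  \<open>s \<cdot> q\<close>, and \<open>s\<close> is the section.\<close>

lemma cokernel_of_mono_tunit_splits:
  assumes w: "mono_arr C w" "tgt C w = tunit C" and q: "is_cokernel C q w"
  obtains s where "s \<in> Hom C (tgt C q) (tunit C)" "q \<cdot> s = ident C (tgt C q)"
proof -
  note Q = is_cokernelD[OF q]
  note [simp] = Q(1-3) w(2)
  obtain r where r: "r \<in> Hom C (tunit C) (src C w)" "r \<cdot> w = ident C (src C w)"
    using mono_tunit_splits[OF w] by blast
  note [simp] = HomD[OF r(1)]
  let ?u = "tunit C"
  have e: "w \<cdot> r \<in> Hom C ?u ?u" by (simp add: Hom_def)
  obtain e' where e': "e' \<in> Hom C ?u ?u" "add_arr C (w \<cdot> r) e' = zero_arr C ?u ?u"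
    using add_arr_group(5)[OF e e e] by blast
  note [simp] = HomD[OF e'(1)]
  \<comment> \<open>\<open>e'\<close> is the opposite of \<open>w \<cdot> r\<close>, so
    \<open>d\<close> is the complementary idempotent.\<close>
  define d where "d = add_arr C (ident C ?u) e'"
  have d: "d \<in> Hom C ?u ?u"
    unfolding d_def by (rule add_arr_Hom[OF ident_Hom e'(1)]) simp
  note [simp] = HomD[OF d]
  have wrw: "w \<cdot> r \<cdot> w = w" using r(2) by simp
  have wH: "w \<in> Hom C (src C w) ?u" by (simp add: Hom_def)
  have dw: "d \<cdot> w = add_arr C (w \<cdot> r \<cdot> w) (e' \<cdot> w)"
    unfolding d_def wrw using cmp_add_left[OF wH ident_Hom e'(1)] by simp
  also have "\<dots> = add_arr C (w \<cdot> r) e' \<cdot> w"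
    by (rule cmp_add_left[OF wH e e'(1), symmetric])
  finally have dw: "null_arr (d \<cdot> w)"
    unfolding e'(2) by (simp add: null_cmp)
  then obtain s where s: "s \<in> arr C" "src C s = tgt C q" "tgt C s = ?u" "d = s \<cdot> q"
    using Q(6)[of d] by auto
  have qH: "q \<in> Hom C ?u (tgt C q)" by (simp add: Hom_def)
  have n: "null_arr (q \<cdot> (w \<cdot> r))"
    using null_cmp[of r "q \<cdot> w"] Q(4) by simp
  have "add_arr C (q \<cdot> (w \<cdot> r)) (q \<cdot> e') = q \<cdot> zero_arr C ?u ?u"
    unfolding e'(2)[symmetric] by (rule cmp_add_right[OF e e'(1) qH, symmetric])
  moreover have "null_arr (q \<cdot> zero_arr C ?u ?u)" by (rule null_cmp) simp_all
  moreover have "add_arr C (q \<cdot> (w \<cdot> r)) (q \<cdot> e') = q \<cdot> e'"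
    unfolding null_arr_eq[OF n, of ?u "tgt C q", simplified]
    by (rule add_arr_group(1)[OF cmp_Hom[OF e'(1) qH] cmp_Hom[OF e'(1) qH] cmp_Hom[OF e'(1) qH]])
  ultimately have ne: "null_arr (q \<cdot> e')" by simp
  have "q \<cdot> d = add_arr C (q \<cdot> ident C ?u) (q \<cdot> e')"
    unfolding d_def by (rule cmp_add_right[OF ident_Hom e'(1) qH]) simp
  also have "\<dots> = q"
    unfolding null_arr_eq[OF ne, of ?u "tgt C q", simplified]
    using add_arr_group(2)[OF qH qH qH] by simp
  finally have "q \<cdot> d = q" .
  then have "(q \<cdot> s) \<cdot> q = ident C (tgt C q) \<cdot> q" unfolding s(4) using s(1-3) by simp
  then have "q \<cdot> s = ident C (tgt C q)"
    using s(1-3) by - (rule epi_arrD[OF Q(5)]; simp)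
  then show thesis using s(1-3) that by (simp add: Hom_def)
qed

text \<open>In \<open>x = i \<cdot> q\<close> the image inclusion \<open>i\<close> has a retraction
  \<open>r\<close>, and the quotient \<open>q\<close> by the kernel has a section \<open>s\<close>.
  Then \<open>s \<cdot> r\<close> is a quasi-inverse of \<open>x\<close>.\<close>

lemma unit_ring_absolutely_flat: "absolutely_flat unit_ring"
  unfolding absolutely_flat_def
proof (intro conjI unit_ring_cring ballI)
  fix x assume "x \<in> carrier unit_ring"
  then have x [simp]: "x \<in> arr C" "src C x = tunit C" "tgt C x = tunit C"
    by (simp_all add: End_ring_def Hom_def)
  obtain w q i where w: "is_kernel C w x" and q: "is_cokernel C q w" and i: "mono_arr C i"
    "src C i = tgt C q" "tgt C i = tgt C x" "src C q = src C x" "x = i \<cdot> q"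
    using image_factorization[OF x(1)] by metis
  note W = is_kernelD[OF w] and Q = is_cokernelD[OF q]
  have ia [simp]: "i \<in> arr C" using i(1) by (rule mono_arr)
  note [simp] = W(1-3) Q(1,2) i(2,3,4)
  obtain r where r: "r \<in> Hom C (tunit C) (src C i)" "r \<cdot> i = ident C (src C i)"
    using mono_tunit_splits[OF i(1)] by auto
  obtain s where s: "s \<in> Hom C (tgt C q) (tunit C)" "q \<cdot> s = ident C (tgt C q)"
    using cokernel_of_mono_tunit_splits[OF W(5) _ q] by auto
  note [simp] = HomD[OF r(1)] HomD[OF s(1)]
  have "s \<cdot> r \<in> carrier unit_ring" by (simp add: End_ring_def Hom_def)
  moreover have "i \<cdot> q \<cdot> (s \<cdot> r) \<cdot> (i \<cdot> q) = i \<cdot> q"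
  proof -
    have "i \<cdot> q \<cdot> (s \<cdot> r) \<cdot> (i \<cdot> q) = i \<cdot> (q \<cdot> (s \<cdot> (r \<cdot> (i \<cdot> q))))" by simp
    also have "r \<cdot> (i \<cdot> q) = q" using cmp_eq_extend'[OF r(2), of q] by simp
    also have "q \<cdot> (s \<cdot> q) = q" using cmp_eq_extend'[OF s(2), of q] by simp
    finally show ?thesis .
  qed
  ultimately show "\<exists>y\<in>carrier unit_ring. x \<otimes>\<^bsub>unit_ring\<^esub> y \<otimes>\<^bsub>unit_ring\<^esub> x = x"
    unfolding i(5) by (intro bexI[of _ "s \<cdot> r"]) (simp_all add: End_ring_def)
qed

lemma unit_idempotents: "e \<in> idempotents unit_ring \<longleftrightarrow> e \<in> Hom C (tunit C) (tunit C) \<and> e \<cdot> e = e"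
  by (simp add: idempotents_def End_ring_def)

text \<open>The splitting of subobjects enters the correspondence here: a retraction
  \<open>r\<close> of \<open>i\<close> yields the idempotent \<open>i \<cdot> r\<close>.\<close>

lemma mono_tunit_split_monos:
  assumes i: "i \<in> monos_into C (tunit C)"
  obtains e where "e \<in> idempotents unit_ring" "i \<in> split_monos e"
proof -
  have m: "mono_arr C i" "tgt C i = tunit C" using i by (simp_all add: monos_into_def)
  note [simp] = m(2) mono_arr[OF m(1)]
  obtain r where r: "r \<in> Hom C (tunit C) (src C i)" "r \<cdot> i = ident C (src C i)"
    using mono_tunit_splits[OF m] by blast
  note [simp] = HomD[OF r(1)]
  have "r \<cdot> (i \<cdot> r) = r" using cmp_eq_extend'[OF r(2), of r] by simp
  then have "i \<cdot> r \<in> idempotents unit_ring" by (simp add: unit_idempotents Hom_def)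
  moreover have "i \<in> split_monos (i \<cdot> r)" unfolding split_monos_def using r by auto
  ultimately show thesis using that by blast
qed

lemma split_monos_into:
  assumes "e \<in> idempotents unit_ring" "i \<in> split_monos e"
  shows "i \<in> monos_into C (tunit C)" "tgt C i = tunit C"
  using split_monos_mono[OF assms(2)] split_monos_Hom[OF assms(2)] assms(1)
  by (auto simp: monos_into_def unit_idempotents Hom_def)

text \<open>Idempotents split in an abelian category: for the image factorisation
  \<open>e = i \<cdot> q\<close>, cancelling the monomorphism and the epimorphism in
  \<open>e \<cdot> e = e\<close> leaves \<open>q \<cdot> i = 1\<close>.\<close>

lemma split_monos_nonempty:
  assumes e: "e \<in> idempotents unit_ring"
  shows "split_monos e \<noteq> {}"
proof -
  have x [simp]: "e \<in> arr C" "src C e = tunit C" "tgt C e = tunit C" and ee: "e \<cdot> e = e"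
    using e by (simp_all add: unit_idempotents Hom_def)
  obtain w q i where q: "is_cokernel C q w" and i: "mono_arr C i"
    "src C i = tgt C q" "tgt C i = tgt C e" "src C q = src C e" "e = i \<cdot> q"
    using image_factorization[OF x(1)] by metis
  note Q = is_cokernelD[OF q]
  have ia [simp]: "i \<in> arr C" using i(1) by (rule mono_arr)
  note [simp] = Q(2) i(2,3,4)
  have "i \<cdot> (q \<cdot> (i \<cdot> q)) = i \<cdot> q" using ee unfolding i(5) by simp
  then have "q \<cdot> (i \<cdot> q) = q" by - (rule mono_arrD[OF i(1)]; simp)
  then have "(q \<cdot> i) \<cdot> q = ident C (tgt C q) \<cdot> q" by simp
  then have "q \<cdot> i = ident C (tgt C q)" by - (rule epi_arrD[OF Q(5)]; simp)
  then have "i \<in> split_monos e"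
    unfolding split_monos_def
    by (intro CollectI conjI bexI[of _ q] ia i(5)[symmetric]) (simp_all add: Hom_def)
  then show ?thesis by blast
qed

lemma idempotents_antisym:
  assumes "e \<in> idempotents unit_ring" "f \<in> idempotents unit_ring" "f \<cdot> e = e" "e \<cdot> f = f"
  shows "e = f"
  using assms endomorphisms_tunit_commute[of e f] by (auto simp: unit_idempotents)

lemma split_monos_unique:
  assumes e: "e \<in> idempotents unit_ring" and f: "f \<in> idempotents unit_ring"
    and i: "i \<in> split_monos e" "i \<in> split_monos f"
  shows "e = f"
proof (rule idempotents_antisym[OF e f])
  have "factors_through C i i"
    unfolding factors_through_def using split_monos_Hom[OF i(1)] ident_Hom[of "src C i"]
    by (intro bexI[of _ "ident C (src C i)"]) simp_all
  then show "f \<cdot> e = e" "e \<cdot> f = f"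
    using split_monos_factors_through[OF i refl] split_monos_factors_through[OF i(2,1) refl] by auto
qed

lemma split_monos_eqI:
  assumes "e \<in> idempotents unit_ring" "i \<in> split_monos e" "j \<in> split_monos e"
  shows "factors_through C i j"
  using assms split_monos_factors_through[OF assms(2,3)] split_monos_into(2) unit_idempotents by simp

text \<open>A monomorphism \<open>j\<close> equivalent to \<open>i\<close> has an idempotent of its
  own; mutual factorisation and antisymmetry force it to be \<open>e\<close>.\<close>

lemma subobj_class_split_monos:
  assumes e: "e \<in> idempotents unit_ring" and i: "i \<in> split_monos e"
  shows "subobj_rel C (tunit C) `` {i} = split_monos e"
proof (rule subset_antisym; rule subsetI)
  note I = split_monos_into[OF e i]
  fix j assume "j \<in> subobj_rel C (tunit C) `` {i}"
  then have j: "j \<in> monos_into C (tunit C)" "factors_through C i j" "factors_through C j i"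
    by (auto simp: subobj_rel_def)
  obtain f where f: "f \<in> idempotents unit_ring" "j \<in> split_monos f"
    using mono_tunit_split_monos[OF j(1)] by blast
  have t: "tgt C i = tgt C j" using I(2) split_monos_into(2)[OF f] by simp
  have "e = f"
    using idempotents_antisym[OF e f(1)] split_monos_factors_through[OF i f(2) t]
      split_monos_factors_through[OF f(2) i t[symmetric]] j(2,3) by blast
  then show "j \<in> split_monos e" using f(2) by simp
next
  fix j assume j: "j \<in> split_monos e"
  then show "j \<in> subobj_rel C (tunit C) `` {i}"
    using split_monos_eqI[OF e i j] split_monos_eqI[OF e j i] split_monos_into[OF e] i
    by (auto simp: subobj_rel_def)
qed

lemma bij_split_monos: "bij_betw split_monos (idempotents unit_ring) (subobjects C (tunit C))"
  unfolding bij_betw_def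
proof (intro conjI inj_onI subset_antisym subsetI)
  fix e f assume "e \<in> idempotents unit_ring" "f \<in> idempotents unit_ring" "split_monos e = split_monos f"
  then show "e = f" using split_monos_nonempty[of e] split_monos_unique[of e f] by blast
next
  fix X assume "X \<in> split_monos ` idempotents unit_ring"
  then obtain e i where e: "e \<in> idempotents unit_ring" "X = split_monos e" "i \<in> split_monos e"
    using split_monos_nonempty by blast
  then show "X \<in> subobjects C (tunit C)"
    using subobj_class_split_monos[OF e(1,3)] split_monos_into(1)[OF e(1,3)]
    unfolding subobjects_def quotient_def by blast
next
  fix X assume "X \<in> subobjects C (tunit C)"
  then obtain i where i: "i \<in> monos_into C (tunit C)" "X = subobj_rel C (tunit C) `` {i}"
    unfolding subobjects_def quotient_def by blast
  then obtain e where "e \<in> idempotents unit_ring" "i \<in> split_monos e"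
    using mono_tunit_split_monos by blast
  then show "X \<in> split_monos ` idempotents unit_ring"
    using subobj_class_split_monos i(2) by blast
qed

lemma subobj_le_split_monos:
  assumes e: "e \<in> idempotents unit_ring" and f: "f \<in> idempotents unit_ring"
  shows "subobj_le C (split_monos e) (split_monos f) \<longleftrightarrow> f \<cdot> e = e"
proof -
  have "factors_through C i j \<longleftrightarrow> f \<cdot> e = e" if "i \<in> split_monos e" "j \<in> split_monos f" for i j
    using split_monos_factors_through that split_monos_into(2)[OF e that(1)]
      split_monos_into(2)[OF f that(2)] by simp
  then show ?thesis
    unfolding subobj_le_def using split_monos_nonempty[OF e] split_monos_nonempty[OF f] by blast
qed

end

section \<open>Intersections and sums of subobjects in terms of idempotents\<close>

context rigid_abelian_tensor_category
begin

lemma unit_idempotentsD: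
  assumes "e \<in> idempotents unit_ring"
  shows "e \<in> arr C" "src C e = tunit C" "tgt C e = tunit C" "e \<cdot> e = e"
  using assms by (simp_all add: unit_idempotents Hom_def)

lemma idempotent_cmp:
  assumes "e \<in> idempotents unit_ring" "f \<in> idempotents unit_ring"
  shows "e \<cdot> f \<in> idempotents unit_ring" "e \<cdot> (e \<cdot> f) = e \<cdot> f" "f \<cdot> (e \<cdot> f) = e \<cdot> f"
proof -
  interpret Z: cring unit_ring by (rule unit_ring_cring)
  note [simp] = unit_idempotentsD[OF assms(1)] unit_idempotentsD[OF assms(2)]
  show "e \<cdot> f \<in> idempotents unit_ring" using Z.idempotent_mult[OF assms] by (simp add: End_ring_def)
  show "e \<cdot> (e \<cdot> f) = e \<cdot> f" by (rule cmp_eq_extend') simp_all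
  have "f \<cdot> (f \<cdot> e) = f \<cdot> e" by (rule cmp_eq_extend') simp_all
  moreover have "f \<cdot> e = e \<cdot> f" by (rule endomorphisms_tunit_commute) (simp_all add: Hom_def)
  ultimately show "f \<cdot> (e \<cdot> f) = e \<cdot> f" by simp
qed

text \<open>The product of commuting idempotents is their meet. A fibre product has an idempotent
  \<open>g\<close> below \<open>e\<close> and \<open>f\<close>, and its universal property puts
  \<open>e \<cdot> f\<close> below \<open>g\<close>. Conversely every monomorphism splitting
  \<open>e \<cdot> f\<close> is shown to be a fibre product.\<close>

lemma subobj_Int_split_monos:
  assumes e: "e \<in> idempotents unit_ring" and f: "f \<in> idempotents unit_ring"
  shows "subobj_Int C (split_monos e) (split_monos f) = split_monos (e \<cdot> f)"
proof (rule subset_antisym; rule subsetI)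
  note ef = idempotent_cmp[OF e f]
  note [simp] = unit_idempotentsD(1-3)[OF e] unit_idempotentsD(1-3)[OF f]
  fix k assume "k \<in> subobj_Int C (split_monos e) (split_monos f)"
  then obtain i j p q where i: "i \<in> split_monos e" and j: "j \<in> split_monos f"
    and pb: "is_pullback C i j p q" and k: "k = i \<cdot> p"
    unfolding subobj_Int_def by blast
  note P = is_pullbackD[OF pb]
  note [simp] = P(1-8) split_monos_into(2)[OF e i] split_monos_into(2)[OF f j]
  have k': "k \<in> arr C" "src C k = src C p" "tgt C k = tunit C" unfolding k by simp_all
  have "mono_arr C k" unfolding k by (rule pullback_mono[OF pb split_monos_mono[OF i] split_monos_mono[OF j]])
  then obtain g where g: "g \<in> idempotents unit_ring" "k \<in> split_monos g"
    using mono_tunit_split_monos[of k] k'(3) by (auto simp: monos_into_def)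
  note [simp] = unit_idempotentsD(1-3)[OF g(1)]
  have "p \<in> Hom C (src C k) (src C i)" "q \<in> Hom C (src C k) (src C j)"
    by (simp_all add: k'(2) Hom_def)
  moreover have "k = j \<cdot> q" unfolding k by (rule P(9))
  ultimately have "factors_through C k i" "factors_through C k j"
    unfolding factors_through_def using k by blast+
  then have 1: "e \<cdot> g = g" "f \<cdot> g = g"
    using split_monos_factors_through[OF g(2) i] split_monos_factors_through[OF g(2) j] k'(3) by simp_all
  \<comment> \<open>A representative of \<open>e \<cdot> f\<close> factors through \<open>i\<close>
    and \<open>j\<close>, hence through their fibre product; this is the inequality opposite to
    1.\<close>
  obtain l where l: "l \<in> split_monos (e \<cdot> f)" using split_monos_nonempty[OF ef(1)] by blast
  note L = split_monos_into(2)[OF ef(1) l] split_monos_Hom(1)[OF l]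
  have "factors_through C l i" "factors_through C l j"
    using split_monos_factors_through[OF l i] split_monos_factors_through[OF l j] ef(2,3) L by simp_all
  then obtain a b where ab: "a \<in> Hom C (src C l) (src C i)" "l = i \<cdot> a"
    "b \<in> Hom C (src C l) (src C j)" "l = j \<cdot> b"
    unfolding factors_through_def by blast
  have "\<exists>!u. u \<in> Hom C (src C b) (src C p) \<and> p \<cdot> u = a \<and> q \<cdot> u = b"
    by (rule P(10)) (use HomD[OF ab(1)] HomD[OF ab(3)] ab(2,4) in simp_all)
  then obtain u where u: "u \<in> arr C" "src C u = src C l" "tgt C u = src C p" "p \<cdot> u = a"
    using HomD(2)[OF ab(3)] by (auto simp: Hom_def)
  have "l = k \<cdot> u" unfolding ab(2) k using u by simp
  then have "factors_through C l k" unfolding factors_through_def using u(1-3) k'(2) by (auto simp: Hom_def)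
  then have 2: "g \<cdot> (e \<cdot> f) = e \<cdot> f" using split_monos_factors_through[OF l g(2)] L k'(3) by simp
  have "e \<cdot> f \<cdot> g = g" using 1 by simp
  then have "e \<cdot> f = g" by (rule idempotents_antisym[OF ef(1) g(1) 2])
  then show "k \<in> split_monos (e \<cdot> f)" using g(2) by simp
next
  note ef = idempotent_cmp[OF e f]
  note [simp] = unit_idempotentsD(1-3)[OF e] unit_idempotentsD(1-3)[OF f]
  fix k assume k: "k \<in> split_monos (e \<cdot> f)"
  note K [simp] = split_monos_into(2)[OF ef(1) k] split_monos_Hom(1)[OF k]
  obtain i j where i: "i \<in> split_monos e" and j: "j \<in> split_monos f"
    using split_monos_nonempty[OF e] split_monos_nonempty[OF f] by blast
  note [simp] = split_monos_into(2)[OF e i] split_monos_into(2)[OF f j]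
    split_monos_Hom(1)[OF i] split_monos_Hom(1)[OF j]
  have "factors_through C k i" "factors_through C k j"
    using split_monos_factors_through[OF k i] split_monos_factors_through[OF k j] ef(2,3) by simp_all
  then obtain p q where pq: "p \<in> Hom C (src C k) (src C i)" "k = i \<cdot> p"
    "q \<in> Hom C (src C k) (src C j)" "k = j \<cdot> q"
    unfolding factors_through_def by blast
  note [simp] = HomD[OF pq(1)] HomD[OF pq(3)]
  have "is_pullback C i j p q"
    unfolding is_pullback_def
  proof (intro conjI ballI impI)
    show "i \<cdot> p = j \<cdot> q" using pq(2,4) by simp
    fix x g h assume x: "x \<in> obj C" "g \<in> Hom C x (src C i)" "h \<in> Hom C x (src C j)" "i \<cdot> g = j \<cdot> h"
    note [simp] = HomD[OF x(2)] HomD[OF x(3)]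
    have 1: "e \<cdot> (i \<cdot> g) = i \<cdot> g" by (rule cmp_eq_extend'[OF split_monos_absorb[OF i]]) simp_all
    have 2: "f \<cdot> (j \<cdot> h) = j \<cdot> h" by (rule cmp_eq_extend'[OF split_monos_absorb[OF j]]) simp_all
    \<comment> \<open>The common composite \<open>i \<cdot> g = j \<cdot> h\<close> is fixed by
      \<open>e\<close> and by \<open>f\<close>, hence by \<open>e \<cdot> f\<close>, and so factors
      through \<open>k\<close>.\<close>
    have "e \<cdot> f \<cdot> (i \<cdot> g) = e \<cdot> (f \<cdot> (i \<cdot> g))" by simp
    also have "\<dots> = i \<cdot> g" unfolding x(4) 2 unfolding x(4)[symmetric] 1 ..
    finally have "\<exists>u\<in>Hom C x (src C k). i \<cdot> g = k \<cdot> u"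
      using split_monos_factor[OF k, of "i \<cdot> g"] by simp
    then obtain u where u: "u \<in> Hom C x (src C k)" "i \<cdot> g = k \<cdot> u" ..
    note [simp] = HomD[OF u(1)]
    have "i \<cdot> (p \<cdot> u) = i \<cdot> g" unfolding u(2) by (rule cmp_eq_extend'[OF pq(2)[symmetric]]) simp_all
    then have pu: "p \<cdot> u = g" by - (rule mono_arrD[OF split_monos_mono[OF i]]; simp)
    have "j \<cdot> (q \<cdot> u) = k \<cdot> u" by (rule cmp_eq_extend'[OF pq(4)[symmetric]]) simp_all
    then have "j \<cdot> (q \<cdot> u) = j \<cdot> h" unfolding u(2)[symmetric] x(4) .
    then have qu: "q \<cdot> u = h" by - (rule mono_arrD[OF split_monos_mono[OF j]]; simp)
    show "\<exists>!u. u \<in> Hom C x (src C p) \<and> p \<cdot> u = g \<and> q \<cdot> u = h"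
    proof (rule ex1I[of _ u])
      show "u \<in> Hom C x (src C p) \<and> p \<cdot> u = g \<and> q \<cdot> u = h" using pu qu by (simp add: Hom_def)
      fix v assume v: "v \<in> Hom C x (src C p) \<and> p \<cdot> v = g \<and> q \<cdot> v = h"
      then have [simp]: "v \<in> arr C" "src C v = x" "tgt C v = src C k" by (simp_all add: Hom_def)
      have "k \<cdot> v = i \<cdot> (p \<cdot> v)"
        by (rule cmp_eq_extend'[OF pq(2)[symmetric], symmetric]) simp_all
      also have "\<dots> = k \<cdot> u" unfolding u(2)[symmetric] using v by simp
      finally have kv: "k \<cdot> v = k \<cdot> u" .
      show "v = u" by (rule mono_arrD[OF split_monos_mono[OF k] _ _ _ _ _ kv]) simp_all
    qed
  qed (simp_all add: Hom_def)
  then show "k \<in> subobj_Int C (split_monos e) (split_monos f)"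
    unfolding subobj_Int_def using i j pq(2) by blast
qed

text \<open>The assumptions on \<open>g\<close> say that it is the join of \<open>e\<close> and \<open>f\<close> among the idempotents.\<close>

lemma image_split_mono:
  assumes e: "e \<in> idempotents unit_ring" and f: "f \<in> idempotents unit_ring"
    and g: "g \<in> idempotents unit_ring" "g \<cdot> e = e" "g \<cdot> f = f"
      "\<And>h. \<lbrakk>h \<in> idempotents unit_ring; h \<cdot> e = e; h \<cdot> f = f\<rbrakk> \<Longrightarrow> h \<cdot> g = g"
    and i: "i \<in> split_monos e" and j: "j \<in> split_monos f"
    and b: "is_biproduct C (src C i) (src C j) s i1 i2 p1 p2"
    and c: "is_cokernel C c (add_arr C (i \<cdot> p1) (j \<cdot> p2))" and k: "is_kernel C k c"
  shows "k \<in> split_monos g"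
proof -
  note [simp] = split_monos_into(2)[OF e i] split_monos_into(2)[OF f j]
    split_monos_Hom(1)[OF i] split_monos_Hom(1)[OF j] unit_idempotentsD(1-3)[OF e]
    unit_idempotentsD(1-3)[OF f] unit_idempotentsD(1-3)[OF g(1)]
  define m where "m = add_arr C (i \<cdot> p1) (j \<cdot> p2)"
  have B: "i1 \<in> Hom C (src C i) s" "i2 \<in> Hom C (src C j) s" "p1 \<in> Hom C s (src C i)"
    "p2 \<in> Hom C s (src C j)"
    using b unfolding is_biproduct_def by blast+
  have M: "m \<in> Hom C s (tunit C)" "m \<cdot> i1 = i" "m \<cdot> i2 = j"
    using biproduct_copair[OF b] unfolding m_def by simp_all
  note C = is_cokernelD[OF c[folded m_def]] and K = is_kernelD[OF k]
  note [simp] = HomD[OF B(1)] HomD[OF B(2)] HomD[OF B(3)] HomD[OF B(4)] HomD[OF M(1)] C(1-3) K(1-3)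
  obtain g' where g': "g' \<in> idempotents unit_ring" "k \<in> split_monos g'"
    using mono_tunit_split_monos[of k] K(5) by (auto simp: monos_into_def)
  note [simp] = unit_idempotentsD(1-3)[OF g'(1)]
  \<comment> \<open>\<open>c\<close> kills the copairing and hence \<open>i\<close> and
    \<open>j\<close>, so the idempotent \<open>g'\<close> of the image is an upper bound of
    \<open>e\<close> and \<open>f\<close>.\<close>
  have "null_arr ((c \<cdot> m) \<cdot> i1)" "null_arr ((c \<cdot> m) \<cdot> i2)" by (rule null_cmp; use C(4) in simp)+
  then have "null_arr (c \<cdot> i)" "null_arr (c \<cdot> j)" using M(2,3) by simp_all
  then have "factors_through C i k" "factors_through C j k"
    using K(6)[of i] K(6)[of j] by (auto simp: factors_through_def Hom_def)
  then have up: "g' \<cdot> e = e" "g' \<cdot> f = f"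
    using split_monos_factors_through[OF i g'(2)] split_monos_factors_through[OF j g'(2)] by simp_all
  obtain l where l: "l \<in> split_monos g" using split_monos_nonempty[OF g(1)] by blast
  note [simp] = split_monos_into(2)[OF g(1) l] split_monos_Hom(1)[OF l]
  \<comment> \<open>For the other inequality: the copairing factors through \<open>l\<close>, so the
    cokernel \<open>d\<close> of \<open>l\<close> factors through \<open>c\<close> and kills
    \<open>k\<close>. As \<open>l\<close> is the kernel of \<open>d\<close>, the image factors
    through \<open>l\<close>.\<close>
  obtain d where d: "is_cokernel C d l" using cokernels[of l] by auto
  note D = is_cokernelD[OF d] and KD = is_kernelD[OF mono_kernel_cokernel[OF split_monos_mono[OF l] d]]
  note [simp] = D(1-3)
  have gi: "g \<cdot> i = i" "g \<cdot> j = j"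
    using cmp_eq_extend'[OF g(2), of i] cmp_eq_extend'[OF g(3), of j]
      split_monos_absorb[OF i] split_monos_absorb[OF j] by simp_all
  have gm: "g \<cdot> m = m"
  proof -
    have 1: "g \<cdot> (i \<cdot> p1) = i \<cdot> p1" by (rule cmp_eq_extend'[OF gi(1)]) simp_all
    have 2: "g \<cdot> (j \<cdot> p2) = j \<cdot> p2" by (rule cmp_eq_extend'[OF gi(2)]) simp_all
    have "g \<cdot> m = add_arr C (g \<cdot> (i \<cdot> p1)) (g \<cdot> (j \<cdot> p2))"
      unfolding m_def by (rule cmp_add_right[of _ s "tunit C" _ _ "tunit C"]) (simp_all add: Hom_def)
    then show ?thesis unfolding 1 2 m_def .
  qed
  then obtain v where v: "v \<in> Hom C s (src C l)" "m = l \<cdot> v"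
    using split_monos_factor[OF l, of m] by auto
  note [simp] = HomD[OF v(1)]
  have "null_arr ((d \<cdot> l) \<cdot> v)" by (rule null_cmp) (use D(4) in simp_all)
  then have "null_arr (d \<cdot> m)" unfolding v(2) by simp
  then obtain d' where d': "d' \<in> arr C" "src C d' = tgt C c" "tgt C d' = tgt C d" "d = d' \<cdot> c"
    using C(6)[of d] by auto
  have "null_arr (d' \<cdot> (c \<cdot> k))" by (rule null_cmp) (use K(4) d' in simp_all)
  then have "null_arr (d \<cdot> k)" unfolding d'(4) using d'(1-3) by simp
  then have "factors_through C k l" using KD(6)[of k] by (auto simp: factors_through_def Hom_def)
  then have "g \<cdot> g' = g'" using split_monos_factors_through[OF g'(2) l] by simp
  then have "g' = g" using idempotents_antisym[OF g'(1) g(1)] g(4)[OF g'(1) up] by blast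
  then show ?thesis using g'(2) by simp
qed

text \<open>Specifying \<open>g\<close> by its universal property allows it to be supplied by the
  union of clopen sets, with no formula for the join of two idempotents.\<close>

lemma subobj_sum_split_monos:
  assumes e: "e \<in> idempotents unit_ring" and f: "f \<in> idempotents unit_ring"
    and g: "g \<in> idempotents unit_ring" "g \<cdot> e = e" "g \<cdot> f = f"
      "\<And>h. \<lbrakk>h \<in> idempotents unit_ring; h \<cdot> e = e; h \<cdot> f = f\<rbrakk> \<Longrightarrow> h \<cdot> g = g"
  shows "subobj_sum C (split_monos e) (split_monos f) = split_monos g"
proof (rule subset_antisym; rule subsetI)
  fix k assume "k \<in> subobj_sum C (split_monos e) (split_monos f)"
  then show "k \<in> split_monos g"
    unfolding subobj_sum_def is_image_def using image_split_mono[OF e f g] by blast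
next
  fix k assume k: "k \<in> split_monos g"
  obtain i j where i: "i \<in> split_monos e" and j: "j \<in> split_monos f"
    using split_monos_nonempty[OF e] split_monos_nonempty[OF f] by blast
  note [simp] = split_monos_into(2)[OF e i] split_monos_into(2)[OF f j]
    split_monos_Hom(1)[OF i] split_monos_Hom(1)[OF j]
  obtain s i1 i2 p1 p2 where b: "is_biproduct C (src C i) (src C j) s i1 i2 p1 p2"
    using biproducts[of "src C i" "src C j"] by auto
  have "add_arr C (i \<cdot> p1) (j \<cdot> p2) \<in> arr C" using HomD(1)[OF biproduct_copair(1)[OF b]] by simp
  then obtain c where c: "is_cokernel C c (add_arr C (i \<cdot> p1) (j \<cdot> p2))" using cokernels by blast
  obtain l where l: "is_kernel C l c" using kernels[OF is_cokernelD(2)[OF c]] by blast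
  have lg: "l \<in> split_monos g" by (rule image_split_mono[OF e f g i j b c l])
  obtain h where h: "h \<in> Hom C (src C l) (src C k)" "l = k \<cdot> h"
    using split_monos_eqI[OF g(1) lg k] unfolding factors_through_def by blast
  obtain h' where h': "h' \<in> Hom C (src C k) (src C l)" "k = l \<cdot> h'"
    using split_monos_eqI[OF g(1) k lg] unfolding factors_through_def by blast
  \<comment> \<open>The image \<open>l\<close> just built and the given \<open>k\<close> split the
    same idempotent, so they are isomorphic over the unit and \<open>k\<close> is a kernel of the
    same \<open>c\<close>.\<close>
  have "is_kernel C k c"
    by (rule is_kernel_iso[OF l split_monos_Hom(1)[OF k] h h' split_monos_mono[OF k]])
  then show "k \<in> subobj_sum C (split_monos e) (split_monos f)"
    unfolding subobj_sum_def is_image_def using i j b c by blast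
qed

text \<open>The inverse of \<open>basic_open\<close> followed by \<open>split_monos\<close>. Both
  bijections carry the order \<open>f \<cdot> e = e\<close> of idempotents to inclusion, so meets
  and joins follow.\<close>

lemma clopens_subobjects_correspondence:
  "\<exists>\<Phi>. bij_betw \<Phi> (clopens (zariski unit_ring)) (subobjects C (tunit C)) \<and>
    (\<forall>S\<in>clopens (zariski unit_ring). \<forall>T\<in>clopens (zariski unit_ring).
      (S \<subseteq> T \<longleftrightarrow> subobj_le C (\<Phi> S) (\<Phi> T)) \<and>
      \<Phi> (S \<inter> T) = subobj_Int C (\<Phi> S) (\<Phi> T) \<and>
      \<Phi> (S \<union> T) = subobj_sum C (\<Phi> S) (\<Phi> T))"
proof -
  interpret Z: cring unit_ring by (rule unit_ring_cring)
  let ?D = "basic_open unit_ring" and ?E = "inv_into (idempotents unit_ring) (basic_open unit_ring)"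
  let ?K = "clopens (zariski unit_ring)"
  note bij = Z.bij_basic_open[OF unit_ring_absolutely_flat]
  have E: "?E S \<in> idempotents unit_ring" "?D (?E S) = S" if "S \<in> ?K" for S
    using bij_betw_inv_into[OF bij] bij_betw_inv_into_right[OF bij that] that
    by (auto simp: bij_betw_def)
  have E_unique: "?E S = e" if "e \<in> idempotents unit_ring" "?D e = S" for e S
    using bij_betw_inv_into_left[OF bij that(1)] that(2) by simp
  have le: "?D e \<subseteq> ?D f \<longleftrightarrow> f \<cdot> e = e" if "e \<in> idempotents unit_ring" "f \<in> idempotents unit_ring" for e f
    using Z.basic_open_subset_iff[OF that] by (simp add: End_ring_def)
  show ?thesis
  proof (intro exI[of _ "split_monos \<circ> ?E"] conjI ballI)
    show "bij_betw (split_monos \<circ> ?E) ?K (subobjects C (tunit C))"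
      by (rule bij_betw_trans[OF bij_betw_inv_into[OF bij] bij_split_monos])
    fix S T assume S: "S \<in> ?K" and T: "T \<in> ?K"
    note ES = E[OF S] and ET = E[OF T]
    show "S \<subseteq> T \<longleftrightarrow> subobj_le C ((split_monos \<circ> ?E) S) ((split_monos \<circ> ?E) T)"
      using le[OF ES(1) ET(1)] ES(2) ET(2) subobj_le_split_monos[OF ES(1) ET(1)] by simp
    have "?D (?E S \<cdot> ?E T) = S \<inter> T"
      using Z.basic_open_mult[OF Z.idempotents_closed[OF ES(1)] Z.idempotents_closed[OF ET(1)]]
        ES(2) ET(2) by (simp add: End_ring_def)
    then have "?E (S \<inter> T) = ?E S \<cdot> ?E T"
      by (rule E_unique[OF idempotent_cmp(1)[OF ES(1) ET(1)]])
    then show "(split_monos \<circ> ?E) (S \<inter> T)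
        = subobj_Int C ((split_monos \<circ> ?E) S) ((split_monos \<circ> ?E) T)"
      using subobj_Int_split_monos[OF ES(1) ET(1)] by simp
    have U: "S \<union> T \<in> ?K" using S T by (simp add: clopens_def openin_Un closedin_Un)
    note EU = E[OF U]
    \<comment> \<open>The union is the least upper bound among clopen sets, and \<open>le\<close>
      carries this to the idempotents.\<close>
    have "subobj_sum C (split_monos (?E S)) (split_monos (?E T)) = split_monos (?E (S \<union> T))"
    proof (rule subobj_sum_split_monos[OF ES(1) ET(1) EU(1)])
      show "?E (S \<union> T) \<cdot> ?E S = ?E S" "?E (S \<union> T) \<cdot> ?E T = ?E T"
        using le[OF ES(1) EU(1)] le[OF ET(1) EU(1)] ES(2) ET(2) EU(2) by auto
      fix h assume h: "h \<in> idempotents unit_ring" "h \<cdot> ?E S = ?E S" "h \<cdot> ?E T = ?E T"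
      then show "h \<cdot> ?E (S \<union> T) = ?E (S \<union> T)"
        using le[OF ES(1) h(1)] le[OF ET(1) h(1)] le[OF EU(1) h(1)] ES(2) ET(2) EU(2) by auto
    qed
    then show "(split_monos \<circ> ?E) (S \<union> T)
        = subobj_sum C ((split_monos \<circ> ?E) S) ((split_monos \<circ> ?E) T)"
      by simp
  qed
qed

end

theorem proposition4p2:
  fixes A :: "('o, 'm) tensor_category"
  defines "Z \<equiv> End_ring A (tunit A)"
  defines "U \<equiv> subobjects A (tunit A)"
  assumes "rigid_abelian_tensor_category A"
  shows "absolutely_flat Z \<and>
    (\<exists>\<Phi>. bij_betw \<Phi> (clopens (zariski Z)) U \<and>
      (\<forall>S\<in>clopens (zariski Z). \<forall>T\<in>clopens (zariski Z).
        (S \<subseteq> T \<longleftrightarrow> subobj_le A (\<Phi> S) (\<Phi> T)) \<and>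
        \<Phi> (S \<inter> T) = subobj_Int A (\<Phi> S) (\<Phi> T) \<and>
        \<Phi> (S \<union> T) = subobj_sum A (\<Phi> S) (\<Phi> T)))"
proof -
  interpret rigid_abelian_tensor_category A by (rule assms(3))
  show ?thesis
    unfolding Z_def U_def
    using unit_ring_absolutely_flat clopens_subobjects_correspondence by blast
qed

end
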